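(* Let $k_1,k_2\ge 2$ be integers, set $d=k_1+k_2+1$ and fix $\alpha\in(0,\frac12)$. Then there exist compact sets $E,F\subset\mathbb{R}^d$ such that: (i) $\dim_{\mathrm H} D(E,F)\le 2\alpha<1$; (ii) for all $\theta\in[0,1]$, the Fourier spectra satisfy $$\dim_{\mathrm F}^{\theta}E\ge\min\{(k_1+1)\theta,\ k_1\theta+\alpha,\ k_1-1+\alpha\}$$ and $$\dim_{\mathrm F}^{\theta}F\ge\min\{(k_2+1)\theta,\ k_2\theta+\alpha,\ k_2-1+\alpha\}.$$
   Context: $D(E,F)=\{|x-y|:x\in E,\ y\in F\}$; $\dim_{\mathrm H}$ is Hausdorff dimension. For a finite Borel measure $\mu$ on $\mathbb{R}^d$, $\widehat\mu(z)=\int e^{-2\pi i z\cdot x}\,d\mu(x)$. For $s\ge 0$ define $$\mathcal{J}_{s,\theta}(\mu)=\left(\int_{\mathbb{R}^d}|\widehat\mu(z)|^{2/\theta}|z|^{s/\theta-d}\,dz\right)^{\theta}\ (\theta\in(0,1]),\qquad \mathcal{J}_{s,0}(\mu)=\sup_{z\in\mathbb{R}^d}|\widehat\mu(z)|^2|z|^s.$$ The Fourier spectrum of $\mu$ at $\theta\in[0,1]$ is $\dim_{\mathrm F}^{\theta}\mu=\sup\{s\ge 0:\mathcal{J}_{s,\theta}(\mu)<\infty\}$ (with $\sup\emptyset=0$). For a Borel set $E\subseteq\mathbb{R}^d$, $\dim_{\mathrm F}^{\theta}E=\sup\{\min\{\dim_{\mathrm F}^{\theta}\mu,d\}:\mu\in\mathcal{M}(E)\}$,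 where $\mathcal{M}(E)$ is the set of finite, non-zero Borel measures with support contained in $E$. *)

theory Defs
  imports "HOL-Analysis.Analysis"
begin

section \<open>Hausdorff dimension\<close>

text \<open>
  The usual conventions: the empty set contributes nothing, and every nonempty set
  contributes 1 when the exponent is 0 (in HOL, \<open>0 powr 0 = 0\<close>).
\<close>

definition diam_power :: "real \<Rightarrow> 'a::metric_space set \<Rightarrow> ennreal" where
  "diam_power s U =
     (if U = {} then 0 else if s = 0 then 1 else ennreal (diameter U powr s))"

text \<open>
  Covers consist of bounded sets because \<open>diameter\<close> is unspecified on unbounded ones.
  Finite covers are included, by padding with empty sets.
\<close>

definition hausdorff_premeasure :: "real \<Rightarrow> real \<Rightarrow> 'a::metric_space set \<Rightarrow> ennreal" where
  "hausdorff_premeasure s \<delta> A =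
     (INF U \<in> {U :: nat \<Rightarrow> 'a set. A \<subseteq> (\<Union>i. U i) \<and> (\<forall>i. bounded (U i) \<and> diameter (U i) \<le> \<delta>)}.
        \<Sum>i. diam_power s (U i))"

definition hausdorff_measure :: "real \<Rightarrow> 'a::metric_space set \<Rightarrow> ennreal" where
  "hausdorff_measure s A = (SUP \<delta>\<in>{0<..}. hausdorff_premeasure s \<delta> A)"

definition hausdorff_dim :: "'a::metric_space set \<Rightarrow> ennreal" where
  "hausdorff_dim A = (INF s \<in> {s. 0 \<le> s \<and> hausdorff_measure s A = 0}. ennreal s)"

section \<open>Distance sets\<close>

definition distance_set :: "'a::real_normed_vector set \<Rightarrow> 'a set \<Rightarrow> real set" where
  "distance_set E F = {norm (x - y) | x y. x \<in> E \<and> y \<in> F}"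

section \<open>Fourier spectrum of measures and sets\<close>

definition fourier_transform :: "'a::euclidean_space measure \<Rightarrow> 'a \<Rightarrow> complex" where
  "fourier_transform \<mu> z = (\<integral>x. exp (- 2 * of_real pi * \<i> * of_real (z \<bullet> x)) \<partial>\<mu>)"

definition ennreal_power :: "ennreal \<Rightarrow> real \<Rightarrow> ennreal" where
  "ennreal_power a p = (if a = \<infinity> then \<infinity> else ennreal (enn2real a powr p))"

text \<open>
  Only \<open>\<theta> \<in> {0..1}\<close> and \<open>s \<ge> 0\<close> are meaningful. The value of the integrand at \<open>z = 0\<close>
  is irrelevant because the origin is a null set. In the supremum, the factor
  \<open>norm z powr s\<close> is spelled out as 1 for \<open>s = 0\<close> so that it has its usual value at
  \<open>z = 0\<close> as well.
\<close>

definition fourier_energy :: "real \<Rightarrow> real \<Rightarrow> 'a::euclidean_space measure \<Rightarrow> ennreal" where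
  "fourier_energy s \<theta> \<mu> =
     (if \<theta> = 0
      then (SUP z. ennreal ((cmod (fourier_transform \<mu> z))\<^sup>2 * (if s = 0 then 1 else norm z powr s)))
      else ennreal_power
             (\<integral>\<^sup>+ z. ennreal (cmod (fourier_transform \<mu> z) powr (2 / \<theta>)
                               * norm z powr (s / \<theta> - real DIM('a))) \<partial>lborel) \<theta>)"

text \<open>The supremum of the empty set is 0 in \<open>ennreal\<close>, as intended; the value may be \<open>\<infinity>\<close>.\<close>

definition fourier_spectrum_measure :: "real \<Rightarrow> 'a::euclidean_space measure \<Rightarrow> ennreal" where
  "fourier_spectrum_measure \<theta> \<mu> = (SUP s \<in> {s. 0 \<le> s \<and> fourier_energy s \<theta> \<mu> < \<infinity>}. ennreal s)"

definition measure_support :: "'a::topological_space measure \<Rightarrow> 'a set" where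
  "measure_support \<mu> = {x. \<forall>U. open U \<longrightarrow> x \<in> U \<longrightarrow> emeasure \<mu> U > 0}"

definition measures_on :: "'a::topological_space set \<Rightarrow> 'a measure set" where
  "measures_on E = {\<mu>. sets \<mu> = sets borel \<and> finite_measure \<mu>
                       \<and> emeasure \<mu> UNIV \<noteq> 0 \<and> measure_support \<mu> \<subseteq> E}"

definition fourier_spectrum :: "real \<Rightarrow> 'a::euclidean_space set \<Rightarrow> ennreal" where
  "fourier_spectrum \<theta> E =
     (SUP \<mu> \<in> measures_on E. min (fourier_spectrum_measure \<theta> \<mu>) (of_nat DIM('a)))"

end

theory Submission
  imports Defs "HOL-Probability.Probability" "HOL-Computational_Algebra.Primes"
begin

text \<open>
The two sets are cylinders. Write the coordinates of \<open>\<real>\<^sup>d\<close> as a disjoint union of a block \<open>I1\<close> of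
size \<open>k1\<close>, a block \<open>I2\<close> of size \<open>k2\<close> and one further coordinate \<open>m\<close>. Let \<open>E\<close> consist of a unit
vector of the block \<open>I1\<close> plus a point of a compact set \<open>C\<close> placed on the \<open>m\<close>-axis, and \<open>F\<close> likewise
with \<open>I2\<close>. The two spheres are orthogonal, so all distances have the form \<open>sqrt (2 + (s - t)\<^sup>2)\<close>
with \<open>s, t \<in> C\<close> (\<open>distance_set_cylinders\<close>): the spheres give \<open>E\<close> and \<open>F\<close> Fourier decay but
do not contribute to the distance set.

The set \<open>C\<close> is a Kaufman set. For a rapidly increasing sequence of scales \<open>Q\<close>, it consists of the
points that lie within about \<open>Q powr (- 2 / \<alpha>)\<close> of a fraction with denominator in \<open>{Q..<2*Q}\<close>.
There are \<open>O(Q\<^sup>2)\<close> such fractions, hence \<open>O(Q\<^sup>4)\<close> pairs of them, and each scale covers the distance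
set by \<open>O(Q\<^sup>4)\<close> intervals of that length; this gives dimension at most \<open>2 * \<alpha>\<close>
(\<open>hausdorff_dim_kaufman_distances\<close>). Covering only at the scales \<open>Q\<close> suffices because the bound
concerns Hausdorff dimension. On the other hand \<open>C\<close> carries a probability
measure \<open>\<nu>\<close> whose Fourier transform is \<open>O(\<bar>t\<bar> powr (- \<alpha> / 2 + \<epsilon>))\<close> for every \<open>\<epsilon> > 0\<close>
(\<open>salem_measure\<close>): the \<open>n\<close>-th Fourier coefficient of the neighbourhood of the fractions at scale
\<open>Q\<close> only sees the denominators that divide \<open>n\<close>, and \<open>n\<close> has few divisors.

The measure on \<open>E\<close> is the product of \<open>\<nu>\<close> with the rotation-invariant measure on the sphere. The
latter decays like \<open>\<bar>\<xi>\<bar> powr (- (k - 1) / 2)\<close>, where \<open>k\<close> is the size of the block. This follows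
without stationary phase: rotation invariance turns the Fourier transform along a ray into a
solution of the radial Helmholtz equation, for which an energy is almost conserved
(\<open>sphere_cos_integral_decay\<close>).

For the energy integral with exponent \<open>s\<close>, the weight \<open>\<bar>z\<bar> powr (s / \<theta> - d)\<close> has to be shared between the
three groups of coordinates. The coordinates of the other block have no decay of their own and
use up \<open>k2\<close> of it; the block of the sphere needs \<open>max 0 (k - (k - 1) / \<theta>)\<close> and the coordinate \<open>m\<close>
needs \<open>max 0 (1 - \<alpha> / \<theta>)\<close>. These demands can be met exactly when \<open>s\<close> is below
\<open>(k + 1) * \<theta> - max 0 (k * \<theta> - (k - 1)) - max 0 (\<theta> - \<alpha>)\<close>, which is the minimum of the three
expressions in the theorem (\<open>energy_integral_finite\<close>). For \<open>\<theta> = 0\<close> the claimed bound is \<open>0\<close>.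
\<close>

section \<open>The divisor bound\<close>

lemma card_divisors_prime_power_mult_le:
  fixes p m a :: nat
  assumes "prime p" "m > 0"
  shows "card {q. q dvd p ^ a * m} \<le> (a + 1) * card {q. q dvd m}"
proof -
  have "{q. q dvd p ^ a * m} \<subseteq> (\<lambda>(i, e). p ^ i * e) ` ({0..a} \<times> {q. q dvd m})"
  proof
    fix q assume "q \<in> {q. q dvd p ^ a * m}"
    then obtain b c where bc: "q = b * c" "b dvd p ^ a" "c dvd m"
      using division_decomp by blast
    then obtain i where "i \<le> a" "b = p ^ i"
      using divides_primepow_nat[OF assms(1)] by blast
    with bc show "q \<in> (\<lambda>(i, e). p ^ i * e) ` ({0..a} \<times> {q. q dvd m})"
      by force
  qed
  moreover have fin: "finite {q. q dvd m}" using assms(2) by simp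
  ultimately have "card {q. q dvd p ^ a * m} \<le> card ((\<lambda>(i, e). p ^ i * e) ` ({0..a} \<times> {q. q dvd m}))"
    by (intro card_mono) auto
  also have "\<dots> \<le> card ({0..a} \<times> {q. q dvd m})"
    by (rule card_image_le) (use fin in auto)
  also have "\<dots> = (a + 1) * card {q. q dvd m}" by (simp add: card_cartesian_product)
  finally show ?thesis .
qed

text \<open>
The divisor function is submultiplicative over prime powers, so it suffices to compare \<open>a + 1\<close> with
\<open>p powr (a * \<epsilon>)\<close>. For primes with \<open>p powr \<epsilon> \<ge> 2\<close> this is \<open>a + 1 \<le> 2 ^ a\<close>; each of the finitely
many smaller primes costs a constant factor.
\<close>

lemma card_divisors_le_powr:
  fixes \<epsilon> :: real
  assumes "\<epsilon> > 0"
  shows "\<exists>C>0. \<forall>n::nat. n > 0 \<longrightarrow> real (card {q. q dvd n}) \<le> C * real n powr \<epsilon>"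
proof -
  \<comment> \<open>Primes from \<open>B\<close> on satisfy \<open>p powr \<epsilon> \<ge> 2\<close>; \<open>K\<close> is the price of a smaller prime.\<close>
  define B where "B = nat \<lceil>2 powr (1 / \<epsilon>)\<rceil>"
  define K where "K = max 1 (1 / (\<epsilon> * ln 2))"
  have K1: "K \<ge> 1" by (simp add: K_def)
  have small: "real (a + 1) \<le> K * real p powr (a * \<epsilon>)" if "prime p" for p a :: nat
  proof -
    have p2: "real p \<ge> 2" using prime_ge_2_nat[OF that] by simp
    have "K * (\<epsilon> * ln 2) \<ge> 1"
    proof -
      have "1 / (\<epsilon> * ln 2) \<le> K" by (simp add: K_def)
      moreover have "\<epsilon> * ln 2 > 0" using assms by simp
      ultimately show ?thesis by (simp add: field_simps)
    qed
    hence "real a * 1 \<le> real a * (K * (\<epsilon> * ln 2))" by (intro mult_left_mono) auto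
    hence "real (a + 1) \<le> K * (1 + a * \<epsilon> * ln 2)" using K1 by (simp add: algebra_simps)
    also have "1 + a * \<epsilon> * ln 2 \<le> exp (a * \<epsilon> * ln 2)" by (rule exp_ge_add_one_self)
    also have "exp (a * \<epsilon> * ln 2) = 2 powr (a * \<epsilon>)" by (simp add: powr_def)
    also have "2 powr (a * \<epsilon>) \<le> real p powr (a * \<epsilon>)"
      using p2 assms by (intro powr_mono2) auto
    finally show ?thesis using K1 by (simp add: mult_left_mono)
  qed
  have big: "real (a + 1) \<le> real p powr (a * \<epsilon>)" if "prime p" "p \<ge> B" for p a :: nat
  proof -
    have "2 powr (1 / \<epsilon>) \<le> real p" using that(2) unfolding B_def by linarith
    hence "(2 powr (1 / \<epsilon>)) powr \<epsilon> \<le> real p powr \<epsilon>" using assms by (intro powr_mono2) auto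
    hence pe: "2 \<le> real p powr \<epsilon>" using assms by (simp add: powr_powr)
    have "a + 1 \<le> 2 ^ a" by (induction a) auto
    hence "real (a + 1) \<le> real (2 ^ a)" by (simp only: of_nat_le_iff)
    also have "\<dots> = 2 ^ a" by simp
    also have "\<dots> \<le> (real p powr \<epsilon>) ^ a" using pe by (intro power_mono) auto
    also have "\<dots> = real p powr (a * \<epsilon>)"
      using pe prime_gt_0_nat[OF that(1)] by (subst powr_realpow[symmetric]) (auto simp: powr_powr mult.commute)
    finally show ?thesis .
  qed
  define S where "S n = {p. prime p \<and> p < B \<and> p dvd n}" for n :: nat
  have finS: "finite (S n)" for n by (rule finite_subset[of _ "{..<B}"]) (auto simp: S_def)
  have main: "real (card {q. q dvd n}) \<le> K ^ card (S n) * real n powr \<epsilon>" if "n > 0" for n :: nat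
    using that
  proof (induction n rule: less_induct)
    case (less n)
    show ?case
    proof (cases "n = 1")
      case True thus ?thesis using K1 by simp
    next
      case False
      then obtain p where p: "prime p" "p dvd n" using prime_factor_nat by blast
      then obtain m where m: "n = p ^ multiplicity p n * m" "\<not> p dvd m"
        using multiplicity_decompose'[of n p] less.prems prime_gt_1_nat[OF p(1)] by auto
      define a where "a = multiplicity p n"
      have n: "n = p ^ a * m" using m a_def by simp
      have a1: "a \<ge> 1" using p less.prems n m(2) by (cases a) auto
      have m0: "m > 0" using n less.prems by (cases m) auto
      have "p ^ a > 1" using p(1) a1 prime_gt_1_nat one_less_power by (metis less_le_trans zero_less_one)
      hence mn: "m < n" using m0 n by simp
      have d: "real (card {q. q dvd n}) \<le> real (a + 1) * real (card {q. q dvd m})"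
        using card_divisors_prime_power_mult_le[OF p(1) m0, of a] n
        by (metis of_nat_le_iff of_nat_mult)
      have IH: "real (card {q. q dvd m}) \<le> K ^ card (S m) * real m powr \<epsilon>"
        by (rule less.IH[OF mn m0])
      have npow: "real n powr \<epsilon> = real p powr (a * \<epsilon>) * real m powr \<epsilon>"
        using powr_realpow[of "real p" a] prime_gt_0_nat[OF p(1)]
        by (subst n) (simp add: powr_mult powr_powr flip: powr_realpow)
      have sub: "S m \<subseteq> S n" using n by (auto simp: S_def)
      have "real (a + 1) * K ^ card (S m) \<le> K ^ card (S n) * real p powr (a * \<epsilon>)"
      proof (cases "p < B")
        case True
        have "p \<in> S n" "p \<notin> S m" using True p m(2) by (auto simp: S_def)
        hence "card (insert p (S m)) \<le> card (S n)" using sub finS by (intro card_mono) auto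
        hence "Suc (card (S m)) \<le> card (S n)" using \<open>p \<notin> S m\<close> finS by simp
        hence "K ^ Suc (card (S m)) \<le> K ^ card (S n)" using K1 by (intro power_increasing) auto
        hence "K * real p powr (a * \<epsilon>) * K ^ card (S m) \<le> K ^ card (S n) * real p powr (a * \<epsilon>)"
          using mult_right_mono[of "K ^ Suc (card (S m))" "K ^ card (S n)" "real p powr (a * \<epsilon>)"]
          by (simp add: algebra_simps)
        moreover have "real (a + 1) * K ^ card (S m) \<le> K * real p powr (a * \<epsilon>) * K ^ card (S m)"
          using small[OF p(1), of a] K1 by (intro mult_right_mono) auto
        ultimately show ?thesis by linarith
      next
        case False
        have "K ^ card (S m) \<le> K ^ card (S n)"
          using K1 card_mono[OF finS sub] by (intro power_increasing) auto
        hence "real p powr (a * \<epsilon>) * K ^ card (S m) \<le> K ^ card (S n) * real p powr (a * \<epsilon>)"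
          by (subst mult.commute, intro mult_right_mono) auto
        moreover have "real (a + 1) * K ^ card (S m) \<le> real p powr (a * \<epsilon>) * K ^ card (S m)"
          using big[OF p(1), of a] False K1 by (intro mult_right_mono) auto
        ultimately show ?thesis by linarith
      qed
      hence fin: "real (a + 1) * K ^ card (S m) * real m powr \<epsilon> \<le> K ^ card (S n) * real p powr (a * \<epsilon>) * real m powr \<epsilon>"
        by (intro mult_right_mono) auto
      note d
      also have "real (a + 1) * real (card {q. q dvd m}) \<le> real (a + 1) * (K ^ card (S m) * real m powr \<epsilon>)"
        using IH by (intro mult_left_mono) auto
      also have "\<dots> \<le> K ^ card (S n) * real n powr \<epsilon>"
        using fin unfolding npow by (simp only: mult.assoc)
      finally show ?thesis .
    qed
  qed
  have "card (S n) \<le> B" for n using card_mono[of "{..<B}" "S n"] by (auto simp: S_def)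
  hence "K ^ card (S n) * real n powr \<epsilon> \<le> K ^ B * real n powr \<epsilon>" for n
    using K1 by (intro mult_right_mono power_increasing) auto
  thus ?thesis using main K1 by (intro exI[of _ "K ^ B"]) (auto intro: order_trans)
qed

section \<open>Cosine series of Lipschitz periodic functions\<close>

text \<open>
Bessel's inequality bounds the sum of the squared coefficients. It serves as the Riemann-Lebesgue
lemma for the system \<open>sin ((2 * n + 1) * (pi * u))\<close>.
\<close>

lemma bessel_tendsto_0:
  fixes g :: "'a \<Rightarrow> real" and s :: "nat \<Rightarrow> 'a \<Rightarrow> real"
  assumes g2: "integrable M (\<lambda>x. (g x)\<^sup>2)"
    and gs: "\<And>n. integrable M (\<lambda>x. g x * s n x)"
    and ss: "\<And>m n. integrable M (\<lambda>x. s m x * s n x)"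
    and ortho: "\<And>m n. (\<integral>x. s m x * s n x \<partial>M) = (if m = n then 1 else 0)"
  shows "(\<lambda>n. \<integral>x. g x * s n x \<partial>M) \<longlonglongrightarrow> 0"
proof -
  define b where "b n = (\<integral>x. g x * s n x \<partial>M)" for n
  have bound: "(\<Sum>n<N. (b n)\<^sup>2) \<le> (\<integral>x. (g x)\<^sup>2 \<partial>M)" for N
  proof -
    have expand: "(g x - (\<Sum>n<N. b n * s n x))\<^sup>2 =
        (g x)\<^sup>2 - 2 * (\<Sum>n<N. b n * (g x * s n x)) + (\<Sum>m<N. \<Sum>n<N. b m * b n * (s m x * s n x))" for x
    proof -
      have "(\<Sum>n<N. b n * s n x)\<^sup>2 = (\<Sum>m<N. \<Sum>n<N. b m * b n * (s m x * s n x))"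
        by (simp add: sum_product power2_eq_square mult_ac)
      moreover have "g x * (\<Sum>n<N. b n * s n x) = (\<Sum>n<N. b n * (g x * s n x))"
        by (simp add: sum_distrib_left mult_ac)
      ultimately show ?thesis by (simp add: power2_diff mult.assoc)
    qed
    have "0 \<le> (\<integral>x. (g x - (\<Sum>n<N. b n * s n x))\<^sup>2 \<partial>M)" by simp
    also have "\<dots> = (\<integral>x. (g x)\<^sup>2 - 2 * (\<Sum>n<N. b n * (g x * s n x))
        + (\<Sum>m<N. \<Sum>n<N. b m * b n * (s m x * s n x)) \<partial>M)" by (simp only: expand)
    also have "\<dots> = (\<integral>x. (g x)\<^sup>2 \<partial>M) - 2 * (\<Sum>n<N. b n * b n)
        + (\<Sum>m<N. \<Sum>n<N. b m * b n * (if m = n then 1 else 0))"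
      by (simp add: g2 gs ss ortho b_def Bochner_Integration.integral_add
          Bochner_Integration.integral_diff)
    also have "\<dots> = (\<integral>x. (g x)\<^sup>2 \<partial>M) - (\<Sum>n<N. (b n)\<^sup>2)"
      by (simp add: power2_eq_square if_distrib[of "\<lambda>x. _ * x"] sum.delta cong: if_cong)
    finally show ?thesis by simp
  qed
  have "summable (\<lambda>n. (b n)\<^sup>2)"
    by (rule summableI_nonneg_bounded[OF _ bound]) simp
  hence "(\<lambda>n. (b n)\<^sup>2) \<longlonglongrightarrow> 0" by (rule summable_LIMSEQ_zero)
  hence "(\<lambda>n. sqrt ((b n)\<^sup>2)) \<longlonglongrightarrow> sqrt 0" by (rule tendsto_real_sqrt)
  thus ?thesis unfolding b_def by (simp add: tendsto_rabs_zero_iff)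
qed

text \<open>
With \<open>y = x / 2\<close>, from \<open>y * cos y \<le> sin y\<close> and \<open>sin x = 2 * sin y * cos y\<close>.
\<close>

lemma sin_ge_half:
  fixes x :: real
  assumes "0 \<le> x" "x \<le> pi / 2"
  shows "x / 2 \<le> sin x"
proof -
  define y where "y = x / 2"
  have y: "0 \<le> y" "y \<le> pi / 4" using assms by (auto simp: y_def)
  have "sin 0 - 0 * cos 0 \<le> sin y - y * cos (y::real)"
  proof (rule DERIV_nonneg_imp_nondecreasing[OF y(1)])
    fix z assume z: "0 \<le> z" "z \<le> y"
    have "((\<lambda>y. sin y - y * cos y) has_real_derivative z * sin z) (at z)"
      by (auto intro!: derivative_eq_intros)
    moreover have "z * sin z \<ge> 0" using z y pi_gt_zero by (intro mult_nonneg_nonneg sin_ge_zero) linarith+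
    ultimately show "\<exists>l. ((\<lambda>y. sin y - y * cos y) has_real_derivative l) (at z) \<and> 0 \<le> l" by blast
  qed
  hence 1: "y * cos y \<le> sin y" by simp
  have c: "cos y \<ge> 0" using y pi_gt_zero by (intro cos_ge_zero) linarith+
  have "x / 2 \<le> y * (1 + cos x)"
  proof -
    have "cos x \<ge> 0" using assms pi_gt_zero by (intro cos_ge_zero) linarith+
    thus ?thesis using y mult_left_mono[of 1 "1 + cos x" y] by (simp add: y_def)
  qed
  also have "1 + cos x = 2 * (cos y)\<^sup>2" using cos_double_cos[of y] by (simp add: y_def)
  also have "y * (2 * (cos y)\<^sup>2) = 2 * (y * cos y) * cos y" by (simp add: power2_eq_square)
  also have "\<dots> \<le> 2 * sin y * cos y" using 1 c by (intro mult_right_mono) auto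
  also have "\<dots> = sin x" using sin_double[of y] by (simp add: y_def)
  finally show ?thesis .
qed

lemma integral_over_period:
  fixes g :: "real \<Rightarrow> real"
  assumes cont: "continuous_on UNIV g" and per: "\<And>x. g (x + 1) = g x"
  shows "integral {a..a + 1} g = integral {b..b + 1} g"
proof -
  have perm: "g (x + real_of_int m) = g x" for x m
  proof (induction m rule: int_induct[where k = 0])
    case (step1 i) thus ?case using per[of "x + real_of_int i"] by (simp add: add.assoc)
  next
    case (step2 i) thus ?case using per[of "x + real_of_int (i - 1)"] by (simp add: algebra_simps)
  qed simp
  have int: "g integrable_on {u..v}" for u v
    by (rule integrable_continuous_interval) (rule continuous_on_subset[OF cont], simp)
  have "integral {a..a + 1} g = integral {0..1} g" for a
  proof -
    define m where "m = \<lceil>a\<rceil>"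
    have m: "a \<le> real_of_int m" "real_of_int m \<le> a + 1" unfolding m_def by linarith+
    have "integral {a..m} g = integral {a + 1..m + 1} g"
      using integral_shift_real_ivl[where a = "a + 1" and c = 1 and b = "m + 1" and f = g] per by simp
    moreover have "integral {a..m} g + integral {m..a+1} g = integral {a..a+1} g"
      by (rule Henstock_Kurzweil_Integration.integral_combine) (use m int in auto)
    moreover have "integral {m..a+1} g + integral {a+1..m+1} g = integral {m..m+1} g"
      by (rule Henstock_Kurzweil_Integration.integral_combine) (use m int in auto)
    moreover have "integral {0..1} g = integral {m..m+1} g"
      using integral_shift_real_ivl[where a = m and c = m and b = "m + 1" and f = g] perm by simp
    ultimately show ?thesis by simp
  qed
  thus ?thesis by simp
qed

lemma dirichlet_kernel:
  fixes u :: real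
  shows "(1 + 2 * (\<Sum>n<N. cos (2 * pi * real (Suc n) * u))) * sin (pi * u) = sin ((2 * real N + 1) * (pi * u))"
proof (induction N)
  case (Suc N)
  define A B where "A = 2 * pi * real (Suc N) * u" and "B = pi * u"
  have "2 * cos A * sin B = sin (A + B) - sin (A - B)" by (simp add: sin_add sin_diff)
  moreover have "A + B = (2 * real (Suc N) + 1) * (pi * u)" "A - B = (2 * real N + 1) * (pi * u)"
    by (simp_all add: A_def B_def algebra_simps)
  ultimately show ?case using Suc by (simp add: algebra_simps A_def B_def)
qed simp

abbreviation period_measure :: "real measure" where
  "period_measure \<equiv> restrict_space lborel {-1/2..1/2}"

lemma period_measure_integral:
  fixes f :: "real \<Rightarrow> real"
  assumes "continuous_on {-1/2..1/2} f"
  shows "integrable period_measure f" "integral\<^sup>L period_measure f = integral {-1/2..1/2} f"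
proof -
  have "set_integrable lborel {-1/2..1/2} f" by (rule borel_integrable_atLeastAtMost'[OF assms])
  from this set_borel_integral_eq_integral[OF this] show "integrable period_measure f"
    "integral\<^sup>L period_measure f = integral {-1/2..1/2} f"
    by (simp_all add: integrable_restrict_space integral_restrict_space set_integrable_def set_lebesgue_integral_def)
qed

lemma period_measure_cos:
  fixes j :: int
  shows "integral\<^sup>L period_measure (\<lambda>u. cos (2 * pi * real_of_int j * u)) = (if j = 0 then 1 else 0)"
proof (cases "j = 0")
  case True
  thus ?thesis by (subst period_measure_integral) auto
next
  case False
  have "((\<lambda>u. cos (2 * pi * j * u)) has_integral
      (sin (2 * pi * j * (1/2)) / (2 * pi * j) - sin (2 * pi * j * (-1/2)) / (2 * pi * j))) {-1/2..1/2}"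
    by (rule fundamental_theorem_of_calculus)
      (use False in \<open>auto intro!: derivative_eq_intros simp flip: has_real_derivative_iff_has_vector_derivative\<close>)
  moreover have "sin (pi * real_of_int j) = 0" by (metis mult.commute sin_zero_iff_int2)
  ultimately show ?thesis using False
    by (subst period_measure_integral) (auto intro!: continuous_intros integral_unique simp: mult_ac)
qed

text \<open>
The error of the partial sum at \<open>x\<close> is the integral of \<open>(f (x + u) - f x) * D N u\<close> with the Dirichlet
kernel \<open>D N u = sin ((2 * N + 1) * (pi * u)) / sin (pi * u)\<close>. As \<open>f\<close> is Lipschitz, the quotient
\<open>g u = (f (x + u) - f x) / sin (pi * u)\<close> is bounded, so the errors are the coefficients of \<open>g\<close>
in an orthogonal system and tend to 0.
\<close>

lemma fourier_cosine_series:
  fixes f :: "real \<Rightarrow> real"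
  assumes per: "\<And>x. f (x + 1) = f x" and even: "\<And>x. f (- x) = f x"
    and lip: "\<And>x y. \<bar>f x - f y\<bar> \<le> L * \<bar>x - y\<bar>"
  defines "a \<equiv> \<lambda>n::nat. integral {-1/2..1/2} (\<lambda>u. f u * cos (2 * pi * real n * u))"
  shows "(\<lambda>n. 2 * (a (Suc n) * cos (2 * pi * real (Suc n) * x))) sums (f x - a 0)"
proof -
  have cont: "continuous_on UNIV f"
  proof (rule continuous_on_iff[THEN iffD2], intro ballI allI impI)
    fix x and e :: real assume "e > 0"
    have L0: "L \<ge> 0" using lip[of 1 0] by simp
    show "\<exists>d>0. \<forall>x'\<in>UNIV. dist x' x < d \<longrightarrow> dist (f x') (f x) < e"
    proof (intro exI[of _ "e / (L + 1)"] conjI ballI impI)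
      show "e / (L + 1) > 0" using \<open>e > 0\<close> L0 by simp
      fix x' assume "dist x' x < e / (L + 1)"
      hence "(L + 1) * \<bar>x' - x\<bar> < e" using L0 by (simp add: dist_real_def field_simps)
      moreover have "L * \<bar>x' - x\<bar> \<le> (L + 1) * \<bar>x' - x\<bar>" by (simp add: mult_right_mono)
      ultimately show "dist (f x') (f x) < e" using lip[of x' x] by (simp add: dist_real_def)
    qed
  qed
  note contf = continuous_on_compose2[OF cont]
  have shift: "integral {-1/2..1/2} (\<lambda>u. f (x + u) * cos (2 * pi * real n * u)) = a n * cos (2 * pi * real n * x)" for n
  proof -
    define G where "G v = f v * cos (2 * pi * real n * (v - x))" for v
    have "cos (2 * pi * real n * (v + 1 - x)) = cos (2 * pi * real n * (v - x))" for v
    proof -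
      have "cos (2 * pi * real n * (v + 1 - x)) = cos (2 * pi * real n * (v - x) + 2 * pi * real n)"
        by (simp add: algebra_simps)
      also have "\<dots> = cos (2 * pi * real n * (v - x))"
        using cos_int_2pin[of "int n"] sin_int_2pin[of "int n"] by (simp add: cos_add)
      finally show ?thesis .
    qed
    hence perG: "G (v + 1) = G v" for v by (simp add: G_def per)
    have contG: "continuous_on UNIV G" unfolding G_def by (intro continuous_intros contf) auto
    have "integral {-1/2..1/2} (\<lambda>u. f (x + u) * cos (2 * pi * real n * u)) = integral {-1/2..1/2} (\<lambda>u. G (u + x))"
      by (simp add: G_def add.commute)
    also have "\<dots> = integral {x - 1/2..(x - 1/2) + 1} G"
      using integral_shift_real_ivl[where a = "x - 1/2" and c = x and b = "x + 1/2" and f = G] by (simp add: add.commute)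
    also have "\<dots> = integral {-1/2..-1/2+1} G"
      by (rule integral_over_period[OF contG perG])
    also have "{-1/2..-1/2+1} = {-1/2..1/2::real}" by simp
    also have "integral {-1/2..1/2} G = integral {-1/2..1/2} (\<lambda>v. cos (2 * pi * real n * x) * (f v * cos (2 * pi * real n * v))
        + sin (2 * pi * real n * x) * (f v * sin (2 * pi * real n * v)))"
      by (rule Henstock_Kurzweil_Integration.integral_cong) (simp add: G_def right_diff_distrib cos_diff algebra_simps)
    also have "\<dots> = cos (2 * pi * real n * x) * a n
        + sin (2 * pi * real n * x) * integral {-1/2..1/2} (\<lambda>v. f v * sin (2 * pi * real n * v))"
      unfolding a_def
      by (subst Henstock_Kurzweil_Integration.integral_add)
        (auto intro!: integrable_continuous_interval continuous_intros contf)
    also have "integral {-1/2..1/2} (\<lambda>v. f v * sin (2 * pi * real n * v)) = 0"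
    proof -
      have "integral {-1/2..1/2} (\<lambda>v. f v * sin (2 * pi * real n * v))
          = integral {-1/2..1/2} (\<lambda>v. - (f v * sin (2 * pi * real n * v)))"
        using Henstock_Kurzweil_Integration.integral_reflect_real[of "1/2" "-1/2" "\<lambda>v. f v * sin (2 * pi * real n * v)"] even by simp
      thus ?thesis by simp
    qed
    finally show ?thesis by simp
  qed
  define D where "D N u = 1 + 2 * (\<Sum>n<N. cos (2 * pi * real (Suc n) * u))" for N and u :: real
  define g where "g u = (f (x + u) - f x) / sin (pi * u)" for u
  have g_bound: "\<bar>g u\<bar> \<le> L" if "u \<in> {-1/2..1/2}" for u
  proof (cases "u = 0")
    case False
    have "sin (pi * \<bar>u\<bar>) \<ge> 0" using that pi_gt_zero mult_left_mono[of "\<bar>u\<bar>" 1 pi]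
      by (intro sin_ge_zero) (auto simp: abs_if)
    hence "\<bar>sin (pi * u)\<bar> = sin (pi * \<bar>u\<bar>)" by (cases "u \<ge> 0") auto
    moreover have "pi * \<bar>u\<bar> / 2 \<le> sin (pi * \<bar>u\<bar>)"
      using that by (intro sin_ge_half) (auto simp: abs_if)
    moreover have "\<bar>u\<bar> \<le> pi * \<bar>u\<bar> / 2" using pi_ge_two mult_right_mono[of 2 pi "\<bar>u\<bar>"] by simp
    ultimately have "\<bar>u\<bar> \<le> \<bar>sin (pi * u)\<bar>" by linarith
    moreover have "\<bar>f (x + u) - f x\<bar> \<le> L * \<bar>u\<bar>" using lip[of "x + u" x] by simp
    moreover have "L \<ge> 0" using lip[of 1 0] by simp
    ultimately have "\<bar>f (x + u) - f x\<bar> \<le> L * \<bar>sin (pi * u)\<bar>"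
      by (meson mult_left_mono order_trans)
    thus ?thesis using False \<open>\<bar>u\<bar> \<le> \<bar>sin (pi * u)\<bar>\<close>
      by (auto simp: g_def abs_div divide_simps)
  qed (use lip[of 1 0] in \<open>simp add: g_def\<close>)
  \<comment> \<open>At \<open>u = 0\<close> both sides vanish, as division by 0 gives 0.\<close>
  have g_sin: "g u * sin ((2 * real N + 1) * (pi * u)) = (f (x + u) - f x) * D N u" if "u \<in> {-1/2..1/2}" for u N
  proof (cases "u = 0")
    case False
    have "sin (pi * u) \<noteq> 0"
    proof
      assume "sin (pi * u) = 0"
      then obtain i :: int where "pi * u = i * pi" using sin_zero_iff_int2 by blast
      hence ui: "u = i" by simp
      have "\<bar>u\<bar> \<le> 1 / 2" using that by auto
      hence "i = 0" unfolding ui by linarith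
      with ui False show False by simp
    qed
    moreover have "D N u * sin (pi * u) = sin ((2 * real N + 1) * (pi * u))"
      unfolding D_def by (rule dirichlet_kernel)
    ultimately show ?thesis unfolding g_def by (metis (no_types, lifting) mult.commute nonzero_eq_divide_eq times_divide_eq_left times_divide_eq_right)
  qed (simp add: g_def)
  define s where "s n u = sqrt 2 * sin ((2 * real n + 1) * (pi * u))" for n and u :: real
  have finite_period: "finite_measure period_measure"
    by (rule finite_measureI) (simp add: emeasure_restrict_space space_restrict_space)
  have s_prod: "s m u * s n u = cos (2 * pi * real_of_int (int m - int n) * u)
      - cos (2 * pi * real_of_int (int m + int n + 1) * u)" for m n u
  proof -
    define A B where "A = (2 * real m + 1) * (pi * u)" and "B = (2 * real n + 1) * (pi * u)"
    have "s m u * s n u = 2 * (sin A * sin B)" by (simp add: s_def A_def B_def mult.assoc mult.left_commute)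
    also have "\<dots> = cos (A - B) - cos (A + B)" by (simp add: cos_add cos_diff)
    finally show ?thesis by (simp add: A_def B_def algebra_simps)
  qed
  have gm: "g \<in> borel_measurable borel" unfolding g_def
    using borel_measurable_continuous_onI[OF cont] by measurable
  have lim: "(\<lambda>n. \<integral>u. g u * s n u \<partial>period_measure) \<longlonglongrightarrow> 0"
  proof (rule bessel_tendsto_0)
    interpret finite_measure period_measure by (rule finite_period)
    have gm': "g \<in> borel_measurable period_measure" using gm by (simp add: measurable_restrict_space1)
    have sm: "s n \<in> borel_measurable period_measure" for n
      unfolding s_def by (intro measurable_restrict_space1) measurable
    have L0: "L \<ge> 0" using lip[of 1 0] by simp
    show "integrable period_measure (\<lambda>x. (g x)\<^sup>2)"
      using g_bound gm' L0 by (intro integrable_const_bound[where B = "L\<^sup>2"])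
        (auto intro!: AE_I2 simp: space_restrict_space abs_le_square_iff[symmetric])
    have sb: "\<bar>s n u\<bar> \<le> sqrt 2" for n u by (simp add: s_def abs_mult)
    show "integrable period_measure (\<lambda>x. g x * s n x)" for n
      using g_bound gm' sm L0 sb by (intro integrable_const_bound[where B = "L * sqrt 2"])
        (auto intro!: AE_I2 mult_mono simp: space_restrict_space abs_mult)
    show "integrable period_measure (\<lambda>x. s m x * s n x)" for m n
      unfolding s_def by (intro period_measure_integral continuous_intros)
    show "(\<integral>x. s m x * s n x \<partial>period_measure) = (if m = n then 1 else 0)" for m n
      unfolding s_prod
      by (subst Bochner_Integration.integral_diff)
        (simp_all only: period_measure_cos period_measure_integral continuous_intros; simp)+
  qed
  have partial: "(\<integral>u. g u * s N u \<partial>period_measure)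
      = sqrt 2 * (a 0 + (\<Sum>n<N. 2 * (a (Suc n) * cos (2 * pi * real (Suc n) * x))) - f x)" for N
  proof -
    have h1: "((\<lambda>u. f (x + u) * cos (2 * pi * real n * u)) has_integral a n * cos (2 * pi * real n * x)) {-1/2..1/2}" for n
      unfolding shift[symmetric]
      by (intro integrable_integral integrable_continuous_interval continuous_intros contf) simp
    have "((\<lambda>u. cos (2 * pi * real (Suc n) * u)) has_integral 0) {-1/2..1/2}" for n
    proof -
      have "integral {-1/2..1/2} (\<lambda>u. cos (2 * pi * real (Suc n) * u)) = 0"
        using period_measure_cos[of "int (Suc n)"]
        by (subst period_measure_integral(2)[symmetric]) (auto intro!: continuous_intros)
      moreover have "(\<lambda>u. cos (2 * pi * real (Suc n) * u)) integrable_on {-1/2..1/2}"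
        by (intro integrable_continuous_interval continuous_intros)
      ultimately show ?thesis by (simp add: has_integral_iff)
    qed
    from has_integral_mult_right[OF this, of "f x"]
    have h2: "((\<lambda>u. f x * cos (2 * pi * real (Suc n) * u)) has_integral 0) {-1/2..1/2}" for n by simp
    have h3: "((\<lambda>u::real. f x) has_integral f x) {-1/2..1/2}"
      using has_integral_const_real[of "f x" "-1/2" "1/2"] by simp
    have h: "((\<lambda>u. (f (x + u) * cos (2 * pi * real 0 * u) - f x)
          + (\<Sum>n<N. 2 * (f (x + u) * cos (2 * pi * real (Suc n) * u) - f x * cos (2 * pi * real (Suc n) * u))))
       has_integral (a 0 * cos (2 * pi * real 0 * x) - f x)
          + (\<Sum>n<N. 2 * (a (Suc n) * cos (2 * pi * real (Suc n) * x) - 0))) {-1/2..1/2}"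
      by (intro has_integral_add has_integral_diff has_integral_sum has_integral_mult_right h1 h2 h3) simp
    have "(\<integral>u. g u * s N u \<partial>period_measure) = (\<integral>u. sqrt 2 * ((f (x + u) - f x) * D N u) \<partial>period_measure)"
      by (rule Bochner_Integration.integral_cong)
        (auto simp: space_restrict_space s_def g_sin[symmetric])
    also have "\<dots> = integral {-1/2..1/2} (\<lambda>u. sqrt 2 * ((f (x + u) - f x) * D N u))"
      unfolding D_def by (rule period_measure_integral) (intro continuous_intros contf; simp)
    also have "\<dots> = sqrt 2 * integral {-1/2..1/2} (\<lambda>u. (f (x + u) - f x) * D N u)" by simp
    also have "(\<lambda>u. (f (x + u) - f x) * D N u)
       = (\<lambda>u. (f (x + u) * cos (2 * pi * real 0 * u) - f x)
          + (\<Sum>n<N. 2 * (f (x + u) * cos (2 * pi * real (Suc n) * u) - f x * cos (2 * pi * real (Suc n) * u))))"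
      by (simp add: D_def algebra_simps sum_distrib_left sum_subtractf sum_distrib_right)
    also have "integral {-1/2..1/2} \<dots> = (a 0 * cos (2 * pi * real 0 * x) - f x)
          + (\<Sum>n<N. 2 * (a (Suc n) * cos (2 * pi * real (Suc n) * x) - 0))"
      using h by (rule integral_unique)
    finally show ?thesis by (simp add: algebra_simps)
  qed
  have "(\<lambda>N. (\<integral>u. g u * s N u \<partial>period_measure) / sqrt 2 + (f x - a 0)) \<longlonglongrightarrow> 0 / sqrt 2 + (f x - a 0)"
    by (intro tendsto_intros lim) auto
  thus ?thesis unfolding sums_def partial by simp
qed

section \<open>Neighbourhoods of the fractions with denominators of size Q\<close>

text \<open>
Normalized to have integral 1.
\<close>

definition tent :: "real \<Rightarrow> real \<Rightarrow> real" where
  "tent \<delta> x = max 0 (1 - \<bar>x\<bar> / \<delta>) / \<delta>"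

text \<open>
The Fourier transform of the tent at the frequency \<open>t\<close>.
\<close>

definition tent_coeff :: "real \<Rightarrow> real \<Rightarrow> real" where
  "tent_coeff \<delta> t = (if t = 0 then 1 else (1 - cos (2 * pi * t * \<delta>)) / (2 * pi\<^sup>2 * t\<^sup>2 * \<delta>\<^sup>2))"

lemma tent_cos_has_integral:
  assumes "\<delta> > 0" "\<delta> \<le> b"
  shows "((\<lambda>x. tent \<delta> x * cos (2 * pi * t * x)) has_integral tent_coeff \<delta> t) {-b..b}"
proof -
  define f where "f x = tent \<delta> x * cos (2 * pi * t * x)" for x
  have half: "((\<lambda>x. (1 - x / \<delta>) / \<delta> * cos (2 * pi * t * x)) has_integral tent_coeff \<delta> t / 2) {0..\<delta>}"
  proof (cases "t = 0")
    case True
    have "((\<lambda>x. (1 - x / \<delta>) / \<delta>) has_integral ((\<delta> - \<delta>\<^sup>2 / (2 * \<delta>)) / \<delta> - (0 - 0\<^sup>2 / (2 * \<delta>)) / \<delta>)) {0..\<delta>}"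
      by (rule fundamental_theorem_of_calculus)
        (use assms in \<open>auto intro!: derivative_eq_intros simp: field_simps simp flip: has_real_derivative_iff_has_vector_derivative\<close>)
    thus ?thesis using True assms by (simp add: tent_coeff_def power2_eq_square field_simps)
  next
    case False
    define w where "w = 2 * pi * t"
    have w: "w \<noteq> 0" using False by (simp add: w_def)
    define G where "G x = ((1 - x / \<delta>) * sin (w * x) / w - cos (w * x) / (\<delta> * w\<^sup>2)) / \<delta>" for x
    have "((\<lambda>x. (1 - x / \<delta>) / \<delta> * cos (w * x)) has_integral G \<delta> - G 0) {0..\<delta>}"
    proof (rule fundamental_theorem_of_calculus)
      fix x assume "x \<in> {0..\<delta>}"
      have "(G has_real_derivative (1 - x / \<delta>) / \<delta> * cos (w * x)) (at x)"
        unfolding G_def using assms w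
        by (auto intro!: derivative_eq_intros simp: field_simps power2_eq_square)
      thus "(G has_vector_derivative (1 - x / \<delta>) / \<delta> * cos (w * x)) (at x within {0..\<delta>})"
        by (simp add: has_real_derivative_iff_has_vector_derivative[symmetric] has_field_derivative_at_within)
    qed (use assms in simp)
    moreover have "G \<delta> - G 0 = tent_coeff \<delta> t / 2"
      using assms w False by (simp add: G_def tent_coeff_def w_def field_simps power2_eq_square)
    ultimately show ?thesis by (simp add: w_def)
  qed
  have right: "(f has_integral tent_coeff \<delta> t / 2) {0..\<delta>}"
    using half by (rule has_integral_eq[rotated]) (use assms in \<open>auto simp: f_def tent_def max_def\<close>)
  have "(f has_integral tent_coeff \<delta> t / 2) {-\<delta>..-0}"
  proof -
    have "((\<lambda>x. f (-x)) has_integral tent_coeff \<delta> t / 2) {-\<delta>..-0}"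
      using right by (subst has_integral_reflect_real)
    moreover have "(\<lambda>x. f (-x)) = f" by (rule ext) (simp add: f_def tent_def)
    ultimately show ?thesis by simp
  qed
  hence "(f has_integral tent_coeff \<delta> t / 2 + tent_coeff \<delta> t / 2) {-\<delta>..\<delta>}"
    by (intro has_integral_combine[where c = 0] right) (use assms in auto)
  hence "(f has_integral tent_coeff \<delta> t) {-\<delta>..\<delta>}" by simp
  hence "(f has_integral tent_coeff \<delta> t) {-b..b}"
    by (rule has_integral_on_superset) (use assms in \<open>auto simp: f_def tent_def field_simps abs_if max_def\<close>)
  thus ?thesis unfolding f_def .
qed

lemma tent_coeff_nonneg: "tent_coeff \<delta> t \<ge> 0"
  by (simp add: tent_coeff_def)

lemma tent_coeff_sin:
  assumes "t \<noteq> 0"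
  shows "tent_coeff \<delta> t = (sin (pi * t * \<delta>))\<^sup>2 / (pi * t * \<delta>)\<^sup>2"
proof -
  have "1 - cos (2 * pi * t * \<delta>) = 2 * (sin (pi * t * \<delta>))\<^sup>2"
    using cos_double_sin[of "pi * t * \<delta>"] by (simp add: mult.assoc)
  thus ?thesis using assms by (simp add: tent_coeff_def power_mult_distrib)
qed

lemma tent_coeff_le_1:
  assumes "\<delta> > 0" shows "tent_coeff \<delta> t \<le> 1"
proof (cases "t = 0")
  case False
  have "(sin (pi * t * \<delta>))\<^sup>2 \<le> (pi * t * \<delta>)\<^sup>2"
    using abs_sin_x_le_abs_x[of "pi * t * \<delta>"] by (simp only: abs_le_square_iff)
  thus ?thesis using False assms by (simp add: tent_coeff_sin divide_le_eq)
qed (simp add: tent_coeff_def)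

lemma tent_coeff_le_square:
  assumes "\<delta> > 0" "t \<noteq> 0" shows "tent_coeff \<delta> t \<le> (1 / (\<delta> * t))\<^sup>2"
proof -
  have "(sin (pi * t * \<delta>))\<^sup>2 \<le> 1" by (simp add: abs_square_le_1)
  hence "tent_coeff \<delta> t \<le> 1 / (pi * t * \<delta>)\<^sup>2"
    using assms by (simp add: tent_coeff_sin divide_right_mono)
  also have "\<dots> \<le> 1 / (t * \<delta>)\<^sup>2"
  proof -
    have "1 \<le> pi\<^sup>2" using pi_ge_two by (intro one_le_power) simp
    hence "(t * \<delta>)\<^sup>2 \<le> (pi * t * \<delta>)\<^sup>2"
      using mult_right_mono[of 1 "pi\<^sup>2" "(t * \<delta>)\<^sup>2"] by (simp add: power_mult_distrib mult.assoc)
    thus ?thesis using assms by (intro divide_left_mono) auto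
  qed
  also have "\<dots> = (1 / (\<delta> * t))\<^sup>2" by (simp add: power_divide mult.commute)
  finally show ?thesis .
qed

definition int_dist :: "real \<Rightarrow> real" where
  "int_dist x = \<bar>x - of_int (round x)\<bar>"

lemma int_dist_le: "int_dist x \<le> \<bar>x - of_int m\<bar>"
  unfolding int_dist_def using round_diff_minimal[of x m] by simp

lemma int_dist_le_half: "int_dist x \<le> 1 / 2"
  unfolding int_dist_def using of_int_round_abs_le[of x] by (simp add: abs_minus_commute)

lemma int_dist_lipschitz: "\<bar>int_dist x - int_dist y\<bar> \<le> \<bar>x - y\<bar>"
  using int_dist_le[of x "round y"] int_dist_le[of y "round x"] unfolding int_dist_def by linarith

lemma int_dist_plus_1: "int_dist (x + 1) = int_dist x"
  using int_dist_le[of x "round (x + 1) - 1"] int_dist_le[of "x + 1" "round x + 1"]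
  unfolding int_dist_def by simp

lemma int_dist_minus: "int_dist (- x) = int_dist x"
  using int_dist_le[of x "- round (- x)"] int_dist_le[of "- x" "- round x"]
  unfolding int_dist_def by simp

text \<open>
Over the period \<open>{-1/2..1/2}\<close>, composing with \<open>int_dist\<close> leaves the tent unchanged, so the two have the same
coefficients.
\<close>

lemma int_dist_eq_abs: "\<bar>x\<bar> \<le> 1 / 2 \<Longrightarrow> int_dist x = \<bar>x\<bar>"
proof -
  assume x: "\<bar>x\<bar> \<le> 1 / 2"
  have "\<bar>x\<bar> \<le> \<bar>x - of_int m\<bar>" for m :: int
  proof (cases "m = 0")
    case False
    hence "1 \<le> \<bar>real_of_int m\<bar>" by linarith
    thus ?thesis using x by linarith
  qed simp
  thus ?thesis using int_dist_le[of x 0] by (simp add: int_dist_def order_antisym)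
qed

lemma tent_lipschitz:
  assumes "\<delta> > 0" shows "\<bar>tent \<delta> x - tent \<delta> y\<bar> \<le> (1 / \<delta>\<^sup>2) * \<bar>x - y\<bar>"
proof -
  have "\<bar>max 0 (1 - \<bar>x\<bar> / \<delta>) - max 0 (1 - \<bar>y\<bar> / \<delta>)\<bar> \<le> \<bar>\<bar>x\<bar> / \<delta> - \<bar>y\<bar> / \<delta>\<bar>" by linarith
  also have "\<dots> = \<bar>\<bar>x\<bar> - \<bar>y\<bar>\<bar> / \<delta>" using assms by (simp add: diff_divide_distrib[symmetric] abs_divide)
  also have "\<dots> \<le> \<bar>x - y\<bar> / \<delta>" using assms by (intro divide_right_mono) auto
  finally have "\<bar>max 0 (1 - \<bar>x\<bar> / \<delta>) - max 0 (1 - \<bar>y\<bar> / \<delta>)\<bar> / \<delta> \<le> \<bar>x - y\<bar> / \<delta> / \<delta>"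
    using assms by (intro divide_right_mono) auto
  thus ?thesis using assms by (simp add: tent_def diff_divide_distrib[symmetric] abs_divide power2_eq_square)
qed

lemma tent_nonneg: "\<delta> > 0 \<Longrightarrow> tent \<delta> x \<ge> 0"
  by (simp add: tent_def)

lemma tent_le: "\<delta> > 0 \<Longrightarrow> tent \<delta> x \<le> 1 / \<delta>"
  unfolding tent_def by (intro divide_right_mono) auto

lemma tent_eq_0: "\<delta> > 0 \<Longrightarrow> \<delta> \<le> \<bar>x\<bar> \<Longrightarrow> tent \<delta> x = 0"
  by (simp add: tent_def max_def)

lemma tent_abs: "tent \<delta> \<bar>x\<bar> = tent \<delta> x"
  by (simp add: tent_def)

lemma periodic_tent_series:
  assumes d: "0 < \<delta>" "\<delta> \<le> 1 / 2"
  shows "(\<lambda>n. 2 * (tent_coeff \<delta> (real (Suc n)) * cos (2 * pi * real (Suc n) * x))) sums (tent \<delta> (int_dist x) - 1)"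
proof -
  define f where "f x = tent \<delta> (int_dist x)" for x
  have coeff: "integral {-1/2..1/2} (\<lambda>u. f u * cos (2 * pi * real n * u)) = tent_coeff \<delta> (real n)" for n
  proof -
    have "integral {-(1/2)..1/2} (\<lambda>u. f u * cos (2 * pi * real n * u))
        = integral {-(1/2)..1/2} (\<lambda>u. tent \<delta> u * cos (2 * pi * real n * u))"
      by (rule Henstock_Kurzweil_Integration.integral_cong) (auto simp: f_def int_dist_eq_abs abs_le_iff tent_abs)
    thus ?thesis using tent_cos_has_integral[OF d, of "real n"] by (simp add: integral_unique)
  qed
  have "\<bar>f x - f y\<bar> \<le> (1 / \<delta>\<^sup>2) * \<bar>x - y\<bar>" for x y
  proof -
    have "\<bar>f x - f y\<bar> \<le> (1 / \<delta>\<^sup>2) * \<bar>int_dist x - int_dist y\<bar>"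
      unfolding f_def by (rule tent_lipschitz[OF d(1)])
    also have "\<dots> \<le> (1 / \<delta>\<^sup>2) * \<bar>x - y\<bar>" by (intro mult_left_mono int_dist_lipschitz) simp
    finally show ?thesis .
  qed
  from fourier_cosine_series[of f, OF _ _ this, of x, unfolded coeff]
  show ?thesis by (simp add: f_def int_dist_plus_1 int_dist_minus tent_coeff_def[of _ 0])
qed

text \<open>
A normalized sum of tents of width \<open>\<delta> / q\<close> around all the fractions \<open>a / q\<close> with \<open>q \<in> {Q..<2*Q}\<close>.
\<close>

definition comb :: "real \<Rightarrow> nat \<Rightarrow> real \<Rightarrow> real" where
  "comb \<delta> Q x = (\<Sum>q\<in>{Q..<2*Q}. tent \<delta> (int_dist (real q * x))) / real Q"

text \<open>
For \<open>n > 0\<close>, half of the coefficient of \<open>cos (2 * pi * n * x)\<close> in \<open>comb\<close>.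
\<close>

definition comb_coeff :: "real \<Rightarrow> nat \<Rightarrow> nat \<Rightarrow> real" where
  "comb_coeff \<delta> Q n = (\<Sum>q\<in>{q\<in>{Q..<2*Q}. q dvd n}. tent_coeff \<delta> (real (n div q))) / real Q"

text \<open>
The tent pulled back along multiplication by \<open>q\<close> only has the frequencies divisible by \<open>q\<close>. This is
what makes the coefficients of the comb small: a frequency \<open>n\<close> is met by \<open>q\<close> only if \<open>q dvd n\<close>.
\<close>

lemma comb_series:
  assumes d: "0 < \<delta>" "\<delta> \<le> 1 / 2" and Q: "Q > 0"
  shows "(\<lambda>n. 2 * (comb_coeff \<delta> Q (Suc n) * cos (2 * pi * real (Suc n) * x))) sums (comb \<delta> Q x - 1)"
proof -
  have one: "(\<lambda>n. if q dvd Suc n then 2 * (tent_coeff \<delta> (real (Suc n div q)) * cos (2 * pi * real (Suc n) * x)) else 0)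
      sums (tent \<delta> (int_dist (real q * x)) - 1)" (is "?f sums _") if "q > 0" for q
  proof -
    define g where "g m = q * Suc m - 1" for m
    have Sg: "Suc (g m) = q * Suc m" for m using that by (simp add: g_def)
    have "strict_mono g"
    proof (rule strict_monoI)
      fix m n :: nat assume "m < n"
      hence "Suc (g m) < Suc (g n)" using that by (simp add: Sg del: mult_Suc_right)
      thus "g m < g n" by simp
    qed
    moreover have "?f n = 0" if "n \<notin> range g" for n
    proof (rule ccontr)
      assume "?f n \<noteq> 0"
      hence "q dvd Suc n" by (auto split: if_splits)
      then obtain k where k: "Suc n = q * k" by blast
      then obtain m where "k = Suc m" by (cases k) auto
      hence "n = g m" using k Sg[of m] by simp
      with that show False by simp
    qed
    ultimately have "?f sums (tent \<delta> (int_dist (real q * x)) - 1) \<longleftrightarrow>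
        (\<lambda>m. ?f (g m)) sums (tent \<delta> (int_dist (real q * x)) - 1)"
      by (intro sums_mono_reindex[symmetric])
    moreover have "?f (g m) = 2 * (tent_coeff \<delta> (real (Suc m)) * cos (2 * pi * real (Suc m) * (real q * x)))" for m
      unfolding Sg using that by (simp add: mult_ac del: mult_Suc_right of_nat_Suc)
    ultimately show ?thesis using periodic_tent_series[OF d, of "real q * x"] by simp
  qed
  have "(\<lambda>n. \<Sum>q\<in>{Q..<2*Q}. if q dvd Suc n then 2 * (tent_coeff \<delta> (real (Suc n div q)) * cos (2 * pi * real (Suc n) * x)) else 0)
     sums (\<Sum>q\<in>{Q..<2*Q}. tent \<delta> (int_dist (real q * x)) - 1)"
    by (intro sums_sum one) (use Q in auto)
  hence "(\<lambda>n. (\<Sum>q\<in>{Q..<2*Q}. if q dvd Suc n then 2 * (tent_coeff \<delta> (real (Suc n div q)) * cos (2 * pi * real (Suc n) * x)) else 0) / real Q)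
     sums ((\<Sum>q\<in>{Q..<2*Q}. tent \<delta> (int_dist (real q * x)) - 1) / real Q)"
    by (rule sums_divide)
  moreover have "(\<Sum>q\<in>{Q..<2*Q}. tent \<delta> (int_dist (real q * x)) - 1) / real Q = comb \<delta> Q x - 1"
    using Q by (simp add: comb_def sum_subtractf diff_divide_distrib)
  moreover have "(\<Sum>q\<in>{Q..<2*Q}. if q dvd Suc n then 2 * (tent_coeff \<delta> (real (Suc n div q)) * cos (2 * pi * real (Suc n) * x)) else 0) / real Q
      = 2 * (comb_coeff \<delta> Q (Suc n) * cos (2 * pi * real (Suc n) * x))" for n
    by (subst sum.inter_filter[symmetric]) (auto simp: comb_coeff_def sum_distrib_left sum_distrib_right sum_divide_distrib mult_ac)
  ultimately show ?thesis by simp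
qed

lemma comb_coeff_nonneg: "comb_coeff \<delta> Q n \<ge> 0"
  unfolding comb_coeff_def by (intro divide_nonneg_nonneg sum_nonneg tent_coeff_nonneg) simp

lemma comb_coeff_eq_0:
  assumes "0 < n" "n < Q" shows "comb_coeff \<delta> Q n = 0"
proof -
  have "{q\<in>{Q..<2*Q}. q dvd n} = {}" using assms by (auto dest: dvd_imp_le)
  thus ?thesis unfolding comb_coeff_def by (simp only: sum.empty div_0)
qed

text \<open>
Interpolation between the bounds 1 and \<open>1 / (\<delta> * m)\<^sup>2\<close>, where \<open>m = n div q \<ge> n / (2 * Q)\<close>.
\<close>

lemma tent_coeff_div_le:
  assumes d: "0 < \<delta>" and n: "n > 0" and q: "q \<in> {Q..<2*Q}" "q dvd n" and \<gamma>: "0 \<le> \<gamma>" "\<gamma> \<le> 2"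
  shows "tent_coeff \<delta> (real (n div q)) \<le> (2 * real Q / (\<delta> * real n)) powr \<gamma>"
proof -
  define y where "y = 2 * real Q / (\<delta> * real n)"
  obtain m where m: "n = q * m" using q by blast
  have q0: "q > 0" and m0: "m > 0" using m n by (auto intro: ccontr)
  have Q0: "Q > 0" using q by auto
  have y0: "y > 0" using Q0 d n by (simp add: y_def)
  have ndiv: "n div q = m" using m q0 by simp
  have "real n \<le> 2 * real Q * real m"
  proof -
    have "real n = real q * real m" using m by simp
    also have "\<dots> \<le> (2 * real Q) * real m" using q by (intro mult_right_mono) auto
    finally show ?thesis .
  qed
  hence "1 / (\<delta> * real m) \<le> y" using d n m0 by (simp add: y_def field_simps)
  hence "(1 / (\<delta> * real m))\<^sup>2 \<le> y\<^sup>2" using d by (intro power_mono) auto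
  with tent_coeff_le_square[OF d, of "real m"] m0 have le2: "tent_coeff \<delta> (real m) \<le> y\<^sup>2" by simp
  have "tent_coeff \<delta> (real m) \<le> y powr \<gamma>"
  proof (cases "y \<ge> 1")
    case True
    have "1 \<le> y powr \<gamma>" using ge_one_powr_ge_zero[OF True \<gamma>(1)] .
    thus ?thesis using tent_coeff_le_1[OF d, of "real m"] by linarith
  next
    case False
    have "y\<^sup>2 = y powr 2" using y0 by simp
    also have "\<dots> \<le> y powr \<gamma>" using False y0 \<gamma> by (intro powr_mono') auto
    finally show ?thesis using le2 by linarith
  qed
  thus ?thesis by (simp add: ndiv y_def)
qed

lemma comb_coeff_le:
  assumes d: "0 < \<delta>" and n: "n > 0" and Q: "Q > 0" and \<gamma>: "0 \<le> \<gamma>" "\<gamma> \<le> 2"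
  shows "comb_coeff \<delta> Q n \<le> real (card {q\<in>{Q..<2*Q}. q dvd n}) / real Q * (2 * real Q / (\<delta> * real n)) powr \<gamma>"
proof -
  let ?S = "{q\<in>{Q..<2*Q}. q dvd n}"
  have "(\<Sum>q\<in>?S. tent_coeff \<delta> (real (n div q))) \<le> real (card ?S) * (2 * real Q / (\<delta> * real n)) powr \<gamma>"
    using tent_coeff_div_le[OF d n _ _ \<gamma>, of _ Q] by (intro sum_bounded_above) auto
  thus ?thesis using Q by (simp add: comb_coeff_def divide_right_mono)
qed

text \<open>
The tents of the comb around \<open>a / q\<close> then have width about \<open>Q powr (- 2 / \<alpha>)\<close>.
\<close>

definition comb_width :: "real \<Rightarrow> nat \<Rightarrow> real" where
  "comb_width \<alpha> Q = real Q powr (1 - 2 / \<alpha>)"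

lemma comb_width_bounds:
  assumes "0 < \<alpha>" "\<alpha> < 1/2" "Q \<ge> 2"
  shows "0 < comb_width \<alpha> Q" "comb_width \<alpha> Q \<le> 1 / 2"
proof -
  show "0 < comb_width \<alpha> Q" using assms by (simp add: comb_width_def)
  have "2 / \<alpha> \<ge> 2" using assms by (simp add: field_simps)
  have "real Q powr (1 - 2 / \<alpha>) \<le> real Q powr (-1)" using assms \<open>2 / \<alpha> \<ge> 2\<close> by (intro powr_mono) auto
  also have "\<dots> \<le> 1 / 2" using assms by (simp add: powr_minus field_simps)
  finally show "comb_width \<alpha> Q \<le> 1 / 2" by (simp add: comb_width_def)
qed

text \<open>
The width is chosen such that \<open>(Q / (\<delta> * n)) powr (\<alpha> / 2)\<close> equals \<open>Q * n powr (- \<alpha> / 2)\<close>: the factor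
\<open>Q\<close> cancels against the normalization of the comb.
\<close>

lemma comb_coeff_decay:
  assumes a: "0 < \<alpha>" "\<alpha> < 1/2" and Q: "Q > 0" and n: "n > 0"
  shows "comb_coeff (comb_width \<alpha> Q) Q n \<le> 2 * real (card {q. q dvd n}) * real n powr (- \<alpha> / 2)"
proof -
  have w: "comb_width \<alpha> Q > 0" using Q by (simp add: comb_width_def)
  have eq: "2 * real Q / (comb_width \<alpha> Q * real n) = 2 * (real Q powr (2 / \<alpha>)) * inverse (real n)"
    using Q n by (simp add: comb_width_def powr_diff field_simps)
  have "(2 * real Q / (comb_width \<alpha> Q * real n)) powr (\<alpha> / 2) = 2 powr (\<alpha> / 2) * real Q * real n powr (- \<alpha> / 2)"
    unfolding eq using Q n a by (simp add: powr_mult powr_powr powr_minus inverse_powr)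
  also have "\<dots> \<le> 2 powr 1 * real Q * real n powr (- \<alpha> / 2)"
    using a by (intro mult_right_mono powr_mono) auto
  finally have "(2 * real Q / (comb_width \<alpha> Q * real n)) powr (\<alpha> / 2) \<le> 2 * real Q * real n powr (- \<alpha> / 2)" by simp
  hence "real (card {q. q dvd n}) / real Q * (2 * real Q / (comb_width \<alpha> Q * real n)) powr (\<alpha> / 2)
      \<le> real (card {q. q dvd n}) / real Q * (2 * real Q * real n powr (- \<alpha> / 2))"
    by (intro mult_left_mono) auto
  also have "\<dots> = 2 * real (card {q. q dvd n}) * real n powr (- \<alpha> / 2)" using Q by simp
  finally have fin: "real (card {q. q dvd n}) / real Q * (2 * real Q / (comb_width \<alpha> Q * real n)) powr (\<alpha> / 2)
      \<le> 2 * real (card {q. q dvd n}) * real n powr (- \<alpha> / 2)" .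
  have "card {q\<in>{Q..<2*Q}. q dvd n} \<le> card {q. q dvd n}" using n by (intro card_mono) auto
  hence "real (card {q\<in>{Q..<2*Q}. q dvd n}) / real Q * (2 * real Q / (comb_width \<alpha> Q * real n)) powr (\<alpha> / 2)
    \<le> real (card {q. q dvd n}) / real Q * (2 * real Q / (comb_width \<alpha> Q * real n)) powr (\<alpha> / 2)"
    by (intro mult_right_mono divide_right_mono) auto
  with fin show ?thesis using comb_coeff_le[OF w n Q, of "\<alpha> / 2"] a by linarith
qed

lemma comb_coeff_le_inverse_square:
  assumes d: "0 < \<delta>" and n: "n > 0" and Q: "Q > 0"
  shows "comb_coeff \<delta> Q n \<le> (2 * real Q / \<delta>)\<^sup>2 / (real n)\<^sup>2"
proof -
  have "card {q\<in>{Q..<2*Q}. q dvd n} \<le> card {Q..<2*Q}" by (intro card_mono) auto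
  hence "real (card {q\<in>{Q..<2*Q}. q dvd n}) / real Q * (2 * real Q / (\<delta> * real n)) powr 2
      \<le> 1 * (2 * real Q / (\<delta> * real n)) powr 2"
    using Q by (intro mult_right_mono) auto
  also have "\<dots> = (2 * real Q / \<delta>)\<^sup>2 / (real n)\<^sup>2"
    using d n Q by (simp add: power_divide power_mult_distrib)
  finally show ?thesis using comb_coeff_le[OF d n Q, of 2] by linarith
qed

section \<open>Multiplying a density by the comb\<close>

definition density_ft :: "(real \<Rightarrow> real) \<Rightarrow> real \<Rightarrow> complex" where
  "density_ft \<psi> t = (\<integral>x. \<psi> x *\<^sub>R cis (- (2 * pi * t * x)) \<partial>lborel)"

text \<open>
The quadratic decay of the Fourier transform takes the place of smoothness: it is all that the
construction needs to know about a density, and it survives multiplication by a comb.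
\<close>

definition bump :: "(real \<Rightarrow> real) \<Rightarrow> bool" where
  "bump \<psi> \<longleftrightarrow> \<psi> \<in> borel_measurable borel \<and> (\<forall>x. 0 \<le> \<psi> x) \<and> (\<forall>x. \<bar>x\<bar> > 1 \<longrightarrow> \<psi> x = 0)
     \<and> (\<exists>B. \<forall>x. \<psi> x \<le> B) \<and> (\<exists>K. \<forall>t. cmod (density_ft \<psi> t) \<le> K * (1 + \<bar>t\<bar>) powr (- 2))"

lemma bumpD:
  assumes "bump \<psi>"
  shows "\<psi> \<in> borel_measurable borel" "0 \<le> \<psi> x" "\<bar>x\<bar> > 1 \<Longrightarrow> \<psi> x = 0"
proof -
  note * = assms[unfolded bump_def]
  show "\<psi> \<in> borel_measurable borel" by (rule *[THEN conjunct1])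
  show "0 \<le> \<psi> x" by (rule *[THEN conjunct2, THEN conjunct1, rule_format])
  show "\<bar>x\<bar> > 1 \<Longrightarrow> \<psi> x = 0" by (rule *[THEN conjunct2, THEN conjunct2, THEN conjunct1, rule_format])
qed

lemma bump_integrable:
  assumes "bump \<psi>" shows "integrable lborel \<psi>"
proof -
  obtain B where B: "\<And>x. \<psi> x \<le> B" using assms by (auto simp: bump_def)
  have "integrable lborel (\<lambda>x. indicator {-1..1} x *\<^sub>R \<psi> x)"
  proof (rule integrableI_bounded_set_indicator[where B = B])
    show "AE x in lborel. x \<in> {-1..1} \<longrightarrow> norm (\<psi> x) \<le> B"
      using bumpD(2)[OF assms] B by simp
  qed (use bumpD(1)[OF assms] in auto)
  moreover have "indicator {-1..1} x *\<^sub>R \<psi> x = \<psi> x" for x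
    using bumpD(3)[OF assms, of x] by (cases "x \<in> {-1..1}") auto
  ultimately show ?thesis by (simp only:)
qed

lemma integrable_scaleR_cis:
  fixes f :: "real \<Rightarrow> real"
  assumes "integrable lborel f"
  shows "integrable lborel (\<lambda>x. f x *\<^sub>R cis (a * x))"
proof (rule Bochner_Integration.integrable_bound[OF assms])
  have [measurable]: "f \<in> borel_measurable lborel" using assms by (rule borel_measurable_integrable)
  have [measurable]: "(\<lambda>x. cis (a * x)) \<in> borel_measurable lborel"
    unfolding cis_conv_exp measurable_lborel2 by (intro borel_measurable_continuous_onI continuous_intros)
  show "(\<lambda>x. f x *\<^sub>R cis (a * x)) \<in> borel_measurable lborel" by measurable
qed simp

lemma cos_scaleR_cis:
  "(2 * cos (2 * pi * s * x)) *\<^sub>R cis (- (2 * pi * t * x))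
     = cis (- (2 * pi * (t - s) * x)) + cis (- (2 * pi * (t + s) * x))"
proof -
  have "- (2 * pi * (t - s) * x) = - (2 * pi * t * x) + 2 * pi * s * x"
    "- (2 * pi * (t + s) * x) = - (2 * pi * t * x) - 2 * pi * s * x" by (simp_all add: algebra_simps)
  thus ?thesis
    by (auto intro!: complex_eqI simp: cos_add cos_diff sin_add sin_diff algebra_simps)
qed

text \<open>
Multiplication by a cosine series convolves the Fourier transform with its coefficients.
\<close>

lemma density_ft_cosine_series:
  assumes int: "integrable lborel \<psi>"
    and c: "summable c" "\<And>n. c n \<ge> 0"
    and h: "\<And>x. (\<lambda>n. 2 * (c n * cos (2 * pi * real (Suc n) * x))) sums (h x - 1)"
    and int': "integrable lborel (\<lambda>x. \<psi> x * h x)"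
  shows "(\<lambda>n. c n *\<^sub>R (density_ft \<psi> (t - real (Suc n)) + density_ft \<psi> (t + real (Suc n))))
     sums (density_ft (\<lambda>x. \<psi> x * h x) t - density_ft \<psi> t)"
proof -
  define f where "f n x = (\<psi> x * (2 * (c n * cos (2 * pi * real (Suc n) * x)))) *\<^sub>R cis (- (2 * pi * t * x))" for n x
  have f_eq: "f n x = c n *\<^sub>R (\<psi> x *\<^sub>R cis (- (2 * pi * (t - real (Suc n))) * x) + \<psi> x *\<^sub>R cis (- (2 * pi * (t + real (Suc n))) * x))" for n x
  proof -
    have "f n x = (c n * \<psi> x) *\<^sub>R ((2 * cos (2 * pi * real (Suc n) * x)) *\<^sub>R cis (- (2 * pi * t * x)))"
      by (simp add: f_def mult_ac)
    also have "\<dots> = c n *\<^sub>R (\<psi> x *\<^sub>R cis (- (2 * pi * (t - real (Suc n))) * x) + \<psi> x *\<^sub>R cis (- (2 * pi * (t + real (Suc n))) * x))"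
      unfolding cos_scaleR_cis by (simp add: scaleR_add_right)
    finally show ?thesis .
  qed
  have int_f: "integrable lborel (f n)" for n
    unfolding f_eq by (intro integrable_scaleR_right Bochner_Integration.integrable_add integrable_scaleR_cis int)
  have f_le: "norm (f n x) \<le> 2 * c n * \<bar>\<psi> x\<bar>" for n x
  proof -
    have "norm (f n x) = \<bar>\<psi> x\<bar> * (2 * c n) * \<bar>cos (2 * pi * real (Suc n) * x)\<bar>"
      using c(2)[of n] by (simp add: f_def abs_mult)
    also have "\<dots> \<le> \<bar>\<psi> x\<bar> * (2 * c n) * 1" using c(2)[of n] by (intro mult_left_mono) auto
    finally show ?thesis by (simp add: mult_ac)
  qed
  have sum_f: "(\<lambda>n. f n x) sums ((\<psi> x * h x) *\<^sub>R cis (- (2 * pi * t * x)) - \<psi> x *\<^sub>R cis (- (2 * pi * t * x)))" for x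
  proof -
    have "(\<lambda>n. \<psi> x * (2 * (c n * cos (2 * pi * real (Suc n) * x)))) sums (\<psi> x * (h x - 1))"
      by (intro sums_mult h)
    hence "(\<lambda>n. f n x) sums ((\<psi> x * (h x - 1)) *\<^sub>R cis (- (2 * pi * t * x)))"
      unfolding f_def by (rule sums_scaleR_left)
    moreover have "(\<psi> x * (h x - 1)) *\<^sub>R cis (- (2 * pi * t * x))
        = (\<psi> x * h x) *\<^sub>R cis (- (2 * pi * t * x)) - \<psi> x *\<^sub>R cis (- (2 * pi * t * x))"
      by (simp add: right_diff_distrib scaleR_diff_left)
    ultimately show ?thesis by simp
  qed
  have "(\<lambda>n. integral\<^sup>L lborel (f n)) sums (\<integral>x. (\<Sum>n. f n x) \<partial>lborel)"
  proof (rule sums_integral[OF int_f])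
    show "AE x in lborel. summable (\<lambda>n. norm (f n x))"
    proof (rule AE_I2)
      fix x
      show "summable (\<lambda>n. norm (f n x))"
        by (rule summable_comparison_test'[where g = "\<lambda>n. 2 * c n * \<bar>\<psi> x\<bar>" and N = 0])
          (use f_le in \<open>auto intro!: summable_mult summable_mult2 c(1)\<close>)
    qed
    have "norm (\<integral>x. norm (f n x) \<partial>lborel) \<le> 2 * c n * (\<integral>x. \<bar>\<psi> x\<bar> \<partial>lborel)" for n
    proof -
      have "(\<integral>x. norm (f n x) \<partial>lborel) \<le> (\<integral>x. 2 * c n * \<bar>\<psi> x\<bar> \<partial>lborel)"
        using int int_f f_le by (intro integral_mono integrable_norm) auto
      thus ?thesis by simp
    qed
    moreover have "summable (\<lambda>n. 2 * c n * (\<integral>x. \<bar>\<psi> x\<bar> \<partial>lborel))"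
      by (intro summable_mult summable_mult2 c(1))
    ultimately show "summable (\<lambda>n. \<integral>x. norm (f n x) \<partial>lborel)"
      by (rule summable_comparison_test'[rotated])
  qed
  moreover have "(\<integral>x. (\<Sum>n. f n x) \<partial>lborel) = density_ft (\<lambda>x. \<psi> x * h x) t - density_ft \<psi> t"
    unfolding sums_unique[OF sum_f, symmetric] density_ft_def
    using integrable_scaleR_cis[OF int, of "- (2 * pi * t)"] integrable_scaleR_cis[OF int', of "- (2 * pi * t)"]
    by (subst Bochner_Integration.integral_diff) simp_all
  moreover have "integral\<^sup>L lborel (f n) = c n *\<^sub>R (density_ft \<psi> (t - real (Suc n)) + density_ft \<psi> (t + real (Suc n)))" for n
    unfolding f_eq density_ft_def
    using integrable_scaleR_cis[OF int, of "- (2 * pi * (t - real (Suc n)))"] integrable_scaleR_cis[OF int, of "- (2 * pi * (t + real (Suc n)))"]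
    by (subst integral_scaleR_right, subst Bochner_Integration.integral_add) (simp_all del: of_nat_Suc)
  ultimately show ?thesis by simp
qed

lemma sums_norm_le:
  fixes f :: "nat \<Rightarrow> 'a::real_normed_vector"
  assumes "f sums L" "\<And>N. (\<Sum>n<N. norm (f n)) \<le> B"
  shows "norm L \<le> B"
proof (rule LIMSEQ_le_const2)
  show "(\<lambda>N. norm (\<Sum>n<N. f n)) \<longlonglongrightarrow> norm L" using assms(1) unfolding sums_def by (rule tendsto_norm)
  show "\<exists>N. \<forall>n\<ge>N. norm (\<Sum>n<n. f n) \<le> B" using assms(2) norm_sum order_trans by blast
qed

text \<open>
Each value of \<open>\<bar>\<lfloor>t\<rfloor> - n\<bar>\<close> is taken at most twice, so the sums are dominated by twice a convergent
series, uniformly in \<open>t\<close>.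
\<close>

lemma sum_powr_translates_bounded:
  "\<exists>S>0. \<forall>t N. (\<Sum>n<N. (1 + \<bar>t - real (Suc n)\<bar>) powr (- 3 / 2)) \<le> S"
proof -
  define g where "g j = (1 + real j) powr (- 3 / 2)" for j
  have g0: "g j \<ge> 0" for j by (simp add: g_def)
  have "summable (\<lambda>j. real j powr (- 3 / 2))" by (simp add: summable_real_powr_iff)
  hence "summable (\<lambda>j. real (Suc j) powr (- 3 / 2))" by (rule summable_Suc_iff[THEN iffD2])
  hence sg: "summable g" unfolding g_def of_nat_Suc .
  define S where "S = suminf g"
  have S0: "S \<ge> 0" unfolding S_def by (rule suminf_nonneg[OF sg g0])
  have part: "(\<Sum>k\<in>A. g (h k)) \<le> S" if "finite A" "inj_on h A" for A :: "nat set" and h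
  proof -
    have "(\<Sum>k\<in>A. g (h k)) = sum g (h ` A)" using that by (simp add: sum.reindex)
    also have "\<dots> \<le> S" unfolding S_def using that g0 by (intro sum_le_suminf sg) auto
    finally show ?thesis .
  qed
  have "(\<Sum>n<N. (1 + \<bar>t - real (Suc n)\<bar>) powr (- 3 / 2)) \<le> 2 powr (3 / 2) * (2 * S)" for t N
  proof -
    define m where "m = \<lfloor>t\<rfloor>"
    define h where "h n = nat \<bar>m - int (Suc n)\<bar>" for n
    have le: "(1 + \<bar>t - real (Suc n)\<bar>) powr (- 3 / 2) \<le> 2 powr (3 / 2) * g (h n)" for n
    proof -
      define y where "y = \<bar>t - real (Suc n)\<bar>"
      have y0: "y \<ge> 0" by (simp add: y_def)
      have "\<bar>t - m\<bar> \<le> 1" unfolding m_def by linarith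
      moreover have "real (h n) = \<bar>real_of_int m - real (Suc n)\<bar>" unfolding h_def by simp
      moreover have "\<bar>real_of_int m - s\<bar> \<le> \<bar>t - m\<bar> + \<bar>t - s\<bar>" for s by linarith
      ultimately have "real (h n) \<le> 1 + y" unfolding y_def by (smt (verit))
      hence "1 + real (h n) \<le> 2 * (1 + y)" using y0 by simp
      hence "(2 * (1 + y)) powr (- 3 / 2) \<le> g (h n)"
        unfolding g_def by (intro powr_mono2') auto
      hence "2 powr (3 / 2) * (2 * (1 + y)) powr (- 3 / 2) \<le> 2 powr (3 / 2) * g (h n)"
        by (intro mult_left_mono) auto
      moreover have "2 powr (3 / 2) * (2 * (1 + y)) powr (- 3 / 2) = (1 + y) powr (- 3 / 2)"
      proof -
        have "(2 * (1 + y)) powr (- 3 / 2) = 2 powr (- 3 / 2) * (1 + y) powr (- 3 / 2)"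
          by (rule powr_mult)
        moreover have "2 powr (3 / 2) * 2 powr (- 3 / 2) = (1::real)" by (simp flip: powr_add)
        ultimately show ?thesis by (metis mult.assoc mult_1)
      qed
      ultimately show ?thesis by (simp only: y_def)
    qed
    have "(\<Sum>n<N. (1 + \<bar>t - real (Suc n)\<bar>) powr (- 3 / 2)) \<le> (\<Sum>n<N. 2 powr (3 / 2) * g (h n))"
      by (intro sum_mono le)
    also have "\<dots> = 2 powr (3 / 2) * (\<Sum>n<N. g (h n))" by (simp add: sum_distrib_left)
    also have "(\<Sum>n<N. g (h n)) = (\<Sum>n\<in>{..<N} \<inter> {n. int (Suc n) \<le> m}. g (h n)) + (\<Sum>n\<in>{..<N} - {n. int (Suc n) \<le> m}. g (h n))"
      by (subst sum.Int_Diff[of _ _ "{n. int (Suc n) \<le> m}"]) auto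
    also have "\<dots> \<le> S + S"
      by (intro add_mono part) (auto simp: h_def inj_on_def)
    finally show ?thesis by (simp add: mult_left_mono)
  qed
  moreover have "2 powr (3 / 2) * (2 * S) < 2 powr (3 / 2) * (2 * S) + 1" "0 \<le> 2 powr (3 / 2) * (2 * S)"
    using S0 by simp_all
  ultimately show ?thesis
    by (intro exI[of _ "2 powr (3 / 2) * (2 * S) + 1"]) (meson less_eq_real_def order_trans le_less_trans)
qed

lemma one_plus_abs_triangle:
  fixes t n :: real assumes "n \<ge> 0"
  shows "1 + \<bar>t\<bar> \<le> (1 + n) * (1 + \<bar>t - n\<bar>)" "1 + \<bar>t\<bar> \<le> (1 + n) + (1 + \<bar>t - n\<bar>)"
proof -
  have "(1 + n) * (1 + \<bar>t - n\<bar>) = 1 + n + \<bar>t - n\<bar> + n * \<bar>t - n\<bar>" by (simp add: algebra_simps)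
  moreover have "n * \<bar>t - n\<bar> \<ge> 0" using assms by simp
  ultimately show "1 + \<bar>t\<bar> \<le> (1 + n) * (1 + \<bar>t - n\<bar>)" using assms by linarith
qed (use assms in linarith)

text \<open>
If one factor decays slowly and the other one quadratically, the convolution inherits the slow rate,
by \<open>1 + \<bar>t\<bar> \<le> (1 + n) * (1 + \<bar>t - n\<bar>)\<close>.
\<close>

lemma convolution_term_le_slow:
  fixes t n :: real assumes n: "n \<ge> 0" and \<beta>: "0 \<le> \<beta>" "\<beta> \<le> 1 / 2"
  shows "(1 + n) powr (- \<beta>) * (1 + \<bar>t - n\<bar>) powr (- 2) \<le> (1 + \<bar>t\<bar>) powr (- \<beta>) * (1 + \<bar>t - n\<bar>) powr (- 3 / 2)"
proof -
  define A B where "A = 1 + n" and "B = 1 + \<bar>t - n\<bar>"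
  have AB: "A \<ge> 1" "B \<ge> 1" using n by (auto simp: A_def B_def)
  have "1 + \<bar>t\<bar> \<le> A * B" using one_plus_abs_triangle(1)[OF n] by (simp add: A_def B_def)
  hence "(A * B) powr (- \<beta>) \<le> (1 + \<bar>t\<bar>) powr (- \<beta>)" using \<beta> by (intro powr_mono2') auto
  hence "A powr (- \<beta>) * B powr (- \<beta>) * B powr (\<beta> - 2) \<le> (1 + \<bar>t\<bar>) powr (- \<beta>) * B powr (- 3 / 2)"
    using AB \<beta> by (intro mult_mono powr_mono) (auto simp: powr_mult)
  moreover have "B powr (- \<beta>) * B powr (\<beta> - 2) = B powr (- 2)" using AB by (simp flip: powr_add)
  ultimately show ?thesis by (simp add: A_def B_def mult.assoc)
qed

text \<open>
If both factors decay quadratically, so does the convolution, since one of \<open>n\<close> and \<open>\<bar>t - n\<bar>\<close> is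
comparable to \<open>\<bar>t\<bar>\<close>.
\<close>

lemma convolution_term_le_fast:
  fixes t n :: real assumes n: "n \<ge> 0"
  shows "(1 + n) powr (- 2) * (1 + \<bar>t - n\<bar>) powr (- 2)
     \<le> 2 * (1 + \<bar>t\<bar>) powr (- 2) * ((1 + n) powr (- 3 / 2) + (1 + \<bar>t - n\<bar>) powr (- 3 / 2))"
proof -
  define A B T where "A = 1 + n" and "B = 1 + \<bar>t - n\<bar>" and "T = 1 + \<bar>t\<bar>"
  have AB: "A \<ge> 1" "B \<ge> 1" "T \<ge> 1" using n by (auto simp: A_def B_def T_def)
  have "T \<le> A + B" using one_plus_abs_triangle(2)[OF n] by (simp add: A_def B_def T_def)
  hence "T\<^sup>2 \<le> (A + B)\<^sup>2" using AB by (intro power_mono) auto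
  also have "\<dots> \<le> 2 * (A\<^sup>2 + B\<^sup>2)" using sum_squares_ge_zero[of "A - B" 0] by (simp add: power2_eq_square algebra_simps)
  finally have "T\<^sup>2 \<le> 2 * (A\<^sup>2 + B\<^sup>2)" .
  hence "1 / (A\<^sup>2 * B\<^sup>2) \<le> 2 * (1 / T\<^sup>2) * (1 / A\<^sup>2 + 1 / B\<^sup>2)"
    using AB by (simp add: field_simps)
  hence "A powr (- 2) * B powr (- 2) \<le> 2 * T powr (- 2) * (A powr (- 2) + B powr (- 2))"
    using AB by (simp add: powr_minus_divide)
  also have "\<dots> \<le> 2 * T powr (- 2) * (A powr (- 3 / 2) + B powr (- 3 / 2))"
    using AB by (intro mult_left_mono add_mono powr_mono) auto
  finally show ?thesis by (simp add: A_def B_def T_def)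
qed

lemma continuous_int_dist: "continuous_on UNIV int_dist"
  by (rule lipschitz_on_continuous_on[where L = 1])
    (auto intro!: lipschitz_onI simp: dist_real_def int_dist_lipschitz)

lemma continuous_comb: "continuous_on UNIV (comb \<delta> Q)"
proof -
  have *: "continuous_on UNIV (\<lambda>x. int_dist (r * x))" for r
    by (rule continuous_on_compose2[OF continuous_int_dist]) (auto intro!: continuous_intros)
  show ?thesis unfolding comb_def tent_def divide_inverse by (intro continuous_intros *)
qed

lemma comb_nonneg: "\<delta> > 0 \<Longrightarrow> comb \<delta> Q x \<ge> 0"
  unfolding comb_def by (intro divide_nonneg_nonneg sum_nonneg tent_nonneg) auto

lemma comb_le: "\<delta> > 0 \<Longrightarrow> Q > 0 \<Longrightarrow> comb \<delta> Q x \<le> 1 / \<delta>"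
proof -
  assume d: "\<delta> > 0" and Q: "Q > 0"
  have "(\<Sum>q\<in>{Q..<2*Q}. tent \<delta> (int_dist (real q * x))) \<le> real (card {Q..<2*Q}) * (1 / \<delta>)"
    by (intro sum_bounded_above tent_le d)
  thus ?thesis using Q by (simp add: comb_def divide_le_eq mult.commute)
qed

lemma comb_nonzero_imp:
  assumes "\<delta> > 0" "comb \<delta> Q x \<noteq> 0"
  shows "\<exists>q\<in>{Q..<2*Q}. int_dist (real q * x) \<le> \<delta>"
proof (rule ccontr)
  assume no: "\<not> ?thesis"
  have "tent \<delta> (int_dist (real q * x)) = 0" if "q \<in> {Q..<2*Q}" for q
  proof (rule tent_eq_0[OF assms(1)])
    have "\<delta> < int_dist (real q * x)" using no that by (meson not_le)
    thus "\<delta> \<le> \<bar>int_dist (real q * x)\<bar>" by linarith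
  qed
  hence "comb \<delta> Q x = 0" by (simp add: comb_def)
  with assms(2) show False by simp
qed

lemma bump_mult_integrable:
  assumes "bump \<psi>" "h \<in> borel_measurable borel" "\<And>x. 0 \<le> h x" "\<And>x. h x \<le> (B::real)"
  shows "integrable lborel (\<lambda>x. \<psi> x * h x)"
proof (rule Bochner_Integration.integrable_bound[where f = "\<lambda>x. B * \<psi> x"])
  show "integrable lborel (\<lambda>x. B * \<psi> x)" using bump_integrable[OF assms(1)] by simp
  show "(\<lambda>x. \<psi> x * h x) \<in> borel_measurable lborel"
    using bumpD(1)[OF assms(1)] assms(2) by measurable
  have "norm (\<psi> x * h x) \<le> norm (B * \<psi> x)" for x
    using bumpD(2)[OF assms(1), of x] assms(3)[of x] assms(4)[of x]
    by (auto simp: abs_mult mult.commute[of _ "\<psi> x"] intro!: mult_left_mono)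
  thus "AE x in lborel. norm (\<psi> x * h x) \<le> norm (B * \<psi> x)" by simp
qed

lemma inverse_square_le: "n > 0 \<Longrightarrow> 1 / (real n)\<^sup>2 \<le> 4 * (1 + real n) powr (- 2)"
proof -
  assume n: "n > 0"
  have "(1 + real n)\<^sup>2 \<le> (2 * real n)\<^sup>2" using n by (intro power_mono) auto
  moreover have "(1 + real n) powr (- 2) = 1 / (1 + real n)\<^sup>2" by (simp add: powr_minus_divide)
  ultimately have "(1 + real n) powr (- 2) \<ge> 1 / (2 * real n)\<^sup>2"
    by (metis divide_left_mono zero_le_one mult_pos_pos zero_less_power of_nat_0_less_iff n add_pos_pos zero_less_one zero_less_numeral mult_pos_pos)
  thus ?thesis by (simp add: power_mult_distrib)
qed

lemma comb_coeff_summable: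
  assumes d: "0 < \<delta>" and Q: "Q > 0"
  shows "summable (\<lambda>n. comb_coeff \<delta> Q (Suc n))"
proof (rule summable_comparison_test')
  have "summable (\<lambda>n. 1 / real n ^ 2)" using inverse_power_summable[of 2, where ?'a = real]
    by (simp add: inverse_eq_divide)
  hence "summable (\<lambda>n. 1 / real (Suc n) ^ 2)" by (rule summable_Suc_iff[THEN iffD2])
  thus "summable (\<lambda>n. (2 * real Q / \<delta>)\<^sup>2 * (1 / real (Suc n) ^ 2))" by (rule summable_mult)
  show "norm (comb_coeff \<delta> Q (Suc n)) \<le> (2 * real Q / \<delta>)\<^sup>2 * (1 / real (Suc n) ^ 2)" for n
    using comb_coeff_le_inverse_square[OF d _ Q, of "Suc n"] comb_coeff_nonneg[of \<delta> Q "Suc n"] by simp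
qed

lemma density_ft_comb_series:
  assumes \<psi>: "bump \<psi>" and d: "0 < \<delta>" "\<delta> \<le> 1 / 2" and Q: "Q > 0"
  shows "(\<lambda>n. comb_coeff \<delta> Q (Suc n) *\<^sub>R (density_ft \<psi> (t - real (Suc n)) + density_ft \<psi> (t + real (Suc n))))
     sums (density_ft (\<lambda>x. \<psi> x * comb \<delta> Q x) t - density_ft \<psi> t)"
proof (rule density_ft_cosine_series)
  show "integrable lborel (\<lambda>x. \<psi> x * comb \<delta> Q x)"
    by (rule bump_mult_integrable[OF \<psi> _ comb_nonneg[OF d(1)] comb_le[OF d(1) Q]])
      (rule borel_measurable_continuous_onI[OF continuous_comb])
qed (use bump_integrable[OF \<psi>] comb_coeff_summable[OF d(1) Q] comb_coeff_nonneg comb_series[OF d Q] in auto)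

lemma bump_decayE:
  assumes "bump \<psi>"
  obtains K where "K \<ge> 0" "\<And>t. cmod (density_ft \<psi> t) \<le> K * (1 + \<bar>t\<bar>) powr (- 2)"
proof -
  obtain K where K: "\<And>t. cmod (density_ft \<psi> t) \<le> K * (1 + \<bar>t\<bar>) powr (- 2)"
    using assms unfolding bump_def by auto
  moreover have "K \<ge> 0" using order_trans[OF norm_ge_zero K[of 0]] by simp
  ultimately show ?thesis using that by blast
qed

text \<open>
The comb changes the Fourier transform at \<open>t\<close> by a sum over the shifts \<open>t - n\<close> and \<open>t + n\<close>; the
second kind is the first kind at \<open>- t\<close>. The family \<open>b\<close> is left open because it is used for the
quadratic decay as well as for the slow decay with a small constant.
\<close>

lemma density_ft_comb_diff_le:
  assumes \<psi>: "bump \<psi>" and d: "0 < \<delta>" "\<delta> \<le> 1 / 2" and Q: "Q > 0"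
    and K: "\<And>t. cmod (density_ft \<psi> t) \<le> K * (1 + \<bar>t\<bar>) powr (- 2)"
    and b: "\<And>n t. comb_coeff \<delta> Q (Suc n) * (K * (1 + \<bar>t - real (Suc n)\<bar>) powr (- 2)) \<le> b n t"
    and B: "\<And>N t. (\<Sum>n<N. b n t) \<le> B \<bar>t\<bar>"
  shows "cmod (density_ft (\<lambda>x. \<psi> x * comb \<delta> Q x) t - density_ft \<psi> t) \<le> 2 * B \<bar>t\<bar>"
proof (rule sums_norm_le[OF density_ft_comb_series[OF \<psi> d Q]])
  fix N
  let ?c = "\<lambda>n. comb_coeff \<delta> Q (Suc n)"
  let ?u = "density_ft \<psi>"
  have minus: "?c n * cmod (?u (t - real (Suc n))) \<le> b n t" for n
    by (rule order_trans[OF mult_left_mono[OF K comb_coeff_nonneg] b])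
  have plus: "?c n * cmod (?u (t + real (Suc n))) \<le> b n (- t)" for n
  proof -
    have "\<bar>t + real (Suc n)\<bar> = \<bar>- t - real (Suc n)\<bar>" by linarith
    hence "?c n * cmod (?u (t + real (Suc n))) \<le> ?c n * (K * (1 + \<bar>- t - real (Suc n)\<bar>) powr (- 2))"
      using mult_left_mono[OF K[of "t + real (Suc n)"] comb_coeff_nonneg] by simp
    thus ?thesis using b[of n "- t"] by (rule order_trans)
  qed
  have "norm (?c n *\<^sub>R (?u (t - real (Suc n)) + ?u (t + real (Suc n)))) \<le> b n t + b n (- t)" for n
  proof -
    have "norm (?c n *\<^sub>R (?u (t - real (Suc n)) + ?u (t + real (Suc n))))
        \<le> ?c n * (cmod (?u (t - real (Suc n))) + cmod (?u (t + real (Suc n))))"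
      using comb_coeff_nonneg by (simp add: mult_left_mono norm_triangle_ineq del: of_nat_Suc)
    also have "\<dots> \<le> b n t + b n (- t)" unfolding distrib_left by (rule add_mono[OF minus plus])
    finally show ?thesis .
  qed
  hence "(\<Sum>n<N. norm (?c n *\<^sub>R (?u (t - real (Suc n)) + ?u (t + real (Suc n))))) \<le> (\<Sum>n<N. b n t + b n (- t))"
    by (rule sum_mono)
  also have "\<dots> \<le> 2 * B \<bar>t\<bar>" using B[of t N] B[of "- t" N] by (simp add: sum.distrib)
  finally show "(\<Sum>n<N. norm (?c n *\<^sub>R (?u (t - real (Suc n)) + ?u (t + real (Suc n))))) \<le> 2 * B \<bar>t\<bar>" .
qed

text \<open>
For fixed \<open>Q\<close> the coefficients of the comb decay quadratically, as those of the tent do.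
\<close>

lemma bump_mult_comb:
  assumes \<psi>: "bump \<psi>" and d: "0 < \<delta>" "\<delta> \<le> 1 / 2" and Q: "Q > 0"
  shows "bump (\<lambda>x. \<psi> x * comb \<delta> Q x)"
proof -
  obtain K where K: "K \<ge> 0" "\<And>t. cmod (density_ft \<psi> t) \<le> K * (1 + \<bar>t\<bar>) powr (- 2)"
    using bump_decayE[OF \<psi>] by blast
  obtain S where S: "S > 0" "\<And>t N. (\<Sum>n<N. (1 + \<bar>t - real (Suc n)\<bar>) powr (- 3 / 2)) \<le> S"
    using sum_powr_translates_bounded by blast
  define D where "D = (2 * real Q / \<delta>)\<^sup>2"
  have D0: "D \<ge> 0" by (simp add: D_def)
  define c where "c n = comb_coeff \<delta> Q (Suc n)" for n
  define b where "b n t = 8 * D * K * (1 + \<bar>t\<bar>) powr (- 2) *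
      ((1 + real (Suc n)) powr (- 3 / 2) + (1 + \<bar>t - real (Suc n)\<bar>) powr (- 3 / 2))" for n t
  have c_le: "c n \<le> 4 * D * (1 + real (Suc n)) powr (- 2)" for n
  proof -
    have "c n \<le> D * (1 / (real (Suc n))\<^sup>2)"
      using comb_coeff_le_inverse_square[OF d(1) _ Q, of "Suc n"] by (simp add: c_def D_def)
    also have "\<dots> \<le> D * (4 * (1 + real (Suc n)) powr (- 2))"
      by (intro mult_left_mono inverse_square_le D0) simp
    finally show ?thesis by simp
  qed
  have tm: "c n * (K * (1 + \<bar>t - real (Suc n)\<bar>) powr (- 2)) \<le> b n t" for n t
  proof -
    have "c n * (K * (1 + \<bar>t - real (Suc n)\<bar>) powr (- 2))
        \<le> (4 * D * (1 + real (Suc n)) powr (- 2)) * (K * (1 + \<bar>t - real (Suc n)\<bar>) powr (- 2))"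
      using K(1) by (intro mult_right_mono c_le) auto
    also have "\<dots> = (4 * D * K) * ((1 + real (Suc n)) powr (- 2) * (1 + \<bar>t - real (Suc n)\<bar>) powr (- 2))"
      by (simp only: mult_ac)
    also have "\<dots> \<le> (4 * D * K) * (2 * (1 + \<bar>t\<bar>) powr (- 2) * ((1 + real (Suc n)) powr (- 3 / 2) + (1 + \<bar>t - real (Suc n)\<bar>) powr (- 3 / 2)))"
      using D0 K(1) by (intro mult_left_mono convolution_term_le_fast) auto
    also have "\<dots> = b n t"
    proof -
      have "(4 * D * K) * (2 * T * X) = 8 * D * K * T * X" for T X :: real by simp
      thus ?thesis by (simp only: b_def)
    qed
    finally show ?thesis .
  qed
  have b_sum: "(\<Sum>n<N. b n t) \<le> 16 * D * K * S * (1 + \<bar>t\<bar>) powr (- 2)" for N t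
  proof -
    have "(\<Sum>n<N. (1 + real (Suc n)) powr (- 3 / 2)) \<le> S" using S(2)[of 0 N] by simp
    hence "(\<Sum>n<N. ((1 + real (Suc n)) powr (- 3 / 2) + (1 + \<bar>t - real (Suc n)\<bar>) powr (- 3 / 2))) \<le> 2 * S"
      using S(2)[where t = t and N = N] by (simp add: sum.distrib del: of_nat_Suc)
    hence "8 * D * K * (1 + \<bar>t\<bar>) powr (- 2) * (\<Sum>n<N. ((1 + real (Suc n)) powr (- 3 / 2) + (1 + \<bar>t - real (Suc n)\<bar>) powr (- 3 / 2)))
       \<le> 8 * D * K * (1 + \<bar>t\<bar>) powr (- 2) * (2 * S)"
      using D0 K(1) by (intro mult_left_mono) auto
    thus ?thesis unfolding b_def sum_distrib_left[symmetric] by (simp add: mult_ac)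
  qed
  have diff: "cmod (density_ft (\<lambda>x. \<psi> x * comb \<delta> Q x) t - density_ft \<psi> t) \<le> 2 * (16 * D * K * S * (1 + \<bar>t\<bar>) powr (- 2))" for t
    using tm b_sum unfolding c_def
    by (rule density_ft_comb_diff_le[OF \<psi> d Q K(2), where B = "\<lambda>a. 16 * D * K * S * (1 + a) powr (- 2)"])
  have decay: "cmod (density_ft (\<lambda>x. \<psi> x * comb \<delta> Q x) t) \<le> (32 * D * K * S + K) * (1 + \<bar>t\<bar>) powr (- 2)" for t
  proof -
    have "cmod a \<le> cmod (a - b) + cmod b" for a b using norm_triangle_ineq[of "a - b" b] by simp
    from this[of "density_ft (\<lambda>x. \<psi> x * comb \<delta> Q x) t" "density_ft \<psi> t"]
    show ?thesis using diff[of t] K(2)[of t] unfolding distrib_right by linarith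
  qed
  obtain B where B: "\<And>x. \<psi> x \<le> B" using \<psi> unfolding bump_def by auto
  have B0: "B \<ge> 0" using order_trans[OF bumpD(2)[OF \<psi>] B] .
  have "\<psi> x * comb \<delta> Q x \<le> B * (1 / \<delta>)" for x
    using B0 by (intro mult_mono B comb_le d Q comb_nonneg) auto
  moreover have "(\<lambda>x. \<psi> x * comb \<delta> Q x) \<in> borel_measurable borel"
    using bumpD(1)[OF \<psi>] borel_measurable_continuous_onI[OF continuous_comb[of \<delta> Q]] by measurable
  ultimately show ?thesis unfolding bump_def
    using decay bumpD(2,3)[OF \<psi>] comb_nonneg[OF d(1)] by (intro conjI allI impI exI) auto
qed

text \<open>
The coefficients of the comb are at most a constant times \<open>n powr (- \<alpha> / 2 + e' / 2)\<close>, and they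
vanish for \<open>n < Q\<close>. Giving up another \<open>n powr (e' / 2)\<close> gains the factor \<open>Q powr (- e' / 2)\<close>, which
beats all the constants when \<open>Q\<close> is large, since they depend on \<open>\<psi>\<close>, \<open>\<alpha>\<close> and \<open>\<epsilon>\<close> but not on \<open>Q\<close>.
\<close>

lemma kaufman_step:
  assumes \<psi>: "bump \<psi>" and a: "0 < \<alpha>" "\<alpha> < 1 / 2" and e: "\<epsilon> > 0"
  shows "\<exists>Q\<ge>N. 2 \<le> Q \<and> (\<forall>t. cmod (density_ft (\<lambda>x. \<psi> x * comb (comb_width \<alpha> Q) Q x) t - density_ft \<psi> t)
      \<le> \<epsilon> * (1 + \<bar>t\<bar>) powr (- \<alpha> / 2 + \<epsilon>))"
proof -
  obtain K where K: "K \<ge> 0" "\<And>t. cmod (density_ft \<psi> t) \<le> K * (1 + \<bar>t\<bar>) powr (- 2)"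
    using bump_decayE[OF \<psi>] by blast
  obtain S where S: "S > 0" "\<And>t N. (\<Sum>n<N. (1 + \<bar>t - real (Suc n)\<bar>) powr (- 3 / 2)) \<le> S"
    using sum_powr_translates_bounded by blast
  \<comment> \<open>Capping the loss keeps the exponent \<open>\<beta>\<close> in the range of \<open>convolution_term_le_slow\<close>.\<close>
  define e' where "e' = min \<epsilon> (\<alpha> / 4)"
  have e': "e' > 0" "e' \<le> \<epsilon>" "e' \<le> \<alpha> / 4" using e a by (auto simp: e'_def)
  define \<beta> where "\<beta> = \<alpha> / 2 - e'"
  have \<beta>: "0 \<le> \<beta>" "\<beta> \<le> 1 / 2" using a e' by (auto simp: \<beta>_def)
  obtain C where C: "C > 0" "\<And>n. n > 0 \<Longrightarrow> real (card {q. q dvd n}) \<le> C * real n powr (e' / 2)"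
    using card_divisors_le_powr[of "e' / 2"] e'(1) by (metis half_gt_zero)
  have "((\<lambda>x. real x powr (- (e' / 2))) \<longlongrightarrow> 0) sequentially"
    by (rule tendsto_neg_powr) (use e'(1) filterlim_real_sequentially in auto)
  moreover have pos: "\<epsilon> / (8 * C * K * S + 1) > 0" using e C(1) K(1) S(1) by (intro divide_pos_pos add_nonneg_pos) auto
  ultimately have "\<forall>\<^sub>F Q in sequentially. real Q powr (- (e' / 2)) < \<epsilon> / (8 * C * K * S + 1)"
    by (rule order_tendstoD(2))
  hence "\<forall>\<^sub>F Q in sequentially. real Q powr (- (e' / 2)) < \<epsilon> / (8 * C * K * S + 1) \<and> Q \<ge> N \<and> Q \<ge> 2"
    by (intro eventually_conj eventually_ge_at_top)
  then obtain Q where Q: "real Q powr (- (e' / 2)) < \<epsilon> / (8 * C * K * S + 1)" "Q \<ge> N" "Q \<ge> 2"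
    using eventually_happens'[OF sequentially_bot] by blast
  have Q0: "Q > 0" using Q by simp
  define z where "z = real Q powr (- (e' / 2))"
  have z0: "z \<ge> 0" by (simp add: z_def)
  have zQ: "8 * C * K * S * z \<le> \<epsilon>"
  proof -
    have "(8 * C * K * S + 1) * z \<le> \<epsilon>" using Q(1) pos e C(1) K(1) S(1) unfolding z_def
      by (subst mult.commute, intro pos_le_divide_eq[THEN iffD1] less_imp_le) (auto intro!: add_nonneg_pos)
    thus ?thesis using z0 by (simp add: distrib_right)
  qed
  define \<delta> where "\<delta> = comb_width \<alpha> Q"
  have d: "0 < \<delta>" "\<delta> \<le> 1 / 2" using comb_width_bounds[OF a Q(3)] by (auto simp: \<delta>_def)
  define c where "c n = comb_coeff \<delta> Q (Suc n)" for n
  have c_le: "c n \<le> 4 * C * z * (1 + real (Suc n)) powr (- \<beta>)" for n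
  proof (cases "Suc n < Q")
    case True
    hence "c n = 0" using comb_coeff_eq_0[of "Suc n" Q \<delta>] by (simp add: c_def)
    thus ?thesis using C(1) z0 by simp
  next
    case False
    define m where "m = real (Suc n)"
    have m1: "m \<ge> 1" by (simp add: m_def)
    have mQ: "m \<ge> real Q" using False unfolding m_def by linarith
    have "c n \<le> 2 * real (card {q. q dvd Suc n}) * m powr (- \<alpha> / 2)"
      unfolding c_def \<delta>_def m_def using Q by (intro comb_coeff_decay[OF a]) auto
    also have "\<dots> \<le> 2 * (C * m powr (e' / 2)) * m powr (- \<alpha> / 2)"
      using C(2)[of "Suc n"] by (intro mult_right_mono mult_left_mono) (auto simp: m_def)
    also have "\<dots> = 2 * C * (m powr (e' / 2) * m powr (- \<alpha> / 2))" by simp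
    also have "m powr (e' / 2) * m powr (- \<alpha> / 2) = m powr (- (e' / 2)) * m powr (- \<beta>)"
      unfolding powr_add[symmetric] \<beta>_def by (simp add: field_simps)
    also have "2 * C * (m powr (- (e' / 2)) * m powr (- \<beta>)) \<le> 2 * C * (z * (2 * (1 + m) powr (- \<beta>)))"
    proof (intro mult_left_mono mult_mono)
      show "m powr (- (e' / 2)) \<le> z" unfolding z_def using mQ Q(3) e'(1) by (intro powr_mono2') auto
      have "(2 * m) powr (- \<beta>) \<le> (1 + m) powr (- \<beta>)" using m1 \<beta> by (intro powr_mono2') auto
      hence "2 powr (- \<beta>) * m powr (- \<beta>) \<le> (1 + m) powr (- \<beta>)" by (simp add: powr_mult)
      moreover have "2 powr (-1) \<le> (2::real) powr (- \<beta>)" using \<beta> by (intro powr_mono) auto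
      hence "(1/2) * m powr (- \<beta>) \<le> 2 powr (- \<beta>) * m powr (- \<beta>)" by (intro mult_right_mono) (auto simp: powr_minus)
      ultimately show "m powr (- \<beta>) \<le> 2 * (1 + m) powr (- \<beta>)" by linarith
    qed (use C(1) z0 in auto)
    finally show ?thesis by (simp add: m_def mult_ac)
  qed
  define b where "b n t = 4 * C * K * z * (1 + \<bar>t\<bar>) powr (- \<beta>) * (1 + \<bar>t - real (Suc n)\<bar>) powr (- 3 / 2)" for n t
  have tm: "c n * (K * (1 + \<bar>t - real (Suc n)\<bar>) powr (- 2)) \<le> b n t" for n t
  proof -
    have "c n * (K * (1 + \<bar>t - real (Suc n)\<bar>) powr (- 2))
        \<le> (4 * C * z * (1 + real (Suc n)) powr (- \<beta>)) * (K * (1 + \<bar>t - real (Suc n)\<bar>) powr (- 2))"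
      using K(1) by (intro mult_right_mono c_le) auto
    also have "\<dots> = (4 * C * K * z) * ((1 + real (Suc n)) powr (- \<beta>) * (1 + \<bar>t - real (Suc n)\<bar>) powr (- 2))"
      by (simp only: mult_ac)
    also have "\<dots> \<le> (4 * C * K * z) * ((1 + \<bar>t\<bar>) powr (- \<beta>) * (1 + \<bar>t - real (Suc n)\<bar>) powr (- 3 / 2))"
      using C(1) z0 K(1) by (intro mult_left_mono convolution_term_le_slow \<beta>) auto
    also have "\<dots> = b n t" by (simp only: b_def mult_ac)
    finally show ?thesis .
  qed
  have b_sum: "(\<Sum>n<N. b n t) \<le> 4 * C * K * S * z * (1 + \<bar>t\<bar>) powr (- \<beta>)" for N t
  proof -
    have "4 * C * K * z * (1 + \<bar>t\<bar>) powr (- \<beta>) * (\<Sum>n<N. (1 + \<bar>t - real (Suc n)\<bar>) powr (- 3 / 2))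
       \<le> 4 * C * K * z * (1 + \<bar>t\<bar>) powr (- \<beta>) * S"
      using C(1) z0 K(1) by (intro mult_left_mono S) auto
    thus ?thesis unfolding b_def sum_distrib_left[symmetric] by (simp only: mult_ac)
  qed
  have "cmod (density_ft (\<lambda>x. \<psi> x * comb \<delta> Q x) t - density_ft \<psi> t) \<le> 2 * (4 * C * K * S * z * (1 + \<bar>t\<bar>) powr (- \<beta>))" for t
    using tm b_sum unfolding c_def
    by (rule density_ft_comb_diff_le[OF \<psi> d Q0 K(2), where B = "\<lambda>a. 4 * C * K * S * z * (1 + a) powr (- \<beta>)"])
  moreover have "2 * (4 * C * K * S * z * (1 + \<bar>t\<bar>) powr (- \<beta>)) \<le> \<epsilon> * (1 + \<bar>t\<bar>) powr (- \<alpha> / 2 + \<epsilon>)" for t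
  proof -
    have "(8 * C * K * S * z) * (1 + \<bar>t\<bar>) powr (- \<beta>) \<le> \<epsilon> * (1 + \<bar>t\<bar>) powr (- \<alpha> / 2 + \<epsilon>)"
      using zQ e e' by (intro mult_mono powr_mono) (auto simp: \<beta>_def)
    thus ?thesis by simp
  qed
  ultimately show ?thesis using Q unfolding \<delta>_def by (meson order_trans)
qed

section \<open>The measure on the Kaufman set\<close>

lemma bump_tent: "bump (tent 1)" "(\<integral>x. tent 1 x \<partial>lborel) = 1"
proof -
  have int: "integrable lborel (tent 1)"
  proof -
    have "set_integrable lborel {-1..1} (tent 1)"
      unfolding tent_def by (intro borel_integrable_atLeastAtMost' continuous_intros) auto
    moreover have "indicator {-1..1} x *\<^sub>R tent 1 x = tent 1 x" for x
      by (cases "x \<in> {-1..1}") (auto simp: tent_def max_def)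
    ultimately show ?thesis unfolding set_integrable_def by (simp only:)
  qed
  have lint: "(\<integral>x. tent 1 x * f x \<partial>lborel) = integral {-1..1} (\<lambda>x. tent 1 x * f x)"
    if "continuous_on UNIV f" for f
  proof -
    have "set_integrable lborel {-1..1} (\<lambda>x. tent 1 x * f x)"
      unfolding tent_def
      by (intro borel_integrable_atLeastAtMost' continuous_intros continuous_on_subset[OF that]) auto
    from set_borel_integral_eq_integral(2)[OF this]
    have "(\<integral>x. indicator {-1..1} x *\<^sub>R (tent 1 x * f x) \<partial>lborel) = integral {-1..1} (\<lambda>x. tent 1 x * f x)"
      by (simp only: set_lebesgue_integral_def)
    moreover have "indicator {-1..1} x *\<^sub>R (tent 1 x * f x) = tent 1 x * f x" for x
      by (cases "x \<in> {-1..1}") (auto simp: tent_def max_def)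
    ultimately show ?thesis by (simp only:)
  qed
  have cos: "(\<integral>x. tent 1 x * cos (2 * pi * t * x) \<partial>lborel) = tent_coeff 1 t" for t
    using lint[of "\<lambda>x. cos (2 * pi * t * x)"] integral_unique[OF tent_cos_has_integral[of 1 1 t]]
    by (simp add: continuous_intros)
  from cos[of 0] show one: "(\<integral>x. tent 1 x \<partial>lborel) = 1" by (simp add: tent_coeff_def)
  have sin: "(\<integral>x. tent 1 x * sin (- (2 * pi * t * x)) \<partial>lborel) = 0" for t
  proof -
    have "(\<integral>x. tent 1 x * sin (- (2 * pi * t * x)) \<partial>lborel)
        = (\<integral>x. - (tent 1 x * sin (- (2 * pi * t * x))) \<partial>lborel)"
      by (subst lborel_integral_real_affine[of "-1" _ 0]) (simp_all add: tent_def)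
    thus ?thesis by simp
  qed
  have ft: "density_ft (tent 1) t = of_real (tent_coeff 1 t)" for t
  proof (rule complex_eqI)
    have i: "integrable lborel (\<lambda>x. tent 1 x *\<^sub>R cis (- (2 * pi * t) * x))"
      by (rule integrable_scaleR_cis[OF int])
    show "Re (density_ft (tent 1) t) = Re (of_real (tent_coeff 1 t))"
      using integral_Re[OF i] cos[of t] by (simp add: density_ft_def)
    show "Im (density_ft (tent 1) t) = Im (of_real (tent_coeff 1 t))"
      using integral_Im[OF i] sin[of t] by (simp add: density_ft_def)
  qed
  have "cmod (density_ft (tent 1) t) \<le> 4 * (1 + \<bar>t\<bar>) powr (- 2)" for t
  proof (cases "\<bar>t\<bar> \<le> 1")
    case True
    have "2 powr (- 2) \<le> (1 + \<bar>t\<bar>) powr (- 2)" using True by (intro powr_mono2') auto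
    hence "1 \<le> 4 * (1 + \<bar>t\<bar>) powr (- 2)" by (simp add: powr_minus)
    thus ?thesis using tent_coeff_le_1[of 1 t] tent_coeff_nonneg[of 1 t] unfolding ft by simp
  next
    case False
    have "(1 + \<bar>t\<bar>)\<^sup>2 \<le> (2 * \<bar>t\<bar>)\<^sup>2" using False by (intro power_mono) auto
    hence "1 / (2 * \<bar>t\<bar>)\<^sup>2 \<le> 1 / (1 + \<bar>t\<bar>)\<^sup>2" using False by (intro divide_left_mono) auto
    hence "1 / t\<^sup>2 \<le> 4 * (1 + \<bar>t\<bar>) powr (- 2)" using False
      by (simp add: powr_minus_divide power_mult_distrib)
    moreover have "tent_coeff 1 t \<le> 1 / t\<^sup>2" using tent_coeff_le_square[of 1 t] False by (simp add: power_divide)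
    ultimately show ?thesis using tent_coeff_nonneg[of 1 t] unfolding ft by simp
  qed
  moreover have "tent 1 \<in> borel_measurable borel" using borel_measurable_integrable[OF int] by simp
  ultimately show "bump (tent 1)" unfolding bump_def
    using tent_nonneg[of 1] tent_le[of 1] tent_eq_0[of 1] by (intro conjI allI impI exI) auto
qed

definition kaufman_level :: "real \<Rightarrow> nat \<Rightarrow> real set" where
  "kaufman_level \<alpha> Q = {x \<in> {-1..1}. \<exists>q\<in>{Q..<2*Q}. int_dist (real q * x) \<le> comb_width \<alpha> Q}"

lemma closed_kaufman_level: "closed (kaufman_level \<alpha> Q)"
proof -
  have "closed {x. int_dist (real q * x) \<le> comb_width \<alpha> Q}" for q
  proof (rule closed_Collect_le)
    show "continuous_on UNIV (\<lambda>x. int_dist (real q * x))"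
      by (rule continuous_on_compose2[OF continuous_int_dist]) (auto intro!: continuous_intros)
  qed simp
  hence "closed ({-1..1} \<inter> (\<Union>q\<in>{Q..<2*Q}. {x. int_dist (real q * x) \<le> comb_width \<alpha> Q}))"
    by (intro closed_Int closed_UN) auto
  moreover have "kaufman_level \<alpha> Q = {-1..1} \<inter> (\<Union>q\<in>{Q..<2*Q}. {x. int_dist (real q * x) \<le> comb_width \<alpha> Q})"
    by (auto simp: kaufman_level_def)
  ultimately show ?thesis by simp
qed

text \<open>
The tolerance \<open>(1/2)^(n+2)\<close> is used for the constant as well as for the loss in the exponent. Its sum is
\<open>1 / 2\<close>, so at least half of the mass survives; it tends to 0, so no loss in the exponent
remains in the limit.
\<close>

lemma kaufman_sequence:
  assumes a: "0 < \<alpha>" "\<alpha> < 1 / 2"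
  shows "\<exists>\<psi> Q. \<psi> 0 = tent 1 \<and> (\<forall>n. bump (\<psi> n) \<and> n \<le> Q n \<and> 2 \<le> Q n \<and>
     \<psi> (Suc n) = (\<lambda>x. \<psi> n x * comb (comb_width \<alpha> (Q n)) (Q n) x) \<and>
     (\<forall>t. cmod (density_ft (\<psi> (Suc n)) t - density_ft (\<psi> n) t)
        \<le> (1/2)^(n+2) * (1 + \<bar>t\<bar>) powr (- \<alpha> / 2 + (1/2)^(n+2))))"
proof -
  define R where "R n p p' \<longleftrightarrow> n \<le> snd p' \<and> 2 \<le> snd p' \<and>
     fst p' = (\<lambda>x. fst p x * comb (comb_width \<alpha> (snd p')) (snd p') x) \<and>
     (\<forall>t. cmod (density_ft (fst p') t - density_ft (fst p) t)
        \<le> (1/2)^(n+2) * (1 + \<bar>t\<bar>) powr (- \<alpha> / 2 + (1/2)^(n+2)))"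
    for n and p p' :: "(real \<Rightarrow> real) \<times> nat"
  have "\<exists>f. \<forall>n. (bump (fst (f n)) \<and> (n = 0 \<longrightarrow> fst (f n) = tent 1)) \<and> R n (f n) (f (Suc n))"
  proof (rule dependent_nat_choice)
    show "\<exists>p::(real \<Rightarrow> real) \<times> nat. bump (fst p) \<and> (0 = 0 \<longrightarrow> fst p = tent 1)"
      by (rule exI[of _ "(tent 1, 0::nat)"]) (simp add: bump_tent(1))
    fix p :: "(real \<Rightarrow> real) \<times> nat" and n :: nat
    assume "bump (fst p) \<and> (n = 0 \<longrightarrow> fst p = tent 1)"
    hence b: "bump (fst p)" by simp
    obtain Q where Q: "Q \<ge> n" "2 \<le> Q"
      "\<forall>t. cmod (density_ft (\<lambda>x. fst p x * comb (comb_width \<alpha> Q) Q x) t - density_ft (fst p) t)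
        \<le> (1/2)^(n+2) * (1 + \<bar>t\<bar>) powr (- \<alpha> / 2 + (1/2)^(n+2))"
      using kaufman_step[OF b a, of "(1/2)^(n+2)" n] by auto
    have "bump (\<lambda>x. fst p x * comb (comb_width \<alpha> Q) Q x)"
      using comb_width_bounds[OF a Q(2)] Q(2) by (intro bump_mult_comb b) auto
    thus "\<exists>p'. (bump (fst p') \<and> (Suc n = 0 \<longrightarrow> fst p' = tent 1)) \<and> R n p p'"
      using Q by (intro exI[of _ "(\<lambda>x. fst p x * comb (comb_width \<alpha> Q) Q x, Q)"]) (simp add: R_def)
  qed
  then obtain f where f: "\<And>n. bump (fst (f n))" "fst (f 0) = tent 1" "\<And>n. R n (f n) (f (Suc n))" by blast
  show ?thesis
    by (intro exI[of _ "\<lambda>n. fst (f n)"] exI[of _ "\<lambda>n. snd (f (Suc n))"] conjI allI f(1,2))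
      (use f(3)[unfolded R_def] in blast)+
qed

text \<open>
The normalized densities \<open>\<psi> n\<close> live on \<open>{-1..1}\<close>, so a subsequence converges weakly. The limit
inherits the decay of the Fourier transforms, and it is carried by every closed set that carries all
but finitely many of the densities, in particular by each level of the Kaufman set.
\<close>

lemma salem_measure:
  assumes a: "0 < \<alpha>" "\<alpha> < 1 / 2"
  shows "\<exists>Q \<nu>. (\<forall>n. n \<le> Q n \<and> 2 \<le> Q n) \<and> real_distribution \<nu> \<and> (AE x in \<nu>. \<forall>n. x \<in> kaufman_level \<alpha> (Q n)) \<and>
     (\<forall>\<epsilon>>0. \<exists>K. \<forall>t. cmod (char \<nu> (- (2 * pi * t))) \<le> K * (1 + \<bar>t\<bar>) powr (- \<alpha> / 2 + \<epsilon>))"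
proof -
  from kaufman_sequence[OF a] obtain \<psi> Q where \<psi>0: "\<psi> 0 = tent 1" and
    all: "\<And>n. bump (\<psi> n) \<and> n \<le> Q n \<and> 2 \<le> Q n \<and>
     \<psi> (Suc n) = (\<lambda>x. \<psi> n x * comb (comb_width \<alpha> (Q n)) (Q n) x) \<and>
     (\<forall>t. cmod (density_ft (\<psi> (Suc n)) t - density_ft (\<psi> n) t)
        \<le> (1/2)^(n+2) * (1 + \<bar>t\<bar>) powr (- \<alpha> / 2 + (1/2)^(n+2)))" by blast
  have \<psi>: "bump (\<psi> n)" and Q: "n \<le> Q n" "2 \<le> Q n"
    and \<psi>Suc: "\<psi> (Suc n) = (\<lambda>x. \<psi> n x * comb (comb_width \<alpha> (Q n)) (Q n) x)"
    and diff: "cmod (density_ft (\<psi> (Suc n)) t - density_ft (\<psi> n) t)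
        \<le> (1/2)^(n+2) * (1 + \<bar>t\<bar>) powr (- \<alpha> / 2 + (1/2)^(n+2))" for n t
    using all[of n] by blast+
  define m where "m n = (\<integral>x. \<psi> n x \<partial>lborel)" for n
  have ft0: "density_ft (\<psi> n) 0 = of_real (m n)" for n
    by (simp add: density_ft_def m_def cis_zero scaleR_conv_of_real)
  have m_ge: "m n \<ge> 1 / 2 + (1 / 2) ^ (n + 1)" for n
  proof (induction n)
    case 0 show ?case using bump_tent(2) by (simp add: m_def \<psi>0)
  next
    case (Suc n)
    have "\<bar>m (Suc n) - m n\<bar> \<le> (1/2)^(n+2)"
      using diff[of n 0] unfolding ft0 of_real_diff[symmetric] norm_of_real by simp
    hence "m (Suc n) \<ge> m n - (1/2)^(n+2)" by linarith
    moreover have "(1/2::real) ^ (n + 1) - (1/2)^(n+2) = (1/2) ^ (Suc n + 1)" by simp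
    ultimately show ?case using Suc by linarith
  qed
  have m_half: "m n \<ge> 1 / 2" for n using m_ge[of n] zero_le_power[of "1/2::real" "n + 1"] by linarith
  hence m0: "m n > 0" for n by (rule less_le_trans[rotated]) simp
  define M where "M n = density lborel (\<lambda>x. ennreal (\<psi> n x / m n))" for n
  have meas[measurable]: "\<psi> n \<in> borel_measurable borel" for n using bumpD(1)[OF \<psi>] .
  have nonneg: "\<psi> n x / m n \<ge> 0" for n x using bumpD(2)[OF \<psi>] less_imp_le[OF m0] by (rule divide_nonneg_nonneg)
  have rd: "real_distribution (M n)" for n
  proof -
    have "(\<integral>\<^sup>+x. ennreal (\<psi> n x / m n) \<partial>lborel) = ennreal (\<integral>x. \<psi> n x / m n \<partial>lborel)"
      using nonneg bump_integrable[OF \<psi>] by (intro nn_integral_eq_integral) auto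
    also have "(\<integral>x. \<psi> n x / m n \<partial>lborel) = 1" using m0[of n] by (simp add: m_def[symmetric])
    finally have "emeasure (M n) (space (M n)) = 1" by (simp add: M_def emeasure_density)
    thus ?thesis unfolding real_distribution_def real_distribution_axioms_def
      by (auto intro!: prob_spaceI simp: M_def)
  qed
  have AE_supp: "AE x in M n. \<psi> n x \<noteq> 0" for n
    unfolding M_def by (subst AE_density) auto
  have char_M: "char (M n) (- (2 * pi * t)) = density_ft (\<psi> n) t / of_real (m n)" for n t
  proof -
    have "char (M n) (- (2 * pi * t)) = (\<integral>x. (\<psi> n x / m n) *\<^sub>R iexp (- (2 * pi * t) * x) \<partial>lborel)"
      unfolding char_def M_def using nonneg by (subst integral_density) auto
    also have "\<dots> = (\<integral>x. (\<psi> n x *\<^sub>R cis (- (2 * pi * t * x))) / of_real (m n) \<partial>lborel)"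
      by (rule Bochner_Integration.integral_cong) (auto simp: cis_conv_exp scaleR_conv_of_real)
    finally show ?thesis by (simp add: density_ft_def)
  qed
  have "tight M" unfolding tight_def
  proof (intro conjI allI impI rd)
    fix \<epsilon> :: real assume "\<epsilon> > 0"
    have "measure (M n) {-2<..2} = 1" for n
    proof -
      interpret real_distribution "M n" by (rule rd)
      have "AE x in M n. x \<in> {-2<..2}"
        using AE_supp
      proof (rule AE_mp, intro AE_I2 impI)
        fix x assume "\<psi> n x \<noteq> 0"
        hence "\<bar>x\<bar> \<le> 1" using bumpD(3)[OF \<psi>, of x n] by linarith
        thus "x \<in> {-2<..2}" by auto
      qed
      thus ?thesis by (intro prob_eq_1[THEN iffD2]) auto
    qed
    thus "\<exists>a b::real. a < b \<and> (\<forall>n. measure (M n) {a<..b} > 1 - \<epsilon>)" using \<open>\<epsilon> > 0\<close>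
      by (intro exI[of _ "-2"] exI[of _ 2]) auto
  qed
  from tight_imp_convergent_subsubsequence[OF this strict_mono_id]
  obtain r \<nu> where r: "strict_mono r" and \<nu>: "real_distribution \<nu>" and conv: "weak_conv_m (M \<circ> id \<circ> r) \<nu>"
    by blast
  have conv': "weak_conv_m (\<lambda>k. M (r k)) \<nu>" using conv by (simp add: o_def)
  interpret \<nu>: real_distribution \<nu> by (rule \<nu>)
  have ae: "AE x in \<nu>. x \<in> kaufman_level \<alpha> (Q n)" for n
  proof -
    let ?A = "kaufman_level \<alpha> (Q n)"
    \<comment> \<open>A bounded continuous function that vanishes exactly on the closed level.\<close>
    define g where "g x = min 1 (infdist x ?A)" for x
    have "0 \<in> ?A" using Q(2)[of n] comb_width_bounds(1)[OF a Q(2), of n]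
      unfolding kaufman_level_def by (auto simp: int_dist_def intro!: bexI[of _ "Q n"])
    hence ne: "?A \<noteq> {}" by blast
    have g0: "g x \<ge> 0" for x by (simp add: g_def infdist_nonneg)
    have g_cont: "isCont g x" for x unfolding g_def by (intro continuous_intros)
    have lim: "(\<lambda>k. integral\<^sup>L (M (r k)) g) \<longlonglongrightarrow> integral\<^sup>L \<nu> g"
      by (rule weak_conv_imp_integral_bdd_continuous_conv[OF rd \<nu> conv' g_cont, where B = 1])
        (use g0 in \<open>auto simp: g_def\<close>)
    have in_level: "\<psi> k x \<noteq> 0 \<Longrightarrow> x \<in> ?A" if "k > n" for k x
      using that
    proof (induction k)
      case (Suc k)
      show ?case
      proof (cases "k = n")
        case True
        have "comb (comb_width \<alpha> (Q n)) (Q n) x \<noteq> 0" using Suc.prems True by (simp add: \<psi>Suc)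
        from comb_nonzero_imp[OF comb_width_bounds(1)[OF a Q(2)] this]
        have "\<exists>q\<in>{Q n..<2 * Q n}. int_dist (real q * x) \<le> comb_width \<alpha> (Q n)" .
        moreover have "\<bar>x\<bar> \<le> 1" using bumpD(3)[OF \<psi>, of x "Suc k"] Suc.prems by linarith
        ultimately show ?thesis by (auto simp: kaufman_level_def abs_le_iff)
      next
        case False
        thus ?thesis using Suc by (simp add: \<psi>Suc)
      qed
    qed simp
    have "\<forall>\<^sub>F k in sequentially. integral\<^sup>L (M (r k)) g = 0"
      using eventually_gt_at_top[of n]
    proof eventually_elim
      case (elim k)
      hence "r k > n" using seq_suble[OF r, of k] by linarith
      hence "AE x in M (r k). g x = 0"
        using AE_supp[of "r k"] by (rule_tac AE_mp[rotated]) (auto intro!: AE_I2 simp: g_def dest: in_level)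
      thus ?case by (rule integral_eq_zero_AE)
    qed
    hence "(\<lambda>k. integral\<^sup>L (M (r k)) g) \<longlonglongrightarrow> 0" by (rule tendsto_eventually)
    hence int0: "integral\<^sup>L \<nu> g = 0" using lim LIMSEQ_unique by blast
    have g_meas: "g \<in> borel_measurable borel"
      using g_cont by (intro borel_measurable_continuous_onI continuous_at_imp_continuous_on) auto
    have "integrable \<nu> g"
      using g_meas g0 by (intro \<nu>.integrable_const_bound[where B = 1]) (auto simp: g_def)
    hence "AE x in \<nu>. g x = 0" using integral_nonneg_eq_0_iff_AE[of \<nu> g] g0 int0 by auto
    thus ?thesis
    proof (rule AE_mp, intro AE_I2 impI)
      fix x assume "g x = 0"
      hence "infdist x ?A = 0" by (simp add: g_def min_def split: if_splits)
      thus "x \<in> ?A" using in_closed_iff_infdist_zero[OF closed_kaufman_level ne] by blast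
    qed
  qed
  have "\<exists>K. \<forall>t. cmod (char \<nu> (- (2 * pi * t))) \<le> K * (1 + \<bar>t\<bar>) powr (- \<alpha> / 2 + \<epsilon>)" if eps: "\<epsilon> > 0" for \<epsilon>
  proof -
    obtain n0 where n0: "(1/2::real) ^ n0 < \<epsilon>" using real_arch_pow_inv[OF eps, of "1/2"] by auto
    obtain K where K: "K \<ge> 0" "\<And>t. cmod (density_ft (\<psi> n0) t) \<le> K * (1 + \<bar>t\<bar>) powr (- 2)"
      using bump_decayE[OF \<psi>] by blast
    have bound: "cmod (density_ft (\<psi> (n0 + j)) t) \<le> (K + (1 - (1/2)^j)) * (1 + \<bar>t\<bar>) powr (- \<alpha> / 2 + \<epsilon>)" for j t
    proof (induction j)
      case 0
      have "K * (1 + \<bar>t\<bar>) powr (- 2) \<le> K * (1 + \<bar>t\<bar>) powr (- \<alpha> / 2 + \<epsilon>)"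
        using a eps K(1) by (intro mult_left_mono powr_mono) auto
      thus ?case using K(2)[of t] by simp
    next
      case (Suc j)
      have e: "(1/2::real)^(n0 + j + 2) \<le> (1/2)^(Suc j)" "(1/2::real)^(n0 + j + 2) \<le> (1/2)^n0"
        by (rule power_decreasing; simp)+
      have "(1/2)^(n0+j+2) * (1 + \<bar>t\<bar>) powr (- \<alpha> / 2 + (1/2)^(n0+j+2)) \<le> (1/2)^(Suc j) * (1 + \<bar>t\<bar>) powr (- \<alpha> / 2 + \<epsilon>)"
        using e n0 by (intro mult_mono powr_mono) auto
      hence d: "cmod (density_ft (\<psi> (Suc (n0 + j))) t - density_ft (\<psi> (n0 + j)) t) \<le> (1/2)^(Suc j) * (1 + \<bar>t\<bar>) powr (- \<alpha> / 2 + \<epsilon>)"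
        using diff[of "n0 + j" t] by linarith
      have "cmod (density_ft (\<psi> (n0 + Suc j)) t) \<le> cmod (density_ft (\<psi> (Suc (n0 + j))) t - density_ft (\<psi> (n0 + j)) t) + cmod (density_ft (\<psi> (n0 + j)) t)"
        using norm_triangle_ineq[of "density_ft (\<psi> (Suc (n0 + j))) t - density_ft (\<psi> (n0 + j)) t" "density_ft (\<psi> (n0 + j)) t"] by simp
      also have "\<dots> \<le> (1/2)^(Suc j) * (1 + \<bar>t\<bar>) powr (- \<alpha> / 2 + \<epsilon>) + (K + (1 - (1/2)^j)) * (1 + \<bar>t\<bar>) powr (- \<alpha> / 2 + \<epsilon>)"
        by (rule add_mono[OF d Suc])
      also have "\<dots> = (K + (1 - (1/2)^(Suc j))) * (1 + \<bar>t\<bar>) powr (- \<alpha> / 2 + \<epsilon>)"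
        by (simp add: algebra_simps)
      finally show ?case .
    qed
    have M_bound: "cmod (char (M k) (- (2 * pi * t))) \<le> 2 * (K + 1) * (1 + \<bar>t\<bar>) powr (- \<alpha> / 2 + \<epsilon>)" if kn: "n0 \<le> k" for k t
    proof -
      obtain j where j: "k = n0 + j" using le_Suc_ex[OF kn] by blast
      have "cmod (density_ft (\<psi> k) t) \<le> (K + 1) * (1 + \<bar>t\<bar>) powr (- \<alpha> / 2 + \<epsilon>)"
        unfolding j by (rule order_trans[OF bound]) (intro mult_right_mono, auto)
      hence le: "cmod (density_ft (\<psi> k) t) / (1/2) \<le> 2 * (K + 1) * (1 + \<bar>t\<bar>) powr (- \<alpha> / 2 + \<epsilon>)" by (simp add: algebra_simps)
      have "cmod (char (M k) (- (2 * pi * t))) = cmod (density_ft (\<psi> k) t) / m k"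
        using m0[of k] by (simp add: char_M norm_divide)
      also have "\<dots> \<le> cmod (density_ft (\<psi> k) t) / (1/2)"
        using m_half[of k] by (intro divide_left_mono) auto
      finally show ?thesis using le by (rule order_trans)
    qed
    have "cmod (char \<nu> (- (2 * pi * t))) \<le> 2 * (K + 1) * (1 + \<bar>t\<bar>) powr (- \<alpha> / 2 + \<epsilon>)" for t
    proof (rule LIMSEQ_le_const2)
      show "(\<lambda>k. cmod (char (M (r k)) (- (2 * pi * t)))) \<longlonglongrightarrow> cmod (char \<nu> (- (2 * pi * t)))"
        by (intro tendsto_norm levy_continuity1[OF rd \<nu> conv'])
      show "\<exists>N. \<forall>k\<ge>N. cmod (char (M (r k)) (- (2 * pi * t))) \<le> 2 * (K + 1) * (1 + \<bar>t\<bar>) powr (- \<alpha> / 2 + \<epsilon>)"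
        using M_bound seq_suble[OF r] by (meson order_trans)
    qed
    thus ?thesis by blast
  qed
  moreover have "AE x in \<nu>. \<forall>n. x \<in> kaufman_level \<alpha> (Q n)" using ae by (simp add: AE_all_countable)
  ultimately show ?thesis using \<nu> Q by blast
qed

section \<open>Decay of solutions of the radial Helmholtz equation\<close>

text \<open>
Differentiation under the integral sign: the difference quotients are dominated by the constant \<open>B\<close>.
\<close>

lemma has_real_derivative_integral:
  fixes G G' :: "real \<Rightarrow> 'a \<Rightarrow> real"
  assumes int: "\<And>s. integrable M (G s)" and meas: "\<And>s. G' s \<in> borel_measurable M" and fin: "finite_measure M"
    and deriv: "AE x in M. \<forall>s. ((\<lambda>s. G s x) has_real_derivative G' s x) (at s)"
    and bound: "AE x in M. \<forall>s. \<bar>G' s x\<bar> \<le> B"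
  shows "((\<lambda>s. \<integral>x. G s x \<partial>M) has_real_derivative (\<integral>x. G' s x \<partial>M)) (at s)"
proof -
  interpret finite_measure M by (rule fin)
  have "((\<lambda>h. ((\<integral>x. G (s + h) x \<partial>M) - (\<integral>x. G s x \<partial>M)) / h) \<longlongrightarrow> (\<integral>x. G' s x \<partial>M)) (at 0)"
    unfolding tendsto_at_iff_sequentially
  proof (intro allI impI)
    fix X :: "nat \<Rightarrow> real" assume X: "\<forall>i. X i \<in> UNIV - {0}" "X \<longlonglongrightarrow> 0"
    have eq: "((\<lambda>h. ((\<integral>x. G (s + h) x \<partial>M) - (\<integral>x. G s x \<partial>M)) / h) \<circ> X)
       = (\<lambda>n. \<integral>x. (G (s + X n) x - G s x) / X n \<partial>M)"
      using int by (auto simp: fun_eq_iff)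
    show "((\<lambda>h. ((\<integral>x. G (s + h) x \<partial>M) - (\<integral>x. G s x \<partial>M)) / h) \<circ> X) \<longlonglongrightarrow> (\<integral>x. G' s x \<partial>M)"
      unfolding eq
    proof (rule integral_dominated_convergence[where w = "\<lambda>_. B"])
      show "(\<lambda>x. (G (s + X n) x - G s x) / X n) \<in> borel_measurable M" for n
        using borel_measurable_integrable[OF int] by (intro borel_measurable_divide borel_measurable_diff) auto
      show "AE x in M. (\<lambda>n. (G (s + X n) x - G s x) / X n) \<longlonglongrightarrow> G' s x"
        using deriv
      proof eventually_elim
        case (elim x)
        hence "((\<lambda>h. (G (s + h) x - G s x) / h) \<longlongrightarrow> G' s x) (at 0)"
          by (simp add: DERIV_def)
        thus ?case using X unfolding tendsto_at_iff_sequentially by (auto simp: o_def)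
      qed
      show "AE x in M. norm ((G (s + X n) x - G s x) / X n) \<le> B" for n
        using deriv bound
      proof eventually_elim
        case (elim x)
        have "norm (G (s + X n) x - G s x) \<le> B * norm (s + X n - s)"
          by (rule field_differentiable_bound[where S = UNIV and f' = "\<lambda>s. G' s x"])
            (use elim in auto)
        thus ?case using X by (simp add: divide_le_eq)
      qed
    qed (use meas in auto)
  qed
  thus ?thesis by (simp add: DERIV_def)
qed

text \<open>
The equation is \<open>f'' + \<kappa> / r * f' + f = 0\<close>, with \<open>\<kappa>\<close> one less than the dimension. The energy
\<open>r powr \<kappa> * (f\<^sup>2 + f'\<^sup>2)\<close> oscillates; the mixed term in \<open>E\<close> is chosen to cancel the
oscillation to leading order, so that \<open>E' = - \<kappa> * r powr (\<kappa> - 2) * f * f'\<close>. For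
\<open>r \<ge> 2 * \<kappa>\<close> the mixed term is dominated by the squares, and therefore \<open>E' \<le> \<kappa> / r\<^sup>2 * E\<close>; the factor
\<open>exp (\<kappa> / r)\<close> is the corresponding integrating factor.
\<close>

lemma helmholtz_radial_energy_antimono:
  fixes f f1 f2 :: "real \<Rightarrow> real"
  assumes k: "\<kappa> \<ge> 1"
    and d: "\<And>r. (f has_real_derivative f1 r) (at r)" "\<And>r. (f1 has_real_derivative f2 r) (at r)"
    and ode: "\<And>r. r * (f r + f2 r) + \<kappa> * f1 r = 0"
    and r: "2 * \<kappa> \<le> r"
  defines "E \<equiv> \<lambda>r. r powr \<kappa> * ((f r)\<^sup>2 + (f1 r)\<^sup>2 + \<kappa> / r * (f r * f1 r))"
  shows "E r * exp (\<kappa> / r) \<le> E (2 * \<kappa>) * exp (\<kappa> / (2 * \<kappa>))"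
    and "r powr \<kappa> * ((f r)\<^sup>2 + (f1 r)\<^sup>2) \<le> 4 / 3 * E r"
proof -
  have key: "3 / 4 * (r powr \<kappa> * ((f r)\<^sup>2 + (f1 r)\<^sup>2)) \<le> E r" and
    key2: "\<bar>\<kappa> * r powr (\<kappa> - 2) * (f r * f1 r)\<bar> \<le> \<kappa> / r\<^sup>2 * E r" if "2 * \<kappa> \<le> r" for r
  proof -
    have r0: "r > 0" using k that by simp
    define q where "q = (f r)\<^sup>2 + (f1 r)\<^sup>2"
    have ff: "\<bar>f r * f1 r\<bar> \<le> q / 2"
      using sum_squares_bound[of "\<bar>f r\<bar>" "\<bar>f1 r\<bar>"] by (simp add: q_def abs_mult)
    have q0: "q \<ge> 0" by (simp add: q_def)
    have "\<kappa> / r \<le> 1 / 2" "\<kappa> / r \<ge> 0" using that r0 k by (auto simp: field_simps)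
    hence "\<bar>\<kappa> / r * (f r * f1 r)\<bar> \<le> 1 / 2 * (q / 2)"
      unfolding abs_mult using ff by (intro mult_mono) (auto simp: abs_mult)
    hence le: "3 / 4 * q \<le> q + \<kappa> / r * (f r * f1 r)" by linarith
    show k1: "3 / 4 * (r powr \<kappa> * ((f r)\<^sup>2 + (f1 r)\<^sup>2)) \<le> E r"
      using mult_left_mono[OF le, of "r powr \<kappa>"] by (simp add: E_def q_def mult_ac)
    have "\<bar>\<kappa> * r powr (\<kappa> - 2) * (f r * f1 r)\<bar> = \<kappa> * r powr (\<kappa> - 2) * \<bar>f r * f1 r\<bar>"
      using k by (simp add: abs_mult)
    also have "\<dots> \<le> \<kappa> * r powr (\<kappa> - 2) * (q / 2)" using k ff by (intro mult_left_mono) auto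
    also have "\<dots> \<le> \<kappa> / r\<^sup>2 * (3 / 4 * (r powr \<kappa> * q))"
      using r0 q0 k by (simp add: powr_diff field_simps)
    also have "\<dots> \<le> \<kappa> / r\<^sup>2 * E r" using k1 k by (intro mult_left_mono) (auto simp: q_def)
    finally show "\<bar>\<kappa> * r powr (\<kappa> - 2) * (f r * f1 r)\<bar> \<le> \<kappa> / r\<^sup>2 * E r" .
  qed
  show "r powr \<kappa> * ((f r)\<^sup>2 + (f1 r)\<^sup>2) \<le> 4 / 3 * E r" using key[OF r] by simp
  show "E r * exp (\<kappa> / r) \<le> E (2 * \<kappa>) * exp (\<kappa> / (2 * \<kappa>))"
  proof (rule DERIV_nonpos_imp_nonincreasing[OF r])
    fix x assume x: "2 * \<kappa> \<le> x" "x \<le> r"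
    have x0: "x > 0" using x k by simp
    have f2: "f2 x = - f x - \<kappa> / x * f1 x" using ode[of x] x0 by (simp add: field_simps)
    define E' where "E' = \<kappa> * x powr (\<kappa> - 1) * ((f x)\<^sup>2 + (f1 x)\<^sup>2 + \<kappa> / x * (f x * f1 x))
      + x powr \<kappa> * (2 * f x * f1 x + 2 * f1 x * f2 x - \<kappa> / x\<^sup>2 * (f x * f1 x) + \<kappa> / x * (f1 x * f1 x + f x * f2 x))"
    have dE: "(E has_real_derivative E') (at x)"
    proof -
      have 1: "((\<lambda>r. r powr \<kappa>) has_real_derivative \<kappa> * x powr (\<kappa> - 1)) (at x)"
        using x0 by (rule has_real_derivative_powr)
      have 2: "((\<lambda>r. \<kappa> / r) has_real_derivative - (\<kappa> / x\<^sup>2)) (at x)"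
        using x0 by (auto intro!: derivative_eq_intros simp: power2_eq_square)
      have 3: "((\<lambda>r. (f r)\<^sup>2 + (f1 r)\<^sup>2) has_real_derivative 2 * f x * f1 x + 2 * f1 x * f2 x) (at x)"
        by (auto intro!: derivative_eq_intros d)
      have 4: "((\<lambda>r. f r * f1 r) has_real_derivative f1 x * f1 x + f2 x * f x) (at x)"
        by (rule DERIV_mult[OF d])
      show ?thesis unfolding E_def
        by (rule DERIV_cong[OF DERIV_mult[OF 1 DERIV_add[OF 3 DERIV_mult[OF 2 4]]]])
          (simp add: E'_def algebra_simps)
    qed
    have "E' = x powr \<kappa> / x\<^sup>2 * (\<kappa> * x * ((f x)\<^sup>2 + (f1 x)\<^sup>2 + \<kappa> / x * (f x * f1 x))
      + x\<^sup>2 * (2 * f x * f1 x + 2 * f1 x * f2 x - \<kappa> / x\<^sup>2 * (f x * f1 x) + \<kappa> / x * (f1 x * f1 x + f x * f2 x)))"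
    proof -
      have p: "x powr (\<kappa> - 1) = x powr \<kappa> / x" using x0 by (simp add: powr_diff)
      have "A * (P / x) * S + P * T = P / x\<^sup>2 * (A * x * S + x\<^sup>2 * T)" for A P S T :: real
        using x0 by (simp add: power2_eq_square field_simps)
      thus ?thesis unfolding E'_def p .
    qed
    also have "\<dots> = x powr \<kappa> / x\<^sup>2 * (- \<kappa> * (f x * f1 x))"
      unfolding f2 using x0 by (simp add: power2_eq_square field_simps)
    also have "\<dots> = - (\<kappa> * x powr (\<kappa> - 2) * (f x * f1 x))" using x0 by (simp add: powr_diff)
    finally have E': "E' \<le> \<kappa> / x\<^sup>2 * E x" using key2[OF x(1)] by linarith
    have "((\<lambda>x. E x * exp (\<kappa> / x)) has_real_derivative E' * exp (\<kappa> / x) + E x * (exp (\<kappa> / x) * (- (\<kappa> / x\<^sup>2)))) (at x)"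
      using x0 by (auto intro!: derivative_eq_intros dE simp: power2_eq_square)
    moreover have "E' * exp (\<kappa> / x) + E x * (exp (\<kappa> / x) * (- (\<kappa> / x\<^sup>2))) = (E' - \<kappa> / x\<^sup>2 * E x) * exp (\<kappa> / x)"
      by (simp add: algebra_simps)
    moreover have "(E' - \<kappa> / x\<^sup>2 * E x) * exp (\<kappa> / x) \<le> 0" using E' by (intro mult_nonpos_nonneg) auto
    ultimately show "\<exists>l. ((\<lambda>r. E r * exp (\<kappa> / r)) has_real_derivative l) (at x) \<and> l \<le> 0" by auto
  qed
qed

text \<open>
As the energy stays bounded, \<open>f\<^sup>2\<close> decays like \<open>r powr (- \<kappa>)\<close>. The constant depends on \<open>\<kappa>\<close> only,
because on \<open>{0..2 * \<kappa>}\<close> the solution is controlled by the assumed bounds.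
\<close>

lemma helmholtz_radial_decay:
  fixes \<kappa> :: real
  assumes k: "\<kappa> \<ge> 1"
  shows "\<exists>C>0. \<forall>f f1 f2. (\<forall>r. (f has_real_derivative f1 r) (at r)) \<longrightarrow> (\<forall>r. (f1 has_real_derivative f2 r) (at r))
    \<longrightarrow> (\<forall>r. r * (f r + f2 r) + \<kappa> * f1 r = 0) \<longrightarrow> (\<forall>r. \<bar>f r\<bar> \<le> 1) \<longrightarrow> (\<forall>r. \<bar>f1 r\<bar> \<le> 1)
    \<longrightarrow> (\<forall>r\<ge>0. \<bar>f r\<bar> \<le> C * (1 + r) powr (- \<kappa> / 2))"
proof -
  \<comment> \<open>\<open>8 = 4 / 3 * 3 * 2\<close>, from the comparison of the energies, from \<open>\<bar>f\<bar>, \<bar>f1\<bar> \<le> 1\<close>, and from \<open>exp (1 / 2) \<le> 2\<close>.\<close>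
  define A where "A = 8 * (2 * \<kappa>) powr \<kappa>"
  have A0: "A > 0" using k by (simp add: A_def)
  define C where "C = (1 + 2 * \<kappa>) powr (\<kappa> / 2) + sqrt A * 2 powr (\<kappa> / 2)"
  have C0: "C > 0" using k A0 by (simp add: C_def add_pos_pos)
  have "\<bar>f r\<bar> \<le> C * (1 + r) powr (- \<kappa> / 2)"
    if d: "\<And>r. (f has_real_derivative f1 r) (at r)" "\<And>r. (f1 has_real_derivative f2 r) (at r)"
    and ode: "\<And>r. r * (f r + f2 r) + \<kappa> * f1 r = 0" and b: "\<And>r. \<bar>f r\<bar> \<le> 1" "\<And>r. \<bar>f1 r\<bar> \<le> 1" and r: "r \<ge> 0"
    for f f1 f2 r
  proof (cases "r < 2 * \<kappa>")
    case True
    have "1 = (1 + r) powr (\<kappa> / 2) * (1 + r) powr (- \<kappa> / 2)" using r by (simp flip: powr_add)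
    also have "\<dots> \<le> (1 + 2 * \<kappa>) powr (\<kappa> / 2) * (1 + r) powr (- \<kappa> / 2)"
      using True r k by (intro mult_right_mono powr_mono2) auto
    also have "\<dots> \<le> C * (1 + r) powr (- \<kappa> / 2)" using A0 by (intro mult_right_mono) (auto simp: C_def)
    finally show ?thesis using b(1)[of r] by linarith
  next
    case False
    hence r2: "2 * \<kappa> \<le> r" by simp
    have r0: "r > 0" using r2 k by simp
    define E where "E r = r powr \<kappa> * ((f r)\<^sup>2 + (f1 r)\<^sup>2 + \<kappa> / r * (f r * f1 r))" for r
    note en = helmholtz_radial_energy_antimono[OF k d ode r2, folded E_def]
    have ff: "(f (2 * \<kappa>))\<^sup>2 \<le> 1" "(f1 (2 * \<kappa>))\<^sup>2 \<le> 1" "\<bar>f (2 * \<kappa>) * f1 (2 * \<kappa>)\<bar> \<le> 1"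
      using b by (auto simp: abs_square_le_1 abs_mult intro: mult_le_one)
    have "(f (2 * \<kappa>))\<^sup>2 + (f1 (2 * \<kappa>))\<^sup>2 + \<kappa> / (2 * \<kappa>) * (f (2 * \<kappa>) * f1 (2 * \<kappa>)) \<le> 3"
      using ff k by simp
    hence E0: "E (2 * \<kappa>) \<le> (2 * \<kappa>) powr \<kappa> * 3" unfolding E_def by (intro mult_left_mono) auto
    have "exp (1/2::real) \<le> 2"
    proof -
      have "exp (1/2::real) ^ 2 = exp 1" by (simp flip: exp_of_nat_mult)
      also have "\<dots> \<le> 2 ^ 2" using e_less_272 by simp
      finally show ?thesis by (rule power2_le_imp_le) simp
    qed
    hence "E (2 * \<kappa>) * exp (\<kappa> / (2 * \<kappa>)) \<le> (2 * \<kappa>) powr \<kappa> * 3 * 2"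
      using k E0 by (intro mult_mono) auto
    hence Er: "E r * exp (\<kappa> / r) \<le> 6 * (2 * \<kappa>) powr \<kappa>" using en(1) by linarith
    have "0 \<le> r powr \<kappa> * ((f r)\<^sup>2 + (f1 r)\<^sup>2)" by simp
    hence E_nonneg: "E r \<ge> 0" using en(2) by linarith
    have "E r * 1 \<le> E r * exp (\<kappa> / r)" using E_nonneg r0 k by (intro mult_left_mono) auto
    hence "r powr \<kappa> * ((f r)\<^sup>2 + (f1 r)\<^sup>2) \<le> A" using Er en(2) by (simp add: A_def)
    moreover have "r powr \<kappa> * (f r)\<^sup>2 \<le> r powr \<kappa> * ((f r)\<^sup>2 + (f1 r)\<^sup>2)" by (intro mult_left_mono) auto
    ultimately have "r powr \<kappa> * (f r)\<^sup>2 \<le> A" by linarith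
    hence "(f r)\<^sup>2 \<le> A * r powr (- \<kappa>)" using r0 by (simp add: powr_minus field_simps)
    hence "sqrt ((f r)\<^sup>2) \<le> sqrt (A * r powr (- \<kappa>))" by (rule real_sqrt_le_mono)
    hence "\<bar>f r\<bar> \<le> sqrt A * r powr (- \<kappa> / 2)" using r0
      by (simp add: real_sqrt_mult powr_half_sqrt[symmetric] powr_powr)
    also have "r powr (- \<kappa> / 2) \<le> 2 powr (\<kappa> / 2) * (1 + r) powr (- \<kappa> / 2)"
    proof -
      have "(2 * r) powr (- \<kappa> / 2) \<le> (1 + r) powr (- \<kappa> / 2)" using r2 k by (intro powr_mono2') auto
      hence "2 powr (\<kappa> / 2) * (2 powr (- \<kappa> / 2) * r powr (- \<kappa> / 2)) \<le> 2 powr (\<kappa> / 2) * (1 + r) powr (- \<kappa> / 2)"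
        by (intro mult_left_mono) (auto simp: powr_mult)
      moreover have "2 powr (\<kappa> / 2) * 2 powr (- \<kappa> / 2) = (1::real)" by (simp flip: powr_add)
      ultimately show ?thesis by (simp only: mult.assoc[symmetric] mult_1)
    qed
    also have "sqrt A * (2 powr (\<kappa> / 2) * (1 + r) powr (- \<kappa> / 2)) \<le> C * (1 + r) powr (- \<kappa> / 2)"
      unfolding mult.assoc[symmetric] by (intro mult_right_mono) (auto simp: C_def)
    finally show ?thesis using A0 by (simp add: mult_left_mono)
  qed
  thus ?thesis using C0 by blast
qed

section \<open>Rotation-invariant measures on spheres of coordinate subspaces\<close>

lemma orthogonal_transformation_continuous:
  fixes f :: "'a::euclidean_space \<Rightarrow> 'a"
  assumes "orthogonal_transformation f" shows "continuous_on S f"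
  by (rule linear_continuous_on[OF linear_conv_bounded_linear[THEN iffD1, OF orthogonal_transformation_linear[OF assms]]])

text \<open>
An isometry maps balls to balls of the same radius, hence of the same measure, and by Vitali's
covering theorem an open set is a disjoint union of balls up to a null set. Applied to the
transformation and to its inverse, the inequality gives invariance of the Lebesgue measure.
\<close>

lemma lborel_le_orthogonal_vimage:
  fixes f :: "'a::euclidean_space \<Rightarrow> 'a"
  assumes f: "orthogonal_transformation f" and S: "open S"
  shows "emeasure lborel S \<le> emeasure lborel (f -` S)"
proof -
  define K where "K = {p::'a \<times> real. snd p > 0 \<and> cball (fst p) (snd p) \<subseteq> S}"
  define B where "B p = cball (fst p) (snd p)" for p :: "'a \<times> real"
  have fine: "\<exists>p. p \<in> K \<and> x \<in> cball (fst p) (snd p) \<and> snd p < d" if xS: "x \<in> S" and d: "0 < d" for x d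
  proof -
    obtain e where e: "e > 0" "cball x e \<subseteq> S" using S xS unfolding open_contains_cball by blast
    have "cball x (min e (d / 2)) \<subseteq> cball x e" by auto
    hence "(x, min e (d / 2)) \<in> K" using e d by (auto simp: K_def)
    thus ?thesis using e d by (intro exI[of _ "(x, min e (d / 2))"]) auto
  qed
  obtain C where C: "countable C" "C \<subseteq> K"
     "pairwise (\<lambda>i j. disjnt (cball (fst i) (snd i)) (cball (fst j) (snd j))) C"
     "negligible (S - (\<Union>i \<in> C. cball (fst i) (snd i)))"
    by (rule Vitali_covering_theorem_cballs[of K snd S fst, OF _ fine]) (auto simp: K_def)
  have disj: "disjoint_family_on B C"
    using C(3) by (auto simp: disjoint_family_on_def pairwise_def disjnt_def B_def)
  have Bset: "B p \<in> sets lborel" for p by (simp add: B_def)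
  have surj: "surj f" by (rule orthogonal_transformation_surj[OF f])
  have inv: "f -` B p = cball (inv f (fst p)) (snd p)" for p
  proof -
    have "fst p = f (inv f (fst p))" using surj by (simp add: surj_f_inv_f)
    moreover have "dist (f x) (f y) = dist x y" for x y
      using linear_diff[OF orthogonal_transformation_linear[OF f], of x y, symmetric]
      by (simp add: dist_norm orthogonal_transformation_norm[OF f])
    ultimately have "dist (fst p) (f x) = dist (inv f (fst p)) x" for x by metis
    thus ?thesis by (auto simp: B_def)
  qed
  have "emeasure lborel (S - (\<Union>p\<in>C. B p)) = 0"
  proof -
    have "S - (\<Union>p\<in>C. B p) \<in> null_sets lebesgue" using C(4) by (simp add: B_def negligible_iff_null_sets)
    moreover have "S - (\<Union>p\<in>C. B p) \<in> sets lborel"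
      using S C(1) Bset by (intro sets.Diff sets.countable_UN') auto
    ultimately show ?thesis by (simp add: null_sets_def)
  qed
  moreover have "emeasure lborel S \<le> emeasure lborel (\<Union>p\<in>C. B p) + emeasure lborel (S - (\<Union>p\<in>C. B p))"
    by (rule order_trans[OF emeasure_mono emeasure_subadditive])
      (use S C(1) Bset in \<open>auto intro!: sets.Diff sets.countable_UN'\<close>)
  ultimately have "emeasure lborel S \<le> emeasure lborel (\<Union>p\<in>C. B p)" by simp
  also have "\<dots> = (\<integral>\<^sup>+p. emeasure lborel (B p) \<partial>count_space C)"
    by (rule emeasure_UN_countable[OF Bset C(1) disj])
  also have "\<dots> = (\<integral>\<^sup>+p. emeasure lborel (f -` B p) \<partial>count_space C)"
    using C(2) unfolding inv by (intro nn_integral_cong) (auto simp: B_def K_def emeasure_cball)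
  also have "\<dots> = emeasure lborel (\<Union>p\<in>C. f -` B p)"
  proof (rule emeasure_UN_countable[symmetric, OF _ C(1)])
    show "f -` B p \<in> sets lborel" for p by (simp add: inv)
    show "disjoint_family_on (\<lambda>p. f -` B p) C" using disj unfolding disjoint_family_on_def by blast
  qed
  also have "\<dots> \<le> emeasure lborel (f -` S)"
  proof (rule emeasure_mono)
    show "(\<Union>p\<in>C. f -` B p) \<subseteq> f -` S" using C(2) by (auto simp: K_def B_def)
    have "open (f -` S)" using S f
      by (intro open_vimage orthogonal_transformation_continuous)
    thus "f -` S \<in> sets lborel" by simp
  qed
  finally show ?thesis .
qed

lemma distr_lborel_orthogonal:
  fixes f :: "'a::euclidean_space \<Rightarrow> 'a"
  assumes f: "orthogonal_transformation f"
  shows "distr lborel borel f = lborel"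
proof (rule lborel_eqI[symmetric])
  have f_meas: "f \<in> borel_measurable borel"
    by (rule borel_measurable_continuous_onI[OF orthogonal_transformation_continuous[OF f]])
  fix l u :: 'a assume lu: "\<And>b. b \<in> Basis \<Longrightarrow> l \<bullet> b \<le> u \<bullet> b"
  have "emeasure lborel (f -` box l u) \<le> emeasure lborel (inv f -` (f -` box l u))"
    by (rule lborel_le_orthogonal_vimage[OF orthogonal_transformation_inv[OF f]])
      (intro open_vimage open_box orthogonal_transformation_continuous[OF f])
  also have "inv f -` (f -` box l u) = box l u"
    using orthogonal_transformation_surj[OF f] by (auto simp: surj_f_inv_f)
  finally have "emeasure lborel (f -` box l u) = emeasure lborel (box l u)"
    using lborel_le_orthogonal_vimage[OF f open_box, of l u] by (rule order_antisym)
  thus "emeasure (distr lborel borel f) (box l u) = (\<Prod>b\<in>Basis. (u - l) \<bullet> b)"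
    using f_meas lu by (simp add: emeasure_distr)
qed simp

definition coord_proj :: "'n set \<Rightarrow> real ^ 'n \<Rightarrow> real ^ 'n" where
  "coord_proj I x = (\<chi> i. if i \<in> I then x $ i else 0)"

lemma coord_proj_nth [simp]: "coord_proj I x $ i = (if i \<in> I then x $ i else 0)"
  by (simp add: coord_proj_def)

lemma linear_coord_proj: "linear (coord_proj I :: real ^ 'n::finite \<Rightarrow> _)"
  by (intro linearI) (auto simp: vec_eq_iff)

lemma continuous_coord_proj: "continuous_on S (coord_proj I :: real ^ 'n::finite \<Rightarrow> _)"
  by (rule linear_continuous_on[OF linear_conv_bounded_linear[THEN iffD1, OF linear_coord_proj]])

lemma coord_proj_idem [simp]: "coord_proj I (coord_proj I x) = coord_proj I x"
  by (simp add: vec_eq_iff)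

lemma inner_coord_proj: "coord_proj I x \<bullet> y = x \<bullet> coord_proj I (y :: real ^ 'n::finite)"
  by (auto simp: inner_vec_def intro!: sum.cong)

lemma inner_coord_proj_sum: "x \<bullet> coord_proj I y = (\<Sum>i\<in>I. x $ i * (y :: real ^ 'n::finite) $ i)"
proof -
  have "x \<bullet> coord_proj I y = (\<Sum>i\<in>UNIV. if i \<in> I then x $ i * y $ i else 0)"
    unfolding inner_vec_def by (rule sum.cong) auto
  thus ?thesis by (simp add: sum.If_cases)
qed

text \<open>
Rotation by the angle \<open>s\<close> in the plane of the coordinates \<open>i\<close> and \<open>j\<close>, written as a perturbation of the
identity along the two axes.
\<close>

definition plane_rotation :: "'n::finite \<Rightarrow> 'n \<Rightarrow> real \<Rightarrow> real ^ 'n \<Rightarrow> real ^ 'n" where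
  "plane_rotation i j s x = x + ((cos s - 1) * x $ i - sin s * x $ j) *\<^sub>R axis i 1
     + (sin s * x $ i + (cos s - 1) * x $ j) *\<^sub>R axis j 1"

lemma inner_self_add_orthonormal_pair: fixes x a b :: "'a::real_inner"
  assumes "a \<bullet> a = 1" "b \<bullet> b = 1" "a \<bullet> b = 0"
  shows "(x + p *\<^sub>R a + q *\<^sub>R b) \<bullet> (x + p *\<^sub>R a + q *\<^sub>R b) = x \<bullet> x + (p\<^sup>2 + q\<^sup>2 + 2 * p * (x \<bullet> a) + 2 * q * (x \<bullet> b))"
proof -
  have c: "a \<bullet> x = x \<bullet> a" "b \<bullet> x = x \<bullet> b" "b \<bullet> a = 0" using assms(3) by (auto simp: inner_commute)
  have "(x + p *\<^sub>R a + q *\<^sub>R b) \<bullet> (x + p *\<^sub>R a + q *\<^sub>R b) = x \<bullet> x + p * (x \<bullet> a) + q * (x \<bullet> b)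
     + (p * (a \<bullet> x) + p * (p * (a \<bullet> a)) + p * (q * (a \<bullet> b))) + (q * (b \<bullet> x) + q * (p * (b \<bullet> a)) + q * (q * (b \<bullet> b)))"
    unfolding inner_add_left inner_add_right inner_scaleR_left inner_scaleR_right distrib_left
    by (simp only: add_ac mult_ac)
  also have "\<dots> = x \<bullet> x + (p\<^sup>2 + q\<^sup>2 + 2 * p * (x \<bullet> a) + 2 * q * (x \<bullet> b))"
    unfolding c assms power2_eq_square by algebra
  finally show ?thesis .
qed
lemma plane_rotation_orthogonal:
  fixes i j :: "'n::finite"
  assumes "i \<noteq> j" shows "orthogonal_transformation (plane_rotation i j s)"
  unfolding orthogonal_transformation
proof (intro conjI allI)
  show "linear (plane_rotation i j s)"
    unfolding plane_rotation_def
    by (intro linearI) (simp_all add: algebra_simps scaleR_add_left scaleR_diff_left)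
  fix x :: "real ^ 'n"
  define p q where "p = (cos s - 1) * x $ i - sin s * x $ j" and "q = sin s * x $ i + (cos s - 1) * x $ j"
  have "plane_rotation i j s x \<bullet> plane_rotation i j s x = x \<bullet> x + (p\<^sup>2 + q\<^sup>2 + 2 * p * (x \<bullet> axis i 1) + 2 * q * (x \<bullet> axis j 1))"
  proof -
    have "axis i 1 \<bullet> axis i (1::real) = 1" "axis j 1 \<bullet> axis j (1::real) = 1" "axis i 1 \<bullet> axis j (1::real) = 0"
      by (simp_all add: inner_axis_axis assms)
    from inner_self_add_orthonormal_pair[OF this, of x p q]
    show ?thesis by (simp only: plane_rotation_def p_def q_def)
  qed
  also have "\<dots> = x \<bullet> x + (p\<^sup>2 + q\<^sup>2 + 2 * p * x $ i + 2 * q * x $ j)"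
    by (simp only: inner_axis inner_real_def mult_1_right)
  also have "p\<^sup>2 + q\<^sup>2 + 2 * p * x $ i + 2 * q * x $ j = 0"
    unfolding p_def q_def using sin_cos_squared_add[of s] by algebra
  finally show "norm (plane_rotation i j s x) = norm x" by (simp add: norm_eq_sqrt_inner)
qed

lemma coord_proj_plane_rotation:
  assumes "i \<in> I" "j \<in> I"
  shows "coord_proj I (plane_rotation i j s x) = plane_rotation i j s (coord_proj I x)"
  using assms by (auto simp: plane_rotation_def vec_eq_iff axis_def)

definition coord_normalize :: "'n::finite set \<Rightarrow> real ^ 'n \<Rightarrow> real ^ 'n" where
  "coord_normalize I x = coord_proj I x /\<^sub>R norm (coord_proj I x)"

text \<open>
For nonempty \<open>I\<close>, a bounded set of positive measure that is invariant under the rotations of the block \<open>I\<close> and on which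
\<open>coord_normalize I\<close> does not divide by 0.
\<close>

definition shell :: "'n::finite set \<Rightarrow> (real ^ 'n) set" where
  "shell I = {x. norm x < 1 \<and> 1 / 2 < norm (coord_proj I x)}"

definition sphere_measure :: "'n::finite set \<Rightarrow> (real ^ 'n) measure" where
  "sphere_measure I = distr (uniform_measure lborel (shell I)) borel (coord_normalize I)"

lemma open_shell: "open (shell I)"
proof -
  have "shell I = {x. norm x < 1} \<inter> {x. 1 / 2 < norm (coord_proj I x)}" by (auto simp: shell_def)
  thus ?thesis
    by (auto intro!: open_Int open_Collect_less continuous_intros continuous_coord_proj)
qed

lemma emeasure_shell:
  fixes I :: "'n::finite set"
  assumes "I \<noteq> {}"
  shows "emeasure lborel (shell I) \<noteq> 0" "emeasure lborel (shell I) \<noteq> \<infinity>"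
proof -
  obtain i where i: "i \<in> I" using assms by blast
  have "coord_proj I ((3/4) *\<^sub>R axis i 1) = (3/4) *\<^sub>R axis i (1::real)" using i by (auto simp: vec_eq_iff axis_def)
  hence "(3/4) *\<^sub>R axis i 1 \<in> shell I" by (simp add: shell_def norm_axis_1)
  hence "\<not> negligible (shell I)" using open_shell open_not_negligible by blast
  thus "emeasure lborel (shell I) \<noteq> 0"
    using open_shell[of I] by (auto simp: negligible_iff_null_sets null_sets_def)
  have "shell I \<subseteq> ball 0 1" by (auto simp: shell_def)
  hence "emeasure lborel (shell I) \<le> emeasure lborel (ball 0 1 :: (real ^ 'n) set)" by (intro emeasure_mono) auto
  also have "\<dots> < \<infinity>" by (rule emeasure_lborel_ball_finite)
  finally show "emeasure lborel (shell I) \<noteq> \<infinity>" by simp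
qed

lemma coord_normalize_measurable: "coord_normalize I \<in> borel_measurable borel"
  unfolding coord_normalize_def
  using borel_measurable_continuous_onI[OF continuous_coord_proj[of UNIV I]]
  by measurable

lemma measurable_uniform_borel: "measurable (uniform_measure lborel A) N = measurable borel N"
  by (rule measurable_cong_sets) auto

lemma prob_space_sphere_measure:
  assumes "I \<noteq> {}" shows "prob_space (sphere_measure I)"
  unfolding sphere_measure_def
  by (rule prob_space.prob_space_distr[OF prob_space_uniform_measure[OF emeasure_shell[OF assms]]])
    (simp add: measurable_uniform_borel coord_normalize_measurable)

lemma sets_sphere_measure [simp, measurable_cong]: "sets (sphere_measure I) = sets borel"
  by (simp add: sphere_measure_def)

lemma AE_sphere_measure:
  fixes I :: "'n::finite set"
  shows "AE x in sphere_measure I. norm x = 1 \<and> coord_proj I x = x"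
proof -
  have "closed {x :: real ^ 'n. norm x = 1}"
    by (rule closed_Collect_eq) (intro continuous_intros)+
  moreover have "closed {x :: real ^ 'n. coord_proj I x = x}"
    by (rule closed_Collect_eq[OF continuous_coord_proj continuous_on_id])
  ultimately have "{x :: real ^ 'n. norm x = 1} \<inter> {x. coord_proj I x = x} \<in> sets borel"
    by (intro borel_closed closed_Int)
  hence meas: "{x \<in> space borel. norm x = 1 \<and> coord_proj I x = x} \<in> sets (borel :: (real ^ 'n) measure)"
    by (simp add: Collect_conj_eq)
  have "norm (coord_normalize I x) = 1 \<and> coord_proj I (coord_normalize I x) = coord_normalize I x" if "x \<in> shell I" for x
  proof
    have "norm (coord_proj I x) > 1 / 2" using that by (simp add: shell_def)
    hence "norm (coord_proj I x) \<noteq> 0" by linarith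
    thus "norm (coord_normalize I x) = 1" by (simp add: coord_normalize_def)
    show "coord_proj I (coord_normalize I x) = coord_normalize I x"
      unfolding coord_normalize_def by (simp only: linear_cmul[OF linear_coord_proj] coord_proj_idem)
  qed
  hence "AE x in uniform_measure lborel (shell I). norm (coord_normalize I x) = 1 \<and> coord_proj I (coord_normalize I x) = coord_normalize I x"
    using open_shell[of I] by (intro AE_uniform_measureI) simp_all
  thus ?thesis unfolding sphere_measure_def
    by (subst AE_distr_iff[OF _ meas]) (simp_all add: measurable_uniform_borel coord_normalize_measurable)
qed

text \<open>
The Lebesgue measure on the shell is invariant, and normalization commutes with the rotation.
\<close>

lemma sphere_measure_rotation:
  fixes g :: "real ^ 'n::finite \<Rightarrow> real"
  assumes ij: "i \<in> I" "j \<in> I" "i \<noteq> j" and g: "g \<in> borel_measurable borel"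
  shows "(\<integral>x. g (plane_rotation i j s x) \<partial>sphere_measure I) = (\<integral>x. g x \<partial>sphere_measure I)"
proof -
  let ?R = "plane_rotation i j s :: real ^ 'n \<Rightarrow> _" and ?U = "uniform_measure lborel (shell I)"
  have orth: "orthogonal_transformation ?R" by (rule plane_rotation_orthogonal[OF ij(3)])
  have R_meas: "?R \<in> borel_measurable borel"
    by (rule borel_measurable_continuous_onI[OF orthogonal_transformation_continuous[OF orth]])
  have norm_proj: "norm (coord_proj I (?R x)) = norm (coord_proj I x)" for x
    by (simp add: coord_proj_plane_rotation[OF ij(1,2)] orthogonal_transformation_norm[OF orth])
  have comm: "coord_normalize I (?R x) = ?R (coord_normalize I x)" for x
    unfolding coord_normalize_def norm_proj linear_cmul[OF orthogonal_transformation_linear[OF orth]]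
    by (simp only: coord_proj_plane_rotation[OF ij(1,2)])
  have shell: "?R -` shell I = shell I"
    by (auto simp: shell_def norm_proj orthogonal_transformation_norm[OF orth])
  have inv: "distr ?U borel ?R = ?U"
  proof (rule measure_eqI)
    fix A assume "A \<in> sets (distr ?U borel ?R)"
    hence A: "A \<in> sets borel" by simp
    have sh: "shell I \<in> sets borel" using open_shell[of I] by simp
    have "emeasure (distr ?U borel ?R) A = emeasure lborel (shell I \<inter> ?R -` A) / emeasure lborel (shell I)"
      using A R_meas sh measurable_sets[OF R_meas A] by (simp add: emeasure_distr)
    also have "shell I \<inter> ?R -` A = ?R -` (shell I \<inter> A)" using shell by auto
    also have "emeasure lborel (?R -` (shell I \<inter> A)) = emeasure (distr lborel borel ?R) (shell I \<inter> A)"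
      using A sh R_meas by (simp add: emeasure_distr)
    also have "\<dots> = emeasure lborel (shell I \<inter> A)" by (simp add: distr_lborel_orthogonal[OF orth])
    finally show "emeasure (distr ?U borel ?R) A = emeasure ?U A" using A sh by simp
  qed simp
  have "(\<integral>x. g (?R x) \<partial>sphere_measure I) = (\<integral>x. g (?R (coord_normalize I x)) \<partial>?U)"
    unfolding sphere_measure_def using g R_meas coord_normalize_measurable
    by (subst integral_distr) (simp_all add: measurable_uniform_borel measurable_compose)
  also have "\<dots> = (\<integral>x. g (coord_normalize I (?R x)) \<partial>?U)" by (simp add: comm)
  also have "\<dots> = (\<integral>x. g (coord_normalize I x) \<partial>distr ?U borel ?R)"
    using g R_meas measurable_compose[OF coord_normalize_measurable g]
    by (subst integral_distr) (simp_all add: measurable_uniform_borel)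
  also have "\<dots> = (\<integral>x. g x \<partial>sphere_measure I)"
    unfolding inv sphere_measure_def using g coord_normalize_measurable by (subst integral_distr) (simp_all add: measurable_uniform_borel)
  finally show ?thesis .
qed

section \<open>Fourier decay of the sphere\<close>

lemma integrable_sphere_measure:
  fixes g :: "real ^ 'n::finite \<Rightarrow> real"
  assumes I: "I \<noteq> {}" and g: "g \<in> borel_measurable borel" and B: "\<And>x. norm x = 1 \<Longrightarrow> \<bar>g x\<bar> \<le> B"
  shows "integrable (sphere_measure I) g"
proof -
  interpret prob_space "sphere_measure I" by (rule prob_space_sphere_measure[OF I])
  have gm: "g \<in> borel_measurable (sphere_measure I)"
    using g measurable_cong_sets[OF sets_sphere_measure refl] by blast
  show ?thesis
    by (rule integrable_const_bound[OF _ gm, where B = B]) (use AE_sphere_measure[of I] B in \<open>auto elim: eventually_mono\<close>)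
qed

text \<open>
The integral of \<open>g y = (w $ i * y $ j - w $ j * y $ i) * sin (r * (w \<bullet> y) + c)\<close> over the sphere does not
change when \<open>g\<close> is rotated. The integral in question is the derivative with respect to the angle, at
angle 0.
\<close>

lemma sphere_rotation_identity:
  fixes w :: "real ^ 'n::finite"
  assumes I: "I \<noteq> {}" and ij: "i \<in> I" "j \<in> I" "i \<noteq> j" and w: "norm w \<le> 1"
  shows "(\<integral>x. (w $ i * x $ i + w $ j * x $ j) * sin (r * (w \<bullet> x) + c)
       - r * (w $ j * x $ i - w $ i * x $ j)\<^sup>2 * cos (r * (w \<bullet> x) + c) \<partial>sphere_measure I) = 0"
proof -
  define a where "a x = w $ i * x $ i + w $ j * x $ j" for x :: "real ^ 'n"
  define b where "b x = w $ j * x $ i - w $ i * x $ j" for x :: "real ^ 'n"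
  \<comment> \<open>\<open>u s x\<close> is the inner product of \<open>w\<close> with the rotated point.\<close>
  define u where "u s x = w \<bullet> x + (cos s - 1) * a x + sin s * b x" for s and x :: "real ^ 'n"
  define G where "G s x = (sin s * a x - cos s * b x) * sin (r * u s x + c)" for s x
  define G' where "G' s x = (cos s * a x + sin s * b x) * sin (r * u s x + c)
     + (sin s * a x - cos s * b x) * (r * (- sin s * a x + cos s * b x) * cos (r * u s x + c))" for s x
  define g where "g y = (w $ i * y $ j - w $ j * y $ i) * sin (r * (w \<bullet> y) + c)" for y :: "real ^ 'n"
  have R: "plane_rotation i j s x $ i = cos s * x $ i - sin s * x $ j"
    "plane_rotation i j s x $ j = sin s * x $ i + cos s * x $ j" for s x
    using ij(3) by (auto simp: plane_rotation_def axis_def algebra_simps)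
  have wR: "w \<bullet> plane_rotation i j s x = u s x" for s x
    by (simp add: plane_rotation_def inner_add_right inner_axis u_def a_def b_def algebra_simps)
  have G_eq: "G s x = g (plane_rotation i j s x)" for s x
    unfolding g_def R wR G_def a_def b_def by (simp add: algebra_simps)
  have cont_a: "continuous_on UNIV a" and cont_b: "continuous_on UNIV b"
    unfolding a_def b_def by (intro continuous_intros)+
  have cont_u: "continuous_on UNIV (u s)" for s
    unfolding u_def by (intro continuous_intros cont_a cont_b)
  have G_meas: "G s \<in> borel_measurable borel" "G' s \<in> borel_measurable borel" for s
    unfolding G_def G'_def
    by (intro borel_measurable_continuous_onI continuous_intros cont_a cont_b cont_u)+
  have wi: "\<bar>w $ k\<bar> \<le> 1" for k using component_le_norm_cart[of w k] w by linarith
  have ab: "\<bar>a x\<bar> \<le> 2" "\<bar>b x\<bar> \<le> 2" if "norm x = 1" for x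
  proof -
    have xk: "\<bar>x $ k\<bar> \<le> 1" for k using component_le_norm_cart[of x k] that by linarith
    have "\<bar>w $ k * x $ l\<bar> \<le> 1" for k l unfolding abs_mult using wi xk by (intro mult_le_one) auto
    from this[of i i] this[of j j] this[of j i] this[of i j]
    show "\<bar>a x\<bar> \<le> 2" "\<bar>b x\<bar> \<le> 2" unfolding a_def b_def by linarith+
  qed
  have trig: "\<bar>p * X\<bar> \<le> 2" if "\<bar>p\<bar> \<le> 1" "\<bar>X\<bar> \<le> 2" for p X :: real
    using mult_mono[OF that] by (simp add: abs_mult)
  have sc4: "\<bar>cos s * a x + sin s * b x\<bar> \<le> 4" "\<bar>sin s * a x - cos s * b x\<bar> \<le> 4" "\<bar>- sin s * a x + cos s * b x\<bar> \<le> 4"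
    if "norm x = 1" for s x
    using trig[of "cos s" "a x"] trig[of "sin s" "b x"] trig[of "sin s" "a x"] trig[of "cos s" "b x"] ab[OF that]
    by (simp_all add: abs_le_iff)
  have G_bound: "\<bar>G s x\<bar> \<le> 4" if "norm x = 1" for s x
  proof -
    have "\<bar>G s x\<bar> \<le> 4 * 1" unfolding G_def abs_mult by (intro mult_mono sc4 that) auto
    thus ?thesis by simp
  qed
  have G'_bound: "\<bar>G' s x\<bar> \<le> 4 + 4 * (\<bar>r\<bar> * 4)" if "norm x = 1" for s x
  proof -
    have "\<bar>(cos s * a x + sin s * b x) * sin (r * u s x + c)\<bar> \<le> 4 * 1"
      unfolding abs_mult[of "cos s * a x + sin s * b x"] by (intro mult_mono sc4 that) auto
    moreover have "\<bar>(sin s * a x - cos s * b x) * (r * (- sin s * a x + cos s * b x) * cos (r * u s x + c))\<bar> \<le> 4 * (\<bar>r\<bar> * 4 * 1)"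
      unfolding abs_mult[of "sin s * a x - cos s * b x"] abs_mult[of "r * (- sin s * a x + cos s * b x)"] abs_mult[of r]
      by (intro mult_mono sc4 that) auto
    ultimately show ?thesis unfolding G'_def by linarith
  qed
  interpret prob_space "sphere_measure I" by (rule prob_space_sphere_measure[OF I])
  have "((\<lambda>s. \<integral>x. G s x \<partial>sphere_measure I) has_real_derivative (\<integral>x. G' 0 x \<partial>sphere_measure I)) (at 0)"
  proof (rule has_real_derivative_integral)
    show "integrable (sphere_measure I) (G s)" for s
      by (rule integrable_sphere_measure[OF I G_meas(1) G_bound])
    show "G' s \<in> borel_measurable (sphere_measure I)" for s
      using G_meas(2) measurable_cong_sets[OF sets_sphere_measure refl] by blast
    show "AE x in sphere_measure I. \<forall>s. \<bar>G' s x\<bar> \<le> 4 + 4 * (\<bar>r\<bar> * 4)"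
      using AE_sphere_measure[of I] by eventually_elim (use G'_bound in auto)
    have "((\<lambda>s. G s x) has_real_derivative G' s x) (at s)" for s x
      unfolding G_def G'_def u_def by (auto intro!: derivative_eq_intros simp: algebra_simps)
    thus "AE x in sphere_measure I. \<forall>s. ((\<lambda>s. G s x) has_real_derivative G' s x) (at s)" by simp
  qed (rule finite_measure_axioms)
  moreover have "(\<integral>x. G s x \<partial>sphere_measure I) = (\<integral>x. g x \<partial>sphere_measure I)" for s
    unfolding G_eq
    by (rule sphere_measure_rotation[OF ij])
      (auto simp: g_def intro!: borel_measurable_continuous_onI continuous_intros)
  ultimately have "(\<integral>x. G' 0 x \<partial>sphere_measure I) = 0"
    using DERIV_unique[OF _ DERIV_const] by simp
  moreover have "G' 0 x = (w $ i * x $ i + w $ j * x $ j) * sin (r * (w \<bullet> x) + c)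
       - r * (w $ j * x $ i - w $ i * x $ j)\<^sup>2 * cos (r * (w \<bullet> x) + c)" for x
    by (simp add: G'_def u_def a_def b_def power2_eq_square algebra_simps)
  ultimately show ?thesis by simp
qed

text \<open>
The second identity is Lagrange's identity. These two sums turn the rotation identities for all
coordinate planes into the Helmholtz equation.
\<close>

lemma sum_pairs_rotation:
  fixes w x :: "real ^ 'n::finite"
  assumes w: "coord_proj I w = w" "norm w = 1" and x: "coord_proj I x = x" "norm x = 1"
  shows "(\<Sum>i\<in>I. \<Sum>j\<in>I - {i}. w $ i * x $ i + w $ j * x $ j) = 2 * (real (card I) - 1) * (w \<bullet> x)"
    and "(\<Sum>i\<in>I. \<Sum>j\<in>I - {i}. (w $ j * x $ i - w $ i * x $ j)\<^sup>2) = 2 * (1 - (w \<bullet> x)\<^sup>2)"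
proof -
  have wx: "(\<Sum>i\<in>I. w $ i * x $ i) = w \<bullet> x" and ww: "(\<Sum>i\<in>I. w $ i * w $ i) = 1" and xx: "(\<Sum>i\<in>I. x $ i * x $ i) = 1"
    using inner_coord_proj_sum[of w I x] inner_coord_proj_sum[of w I w] inner_coord_proj_sum[of x I x] w x
    by (simp_all add: power2_norm_eq_inner[symmetric])
  have rem: "(\<Sum>j\<in>I - {i}. h j) = (\<Sum>j\<in>I. h j) - h i" if "i \<in> I" for h :: "'n \<Rightarrow> real" and i
    using that by (simp add: sum_diff1)
  have "(\<Sum>i\<in>I. \<Sum>j\<in>I - {i}. w $ i * x $ i + w $ j * x $ j)
      = (\<Sum>i\<in>I. (\<Sum>j\<in>I. w $ i * x $ i + w $ j * x $ j) - (w $ i * x $ i + w $ i * x $ i))"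
    by (intro sum.cong refl) (simp add: rem)
  also have "\<dots> = (\<Sum>i\<in>I. (real (card I) - 2) * (w $ i * x $ i) + w \<bullet> x)"
    by (rule sum.cong[OF refl]) (simp add: sum.distrib wx algebra_simps)
  also have "\<dots> = (real (card I) - 2) * (w \<bullet> x) + real (card I) * (w \<bullet> x)"
    by (simp only: sum.distrib sum_distrib_left[symmetric] wx sum_constant)
  also have "\<dots> = 2 * (real (card I) - 1) * (w \<bullet> x)" by (simp add: algebra_simps)
  finally show "(\<Sum>i\<in>I. \<Sum>j\<in>I - {i}. w $ i * x $ i + w $ j * x $ j) = 2 * (real (card I) - 1) * (w \<bullet> x)" .
  have "(\<Sum>i\<in>I. \<Sum>j\<in>I - {i}. (w $ j * x $ i - w $ i * x $ j)\<^sup>2)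
      = (\<Sum>i\<in>I. \<Sum>j\<in>I. (w $ j * x $ i - w $ i * x $ j)\<^sup>2)"
    by (rule sum.cong[OF refl]) (simp add: rem)
  also have "\<dots> = (\<Sum>i\<in>I. \<Sum>j\<in>I. (x $ i * x $ i) * (w $ j * w $ j) + (w $ i * w $ i) * (x $ j * x $ j)
       - 2 * ((w $ i * x $ i) * (w $ j * x $ j)))"
    by (intro sum.cong refl) (simp add: power2_eq_square algebra_simps)
  also have "\<dots> = (\<Sum>i\<in>I. x $ i * x $ i) * (\<Sum>j\<in>I. w $ j * w $ j) + (\<Sum>i\<in>I. w $ i * w $ i) * (\<Sum>j\<in>I. x $ j * x $ j)
       - 2 * ((\<Sum>i\<in>I. w $ i * x $ i) * (\<Sum>j\<in>I. w $ j * x $ j))"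
    by (simp only: sum_product sum_subtractf sum.distrib sum_distrib_left[of "2::real"])
  also have "\<dots> = 2 * (1 - (w \<bullet> x)\<^sup>2)" by (simp add: wx ww xx power2_eq_square)
  finally show "(\<Sum>i\<in>I. \<Sum>j\<in>I - {i}. (w $ j * x $ i - w $ i * x $ j)\<^sup>2) = 2 * (1 - (w \<bullet> x)\<^sup>2)" .
qed

text \<open>
Along the ray in direction \<open>w\<close>, the integral \<open>f r\<close> of \<open>cos (r * (w \<bullet> x) + c)\<close> satisfies
\<open>r * (f + f'') + \<kappa> * f' = 0\<close>; this is the sum of the rotation identities over all pairs of coordinates
of the block. The phase \<open>c\<close> covers the real and the imaginary part of the Fourier transform at once.
\<close>

lemma sphere_cos_integral_decay:
  fixes I :: "'n::finite set"
  assumes card: "card I \<ge> 2"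
  shows "\<exists>C>0. \<forall>w c r. coord_proj I w = w \<longrightarrow> norm w = 1 \<longrightarrow> 0 \<le> r \<longrightarrow>
    \<bar>\<integral>x. cos (r * (w \<bullet> x) + c) \<partial>sphere_measure I\<bar> \<le> C * (1 + r) powr (- (real (card I) - 1) / 2)"
proof -
  have I: "I \<noteq> {}" using card by auto
  interpret prob_space "sphere_measure I" by (rule prob_space_sphere_measure[OF I])
  define \<kappa> where "\<kappa> = real (card I) - 1"
  have k: "\<kappa> \<ge> 1" using card by (simp add: \<kappa>_def)
  from helmholtz_radial_decay[OF k] obtain C where C: "C > 0" and
    decay: "\<And>f f1 f2 r. \<lbrakk>\<And>r. (f has_real_derivative f1 r) (at r); \<And>r. (f1 has_real_derivative f2 r) (at r);
      \<And>r. r * (f r + f2 r) + \<kappa> * f1 r = 0; \<And>r. \<bar>f r\<bar> \<le> 1; \<And>r. \<bar>f1 r\<bar> \<le> 1; r \<ge> 0\<rbrakk>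
      \<Longrightarrow> \<bar>f r\<bar> \<le> C * (1 + r) powr (- \<kappa> / 2)" by blast
  have "\<bar>\<integral>x. cos (r * (w \<bullet> x) + c) \<partial>sphere_measure I\<bar> \<le> C * (1 + r) powr (- \<kappa> / 2)"
    if w: "coord_proj I w = w" "norm w = 1" and r: "0 \<le> r" for w :: "real ^ 'n" and c r
  proof -
    define F where "F r x = cos (r * (w \<bullet> x) + c)" for r and x :: "real ^ 'n"
    define F1 where "F1 r x = - ((w \<bullet> x) * sin (r * (w \<bullet> x) + c))" for r and x :: "real ^ 'n"
    define F2 where "F2 r x = - ((w \<bullet> x)\<^sup>2 * cos (r * (w \<bullet> x) + c))" for r and x :: "real ^ 'n"
    have meas: "F r \<in> borel_measurable borel" "F1 r \<in> borel_measurable borel" "F2 r \<in> borel_measurable borel" for r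
      unfolding F_def F1_def F2_def by (intro borel_measurable_continuous_onI continuous_intros)+
    have meas': "F r \<in> borel_measurable (sphere_measure I)" "F1 r \<in> borel_measurable (sphere_measure I)"
      "F2 r \<in> borel_measurable (sphere_measure I)" for r
      using meas measurable_cong_sets[OF sets_sphere_measure refl] by blast+
    have wx: "\<bar>w \<bullet> x\<bar> \<le> 1" if "norm x = 1" for x using Cauchy_Schwarz_ineq2[of w x] w(2) that by simp
    have bound: "\<bar>F r x\<bar> \<le> 1" "\<bar>F1 r x\<bar> \<le> 1" "\<bar>F2 r x\<bar> \<le> 1" if "norm x = 1" for r x
      using wx[OF that] unfolding F_def F1_def F2_def abs_minus_cancel abs_mult
      by (auto intro!: mult_le_one simp: abs_square_le_1)
    note int = integrable_sphere_measure[OF I meas(1) bound(1)] integrable_sphere_measure[OF I meas(2) bound(2)]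
      integrable_sphere_measure[OF I meas(3) bound(3)]
    have avg: "\<bar>\<integral>x. h x \<partial>sphere_measure I\<bar> \<le> 1" if h: "integrable (sphere_measure I) h" "\<And>x. norm x = 1 \<Longrightarrow> \<bar>h x\<bar> \<le> 1"
      for h :: "real ^ 'n \<Rightarrow> real"
    proof -
      have "\<bar>\<integral>x. h x \<partial>sphere_measure I\<bar> \<le> (\<integral>x. \<bar>h x\<bar> \<partial>sphere_measure I)" by (rule integral_abs_bound)
      also have "\<dots> \<le> (\<integral>x. 1 \<partial>sphere_measure I)"
        by (rule integral_mono_AE) (use h AE_sphere_measure[of I] in \<open>auto elim: eventually_mono\<close>)
      finally show ?thesis by (simp add: prob_space)
    qed
    define f where "f r = (\<integral>x. F r x \<partial>sphere_measure I)" for r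
    define f1 where "f1 r = (\<integral>x. F1 r x \<partial>sphere_measure I)" for r
    define f2 where "f2 r = (\<integral>x. F2 r x \<partial>sphere_measure I)" for r
    have d1: "(f has_real_derivative f1 r) (at r)" for r
      unfolding f_def f1_def
    proof (rule has_real_derivative_integral[OF int(1) meas'(2) finite_measure_axioms, where B = 1])
      have "((\<lambda>s. F s x) has_real_derivative F1 s x) (at s)" for s x
        unfolding F_def F1_def by (auto intro!: derivative_eq_intros)
      thus "AE x in sphere_measure I. \<forall>s. ((\<lambda>s. F s x) has_real_derivative F1 s x) (at s)" by simp
      show "AE x in sphere_measure I. \<forall>s. \<bar>F1 s x\<bar> \<le> 1"
        using AE_sphere_measure[of I] by eventually_elim (use bound in auto)
    qed
    have d2: "(f1 has_real_derivative f2 r) (at r)" for r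
      unfolding f1_def f2_def
    proof (rule has_real_derivative_integral[OF int(2) meas'(3) finite_measure_axioms, where B = 1])
      have "((\<lambda>s. F1 s x) has_real_derivative F2 s x) (at s)" for s x
        unfolding F1_def F2_def by (auto intro!: derivative_eq_intros simp: power2_eq_square)
      thus "AE x in sphere_measure I. \<forall>s. ((\<lambda>s. F1 s x) has_real_derivative F2 s x) (at s)" by simp
      show "AE x in sphere_measure I. \<forall>s. \<bar>F2 s x\<bar> \<le> 1"
        using AE_sphere_measure[of I] by eventually_elim (use bound in auto)
    qed
    have ode: "r * (f r + f2 r) + \<kappa> * f1 r = 0" for r
    proof -
      define T where "T i j x = (w $ i * x $ i + w $ j * x $ j) * sin (r * (w \<bullet> x) + c)
         - r * (w $ j * x $ i - w $ i * x $ j)\<^sup>2 * cos (r * (w \<bullet> x) + c)" for i j and x :: "real ^ 'n"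
      have T_int: "integrable (sphere_measure I) (T i j)" for i j
      proof (rule integrable_sphere_measure[OF I])
        show "T i j \<in> borel_measurable borel"
          unfolding T_def by (intro borel_measurable_continuous_onI continuous_intros)
        show "\<bar>T i j x\<bar> \<le> 2 * 1 + \<bar>r\<bar> * 4 * 1" if x: "norm x = 1" for x
        proof -
          have le1: "\<bar>w $ k * x $ l\<bar> \<le> 1" for k l
            unfolding abs_mult using component_le_norm_cart[of w k] component_le_norm_cart[of x l] w(2) x
            by (intro mult_le_one) auto
          have A: "\<bar>w $ i * x $ i + w $ j * x $ j\<bar> \<le> 2" using le1[of i i] le1[of j j] by linarith
          have "\<bar>w $ j * x $ i - w $ i * x $ j\<bar> \<le> 2" using le1[of j i] le1[of i j] by linarith
          hence "\<bar>w $ j * x $ i - w $ i * x $ j\<bar>\<^sup>2 \<le> 2\<^sup>2" by (intro power_mono) auto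
          hence Bb: "\<bar>(w $ j * x $ i - w $ i * x $ j)\<^sup>2\<bar> \<le> 4" by simp
          have "\<bar>(w $ i * x $ i + w $ j * x $ j) * sin (r * (w \<bullet> x) + c)\<bar> \<le> 2 * 1"
            unfolding abs_mult[of "w $ i * x $ i + w $ j * x $ j"] using A by (intro mult_mono) auto
          moreover have "\<bar>r * (w $ j * x $ i - w $ i * x $ j)\<^sup>2 * cos (r * (w \<bullet> x) + c)\<bar> \<le> \<bar>r\<bar> * 4 * 1"
            unfolding abs_mult[of "r * (w $ j * x $ i - w $ i * x $ j)\<^sup>2"] abs_mult[of r]
            using Bb by (intro mult_mono) auto
          ultimately show ?thesis unfolding T_def by linarith
        qed
      qed
      have "(\<integral>x. (\<Sum>i\<in>I. \<Sum>j\<in>I - {i}. T i j x) \<partial>sphere_measure I) = (\<Sum>i\<in>I. \<Sum>j\<in>I - {i}. \<integral>x. T i j x \<partial>sphere_measure I)"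
        using T_int by (simp add: Bochner_Integration.integral_sum)
      also have "\<dots> = 0"
        unfolding T_def using w(2) by (intro sum.neutral ballI sphere_rotation_identity[OF I]) auto
      finally have zero: "(\<integral>x. (\<Sum>i\<in>I. \<Sum>j\<in>I - {i}. T i j x) \<partial>sphere_measure I) = 0" .
      have sumT: "(\<Sum>i\<in>I. \<Sum>j\<in>I - {i}. T i j x) = - 2 * (\<kappa> * F1 r x + r * (F r x + F2 r x))"
        if x: "norm x = 1 \<and> coord_proj I x = x" for x
      proof -
        have "(\<Sum>i\<in>I. \<Sum>j\<in>I - {i}. T i j x)
            = (\<Sum>i\<in>I. \<Sum>j\<in>I - {i}. w $ i * x $ i + w $ j * x $ j) * sin (r * (w \<bullet> x) + c)
              - r * (\<Sum>i\<in>I. \<Sum>j\<in>I - {i}. (w $ j * x $ i - w $ i * x $ j)\<^sup>2) * cos (r * (w \<bullet> x) + c)"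
          unfolding T_def by (simp only: sum_subtractf sum_distrib_left sum_distrib_right)
        also have "\<dots> = - 2 * (\<kappa> * F1 r x + r * (F r x + F2 r x))"
          unfolding sum_pairs_rotation[OF w conjunct2[OF x] conjunct1[OF x]]
          by (simp add: \<kappa>_def F_def F1_def F2_def algebra_simps)
        finally show ?thesis .
      qed
      have "(\<integral>x. (\<Sum>i\<in>I. \<Sum>j\<in>I - {i}. T i j x) \<partial>sphere_measure I)
          = (\<integral>x. - 2 * (\<kappa> * F1 r x + r * (F r x + F2 r x)) \<partial>sphere_measure I)"
      proof (rule integral_cong_AE)
        show "AE x in sphere_measure I. (\<Sum>i\<in>I. \<Sum>j\<in>I - {i}. T i j x) = - 2 * (\<kappa> * F1 r x + r * (F r x + F2 r x))"
          using AE_sphere_measure[of I] by eventually_elim (rule sumT)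
        show "(\<lambda>x. \<Sum>i\<in>I. \<Sum>j\<in>I - {i}. T i j x) \<in> borel_measurable (sphere_measure I)"
          using borel_measurable_integrable[OF T_int] by (intro borel_measurable_sum)
      qed (use meas' in \<open>intro borel_measurable_times borel_measurable_add borel_measurable_const\<close>)
      also have "\<dots> = - 2 * (\<kappa> * f1 r + r * (f r + f2 r))"
        using int by (simp add: f_def f1_def f2_def)
      finally show ?thesis using zero by simp
    qed
    have "\<bar>f r\<bar> \<le> C * (1 + r) powr (- \<kappa> / 2)"
    proof (rule decay[OF d1 d2 ode _ _ r])
      show "\<bar>f r\<bar> \<le> 1" "\<bar>f1 r\<bar> \<le> 1" for r
        unfolding f_def f1_def by (intro avg int bound; assumption)+
    qed
    thus ?thesis by (simp add: f_def F_def)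
  qed
  thus ?thesis using C unfolding \<kappa>_def by blast
qed

section \<open>Finiteness of the energy integral\<close>

lemma nn_integral_even_finite:
  fixes h :: "real \<Rightarrow> real"
  assumes h: "h \<in> borel_measurable borel" and even: "\<And>t. h (- t) = h t"
    and half: "(\<integral>\<^sup>+t. ennreal (h t) * indicator {0..} t \<partial>lborel) < \<infinity>"
  shows "(\<integral>\<^sup>+t. ennreal (h t) \<partial>lborel) < \<infinity>"
proof -
  define g where "g t = ennreal (h t) * indicator {0..} t" for t
  have gm: "g \<in> borel_measurable borel" using h unfolding g_def by measurable
  have "(\<integral>\<^sup>+t. g (- t) \<partial>lborel) = (\<integral>\<^sup>+t. g t \<partial>distr lborel borel uminus)"
    using gm by (subst nn_integral_distr) auto
  hence refl: "(\<integral>\<^sup>+t. g (- t) \<partial>lborel) = (\<integral>\<^sup>+t. g t \<partial>lborel)" by (simp add: lborel_distr_uminus)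
  have "(\<integral>\<^sup>+t. ennreal (h t) \<partial>lborel) \<le> (\<integral>\<^sup>+t. g t + g (- t) \<partial>lborel)"
    by (rule nn_integral_mono) (auto simp: g_def even indicator_def)
  also have "\<dots> = (\<integral>\<^sup>+t. g t \<partial>lborel) + (\<integral>\<^sup>+t. g (- t) \<partial>lborel)"
    using gm by (intro nn_integral_add) auto
  also have "\<dots> < \<infinity>"
  proof -
    have "(\<integral>\<^sup>+t. g t \<partial>lborel) < \<infinity>" using half by (simp only: g_def)
    thus ?thesis unfolding refl by simp
  qed
  finally show ?thesis .
qed

text \<open>
One-dimensional majorant: the peak controls the energy integrand near the origin, the tail away from it.
\<close>

lemma nn_integral_power_peak_tail_finite:
  fixes \<gamma> e :: real
  assumes \<gamma>: "0 \<le> \<gamma>" "\<gamma> < 1" and e: "e > 0"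
  shows "(\<integral>\<^sup>+t. ennreal (\<bar>t\<bar> powr (- \<gamma>) * indicator {-1..1} t + (1 + \<bar>t\<bar>) powr (- (1 + e))) \<partial>lborel) < \<infinity>"
proof (rule nn_integral_even_finite)
  show "(\<lambda>t::real. \<bar>t\<bar> powr (- \<gamma>) * indicator {-1..1} t + (1 + \<bar>t\<bar>) powr (- (1 + e))) \<in> borel_measurable borel"
    by measurable
  show "\<bar>- t\<bar> powr - \<gamma> * indicator {-1..1} (- t) + (1 + \<bar>- t\<bar>) powr - (1 + e) =
        \<bar>t\<bar> powr - \<gamma> * indicator {-1..1} t + (1 + \<bar>t\<bar>) powr - (1 + e)" for t :: real
    by (auto simp: indicator_def)
  have I1: "(\<integral>\<^sup>+t. ennreal (t powr (- \<gamma>)) * indicator {0..1} t \<partial>lborel) < \<infinity>"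
    using nn_integral_has_integral_lebesgue'[OF _ has_integral_powr_from_0[of "- \<gamma>" 1]] \<gamma> by simp
  have I2: "(\<integral>\<^sup>+t. ennreal (t powr (- (1 + e))) * indicator {1..} t \<partial>lborel) < \<infinity>"
    using nn_integral_has_integral_lebesgue'[OF _ has_integral_powr_to_inf[of "- (1 + e)" 1]] e by simp
  have I3: "(\<integral>\<^sup>+t. indicator {0..1::real} t \<partial>lborel) < \<infinity>" by simp
  have "(\<integral>\<^sup>+t. ennreal (\<bar>t\<bar> powr (- \<gamma>) * indicator {-1..1} t + (1 + \<bar>t\<bar>) powr (- (1 + e))) * indicator {0..} t \<partial>lborel)
     \<le> (\<integral>\<^sup>+t. (ennreal (t powr (- \<gamma>)) * indicator {0..1} t + ennreal (t powr (- (1 + e))) * indicator {1..} t) + indicator {0..1} t \<partial>lborel)"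
  proof (rule nn_integral_mono)
    fix t :: real
    show "ennreal (\<bar>t\<bar> powr (- \<gamma>) * indicator {-1..1} t + (1 + \<bar>t\<bar>) powr (- (1 + e))) * indicator {0..} t
      \<le> (ennreal (t powr (- \<gamma>)) * indicator {0..1} t + ennreal (t powr (- (1 + e))) * indicator {1..} t) + indicator {0..1} t"
    proof (cases "t < 0")
      case False
      hence t: "t \<ge> 0" by simp
      show ?thesis
      proof (cases "t \<le> 1")
        case True
        have "(1 + t) powr (- (1 + e)) \<le> 1" using t e powr_mono[of "- (1 + e)" 0 "1 + t"] by simp
        hence "ennreal (t powr (- \<gamma>) + (1 + t) powr (- (1 + e))) \<le> ennreal (t powr (- \<gamma>)) + 1"
          by (subst ennreal_plus) (auto intro!: add_left_mono)
        also have "\<dots> \<le> (ennreal (t powr (- \<gamma>)) + ennreal (t powr (- (1 + e))) * indicator {1..} t) + 1"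
          by (intro add_right_mono) simp
        finally show ?thesis using t True by simp
      next
        case False
        hence "(1 + t) powr (- (1 + e)) \<le> t powr (- (1 + e))" using e by (intro powr_mono2') auto
        thus ?thesis using False t by (simp add: ennreal_leI)
      qed
    qed simp
  qed
  also have "\<dots> = (\<integral>\<^sup>+t. ennreal (t powr (- \<gamma>)) * indicator {0..1} t \<partial>lborel)
      + (\<integral>\<^sup>+t. ennreal (t powr (- (1 + e))) * indicator {1..} t \<partial>lborel) + (\<integral>\<^sup>+t. indicator {0..1::real} t \<partial>lborel)"
    by (subst nn_integral_add; (subst nn_integral_add)?) measurable
  also have "\<dots> < \<infinity>" using I1 I2 I3 by simp
  finally show "(\<integral>\<^sup>+t. ennreal (\<bar>t\<bar> powr (- \<gamma>) * indicator {-1..1} t + (1 + \<bar>t\<bar>) powr (- (1 + e))) * indicator {0..} t \<partial>lborel) < \<infinity>" .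
qed

lemma prod_Basis_vec:
  fixes z :: "real ^ 'n::finite" and g :: "real \<Rightarrow> 'b::comm_monoid_mult"
  shows "(\<Prod>b\<in>Basis. g (z \<bullet> b)) = (\<Prod>i\<in>UNIV. g (z $ i))"
proof -
  have basis: "(Basis :: (real ^ 'n) set) = range (\<lambda>i. axis i 1)" by (auto simp: Basis_vec_def)
  have "inj (\<lambda>i::'n. axis i (1::real))" by (auto simp: inj_on_def axis_eq_axis)
  hence "(\<Prod>b\<in>range (\<lambda>i::'n. axis i (1::real)). g (z \<bullet> b)) = (\<Prod>i\<in>UNIV. g (z $ i))"
    by (subst prod.reindex) (simp_all add: inner_axis)
  thus ?thesis by (simp only: basis)
qed

lemma nn_integral_prod_coords_finite:
  fixes g :: "real \<Rightarrow> real"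
  assumes g: "g \<in> borel_measurable borel" "\<And>t. g t \<ge> 0" and fin: "(\<integral>\<^sup>+t. ennreal (g t) \<partial>lborel) < \<infinity>"
  shows "(\<integral>\<^sup>+z. ennreal (\<Prod>i\<in>UNIV. g (z $ i)) \<partial>(lborel :: (real ^ 'n::finite) measure)) < \<infinity>"
proof -
  have "(\<integral>\<^sup>+z. ennreal (\<Prod>i\<in>UNIV. g (z $ i)) \<partial>(lborel :: (real ^ 'n) measure)) = (\<integral>\<^sup>+z. (\<Prod>b\<in>Basis. ennreal (g (z \<bullet> b))) \<partial>(lborel :: (real ^ 'n) measure))"
    using g(2) by (simp add: prod_Basis_vec prod_ennreal)
  also have "\<dots> = (\<Prod>b\<in>(Basis :: (real ^ 'n) set). \<integral>\<^sup>+t. ennreal (g t) \<partial>lborel)"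
    using g(1) by (intro nn_integral_lborel_prod) auto
  also have "\<dots> < \<infinity>" using fin by (simp add: power_less_top_ennreal)
  finally show ?thesis .
qed

text \<open>
Decay in the norm of a group of coordinates splits into decay in each of them, which reduces the
energy integral to one-dimensional ones.
\<close>

lemma powr_le_prod_coords:
  fixes z :: "real ^ 'n::finite"
  assumes A: "A \<noteq> {}" and R: "\<And>i. i \<in> A \<Longrightarrow> \<bar>z $ i\<bar> \<le> R" "R \<ge> 0" and e: "e \<ge> 0" and x: "real (card A) * (1 + e) \<le> x"
  shows "(1 + R) powr (- x) \<le> (\<Prod>i\<in>A. (1 + \<bar>z $ i\<bar>) powr (- (1 + e)))"
proof -
  have "(1 + R) powr (- x) \<le> (1 + R) powr (- (real (card A) * (1 + e)))"
    using R x by (intro powr_mono) auto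
  also have "\<dots> = ((1 + R) powr (- (1 + e))) powr real (card A)" by (simp add: powr_powr algebra_simps)
  also have "\<dots> = ((1 + R) powr (- (1 + e))) ^ card A" using R(2) by (intro powr_realpow) simp
  also have "\<dots> = (\<Prod>i\<in>A. (1 + R) powr (- (1 + e)))" by simp
  also have "\<dots> \<le> (\<Prod>i\<in>A. (1 + \<bar>z $ i\<bar>) powr (- (1 + e)))"
    using R e by (intro prod_mono conjI powr_mono2') auto
  finally show ?thesis .
qed

text \<open>
Away from the origin, the exponent \<open>a\<close> of the weight \<open>norm z powr (- a)\<close> is split as
\<open>k2 + b0 + b1 + \<eta>\<close>. The parts \<open>b1\<close> and \<open>b0\<close> raise the decay of \<open>F\<close> in the block \<open>I\<close> and in the coordinate
\<open>m\<close> to the exponents \<open>k\<close> and 1, the part \<open>k2\<close> serves the remaining coordinates, and \<open>\<eta> > 0\<close> is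
distributed over all of them to make every one-dimensional integral converge. Near the origin,
\<open>s > 0\<close> gives \<open>a < d\<close>, and the singularity splits evenly over the \<open>d\<close> coordinates.
\<close>

lemma energy_integral_finite:
  fixes F :: "real ^ 'n::finite \<Rightarrow> real"
  assumes I: "card I = k" "k \<ge> 2" and m: "m \<notin> I" and k2: "CARD('n) = k + k2 + 1" "k2 \<ge> 1"
    and \<alpha>: "0 < \<alpha>" "\<alpha> < 1 / 2" and \<theta>: "0 < \<theta>" "\<theta> \<le> 1"
    and F: "\<And>z. 0 \<le> F z" "\<And>z. F z \<le> 1"
    and decay: "\<And>\<epsilon>. \<epsilon> > 0 \<Longrightarrow> \<exists>K. \<forall>z. F z \<le> K * (1 + norm (coord_proj I z)) powr (- (real k - 1) / 2) * (1 + \<bar>z $ m\<bar>) powr (- \<alpha> / 2 + \<epsilon>)"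
    and s: "0 < s" "s < (real k + 1) * \<theta>" "s < real k * \<theta> + \<alpha>" "s < real k - 1 + \<alpha>"
  shows "(\<integral>\<^sup>+z. ennreal (F z powr (2 / \<theta>) * norm z powr (s / \<theta> - real CARD('n))) \<partial>lborel) < \<infinity>"
proof -
  define d where "d = real CARD('n)"
  have d: "d = real k + real k2 + 1" using k2 by (simp add: d_def)
  define a where "a = d - s / \<theta>"
  define b0 where "b0 = max 0 (1 - \<alpha> / \<theta>)"
  define b1 where "b1 = max 0 (real k - (real k - 1) / \<theta>)"
  define \<eta> where "\<eta> = real k + 1 - s / \<theta> - b0 - b1"
  have \<eta>: "\<eta> > 0"
  proof -
    have "s < (real k + 1) * \<theta> - max 0 (\<theta> - \<alpha>) - max 0 (real k * \<theta> - (real k - 1))"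
    \<comment> \<open>If \<open>\<theta> \<le> \<alpha> < 1 / 2\<close>, then \<open>k * \<theta> \<le> k - 1\<close>, so both maxima are 0.\<close>
    proof (cases "\<theta> \<le> \<alpha>")
      case True
      have "real k * \<theta> \<le> real k * (1 / 2)" using True \<alpha> by (intro mult_left_mono) auto
      also have "\<dots> \<le> real k - 1" using I(2) by simp
      finally show ?thesis using True s by (simp add: max_def)
    next
      case False
      thus ?thesis using s by (simp add: max_def distrib_right)
    qed
    also have "\<dots> = \<theta> * (real k + 1 - b0 - b1)"
    proof -
      have "\<theta> * b0 = max 0 (\<theta> - \<alpha>)" using \<theta>(1) by (cases "\<theta> \<le> \<alpha>") (auto simp: b0_def max_def field_simps)
      moreover have "\<theta> * b1 = max 0 (real k * \<theta> - (real k - 1))"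
        using \<theta>(1) by (cases "real k * \<theta> \<le> real k - 1") (auto simp: b1_def max_def field_simps)
      ultimately show ?thesis by (simp add: algebra_simps)
    qed
    finally have "s / \<theta> < real k + 1 - b0 - b1" using \<theta>(1) by (simp add: field_simps)
    thus ?thesis by (simp add: \<eta>_def)
  qed
  have a_eq: "a = real k2 + b0 + b1 + \<eta>" by (simp add: a_def d \<eta>_def)
  have b_nonneg: "b0 \<ge> 0" "b1 \<ge> 0" by (auto simp: b0_def b1_def)
  have a0: "a > 0" using a_eq b_nonneg \<eta> by simp
  have ad: "a < d" using s(1) \<theta>(1) by (simp add: a_def)
  have d0: "d > 0" using d by simp
  define e where "e = \<eta> / (6 * d)"
  have e: "e > 0" using \<eta> d0 by (simp add: e_def)
  have de: "d * e = \<eta> / 6" using d0 by (simp add: e_def)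
  obtain K where K: "\<And>z. F z \<le> K * (1 + norm (coord_proj I z)) powr (- (real k - 1) / 2) * (1 + \<bar>z $ m\<bar>) powr (- \<alpha> / 2 + \<theta> * \<eta> / 12)"
    using decay[of "\<theta> * \<eta> / 12"] \<theta>(1) \<eta> by auto
  define K' where "K' = max K 1"
  have K': "K' \<ge> 1" "K \<le> K'" by (auto simp: K'_def)
  define g where "g t = \<bar>t\<bar> powr (- (a / d)) * indicator {-1..1} t + (1 + \<bar>t\<bar>) powr (- (1 + e))" for t :: real
  have g0: "g t \<ge> 0" for t by (auto simp: g_def)
  have g_meas: "g \<in> borel_measurable borel" unfolding g_def by measurable
  have g_fin: "(\<integral>\<^sup>+t. ennreal (g t) \<partial>lborel) < \<infinity>"
    unfolding g_def using a0 ad d0 e by (intro nn_integral_power_peak_tail_finite) auto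
  define C where "C = K' powr (2 / \<theta>) * 2 powr a"
  have C0: "C \<ge> 1"
  proof -
    have "1 * 1 \<le> K' powr (2 / \<theta>) * 2 powr a"
      using K'(1) \<theta>(1) a0 by (intro mult_mono ge_one_powr_ge_zero) auto
    thus ?thesis by (simp add: C_def)
  qed
  have far: "F z powr (2 / \<theta>) * norm z powr (- a) \<le> C * (\<Prod>i\<in>UNIV. (1 + \<bar>z $ i\<bar>) powr (- (1 + e)))"
    if z: "norm z \<ge> 1" for z
  proof -
    define N P M where "N = norm z" and "P = norm (coord_proj I z)" and "M = \<bar>z $ m\<bar>"
    define J where "J = - (insert m I)"
    have N1: "N \<ge> 1" using z by (simp add: N_def)
    have P0: "P \<ge> 0" and M0: "M \<ge> 0" by (auto simp: P_def M_def)
    have PN: "P \<le> N" unfolding P_def N_def by (rule norm_le_componentwise_cart) auto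
    have MN: "M \<le> N" unfolding M_def N_def using component_le_norm_cart[of z m] by simp
    have F_le: "F z powr (2 / \<theta>) \<le> K' powr (2 / \<theta>) * (1 + P) powr (- (real k - 1) / \<theta>) * (1 + M) powr (- \<alpha> / \<theta> + \<eta> / 6)"
    proof -
      have "F z \<le> K' * (1 + P) powr (- (real k - 1) / 2) * (1 + M) powr (- \<alpha> / 2 + \<theta> * \<eta> / 12)"
        by (rule order_trans[OF K]) (use K'(2) in \<open>auto simp: P_def M_def intro!: mult_right_mono\<close>)
      hence "F z powr (2 / \<theta>) \<le> (K' * (1 + P) powr (- (real k - 1) / 2) * (1 + M) powr (- \<alpha> / 2 + \<theta> * \<eta> / 12)) powr (2 / \<theta>)"
        using F(1) \<theta>(1) by (intro powr_mono2) auto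
      also have "\<dots> = K' powr (2 / \<theta>) * (1 + P) powr (- (real k - 1) / 2 * (2 / \<theta>)) * (1 + M) powr ((- \<alpha> / 2 + \<theta> * \<eta> / 12) * (2 / \<theta>))"
        using K'(1) by (simp add: powr_mult powr_powr)
      also have "- (real k - 1) / 2 * (2 / \<theta>) = - (real k - 1) / \<theta>" using \<theta>(1) by (simp add: field_simps)
      also have "(- \<alpha> / 2 + \<theta> * \<eta> / 12) * (2 / \<theta>) = - \<alpha> / \<theta> + \<eta> / 6" using \<theta>(1) by (simp add: field_simps)
      finally show ?thesis .
    qed
    have N_le: "N powr (- a) \<le> 2 powr a * ((1 + M) powr (- (b0 + \<eta> / 3)) * (1 + P) powr (- (b1 + \<eta> / 3)) * (1 + N) powr (- (real k2 + \<eta> / 3)))"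
    proof -
      have "(2 * N) powr (- a) \<le> (1 + N) powr (- a)" using N1 a0 by (intro powr_mono2') auto
      hence "2 powr a * (2 powr (- a) * N powr (- a)) \<le> 2 powr a * (1 + N) powr (- a)"
        by (intro mult_left_mono) (auto simp: powr_mult)
      moreover have "2 powr a * (2 powr (- a) * N powr (- a)) = N powr (- a)"
      proof -
        have "2 powr a * 2 powr (- a) = (1::real)" by (simp flip: powr_add)
        thus ?thesis by (simp only: mult.assoc[symmetric] mult_1)
      qed
      moreover have "(1 + N) powr (- a) = (1 + N) powr (- (b0 + \<eta> / 3)) * (1 + N) powr (- (b1 + \<eta> / 3)) * (1 + N) powr (- (real k2 + \<eta> / 3))"
      proof -
        have "- a = - (b0 + \<eta> / 3) + - (b1 + \<eta> / 3) + - (real k2 + \<eta> / 3)" using a_eq by linarith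
        thus ?thesis by (simp only: powr_add)
      qed
      moreover have "\<dots> \<le> (1 + M) powr (- (b0 + \<eta> / 3)) * (1 + P) powr (- (b1 + \<eta> / 3)) * (1 + N) powr (- (real k2 + \<eta> / 3))"
        using b_nonneg \<eta> M0 P0 MN PN by (intro mult_mono powr_mono2') auto
      ultimately have "N powr (- a) \<le> 2 powr a * (1 + N) powr (- a)" and
        *: "(1 + N) powr (- a) \<le> (1 + M) powr (- (b0 + \<eta> / 3)) * (1 + P) powr (- (b1 + \<eta> / 3)) * (1 + N) powr (- (real k2 + \<eta> / 3))"
        by (simp_all only:)
      thus ?thesis using mult_left_mono[OF *, of "2 powr a"] by (intro order_trans[OF \<open>N powr (- a) \<le> _\<close>]) simp
    qed
    have Q_P: "(1 + P) powr (- (real k - 1) / \<theta>) * (1 + P) powr (- (b1 + \<eta> / 3)) \<le> (\<Prod>i\<in>I. (1 + \<bar>z $ i\<bar>) powr (- (1 + e)))"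
    proof -
      have "(1 + P) powr (- (real k - 1) / \<theta>) * (1 + P) powr (- (b1 + \<eta> / 3)) = (1 + P) powr (- ((real k - 1) / \<theta> + b1 + \<eta> / 3))"
      proof -
        have "- ((real k - 1) / \<theta> + b1 + \<eta> / 3) = - (real k - 1) / \<theta> + - (b1 + \<eta> / 3)"
          using minus_divide_left[of "real k - 1" \<theta>] by linarith
        thus ?thesis by (simp only: powr_add)
      qed
      also have "\<dots> \<le> (\<Prod>i\<in>I. (1 + \<bar>z $ i\<bar>) powr (- (1 + e)))"
      proof (rule powr_le_prod_coords)
        show "\<bar>z $ i\<bar> \<le> P" if "i \<in> I" for i
          using component_le_norm_cart[of "coord_proj I z" i] that by (simp add: P_def)
        have "real k * e \<le> d * e" using e by (intro mult_right_mono) (auto simp: d)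
        hence "real k * e \<le> \<eta> / 3" using de \<eta> by simp
        moreover have "real k \<le> (real k - 1) / \<theta> + b1" by (simp add: b1_def max_def)
        ultimately show "real (card I) * (1 + e) \<le> (real k - 1) / \<theta> + b1 + \<eta> / 3" using I(1) by (simp add: distrib_left)
      qed (use I e P0 in auto)
      finally show ?thesis .
    qed
    have Q_M: "(1 + M) powr (- \<alpha> / \<theta> + \<eta> / 6) * (1 + M) powr (- (b0 + \<eta> / 3)) \<le> (1 + \<bar>z $ m\<bar>) powr (- (1 + e))"
    proof -
      have "1 * e \<le> d * e" using e by (intro mult_right_mono) (auto simp: d)
      hence "e \<le> \<eta> / 6" using de by simp
      moreover have "1 \<le> \<alpha> / \<theta> + b0" by (simp add: b0_def max_def)
      ultimately show ?thesis unfolding powr_add[symmetric] M_def by (intro powr_mono) auto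
    qed
    have Q_N: "(1 + N) powr (- (real k2 + \<eta> / 3)) \<le> (\<Prod>i\<in>J. (1 + \<bar>z $ i\<bar>) powr (- (1 + e)))"
    proof (rule powr_le_prod_coords)
      have cJ: "card J = k2"
        using m I(1) k2(1) unfolding J_def by (simp add: Compl_eq_Diff_UNIV card_Diff_subset)
      show "J \<noteq> {}" using cJ k2(2) by auto
      show "\<bar>z $ i\<bar> \<le> N" for i using component_le_norm_cart[of z i] by (simp add: N_def)
      have "real k2 * e \<le> d * e" using e by (intro mult_right_mono) (auto simp: d)
      hence "real k2 * e \<le> \<eta> / 3" using de \<eta> by simp
      thus "real (card J) * (1 + e) \<le> real k2 + \<eta> / 3" by (simp add: cJ distrib_left)
    qed (use N1 e in auto)
    have "F z powr (2 / \<theta>) * N powr (- a)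
       \<le> (K' powr (2 / \<theta>) * (1 + P) powr (- (real k - 1) / \<theta>) * (1 + M) powr (- \<alpha> / \<theta> + \<eta> / 6))
         * (2 powr a * ((1 + M) powr (- (b0 + \<eta> / 3)) * (1 + P) powr (- (b1 + \<eta> / 3)) * (1 + N) powr (- (real k2 + \<eta> / 3))))"
      by (intro mult_mono F_le N_le) auto
    also have "\<dots> = C * (((1 + P) powr (- (real k - 1) / \<theta>) * (1 + P) powr (- (b1 + \<eta> / 3)))
         * (((1 + M) powr (- \<alpha> / \<theta> + \<eta> / 6) * (1 + M) powr (- (b0 + \<eta> / 3))) * (1 + N) powr (- (real k2 + \<eta> / 3))))"
      by (simp only: C_def mult_ac)
    also have "\<dots> \<le> C * ((\<Prod>i\<in>I. (1 + \<bar>z $ i\<bar>) powr (- (1 + e))) * ((1 + \<bar>z $ m\<bar>) powr (- (1 + e)) * (\<Prod>i\<in>J. (1 + \<bar>z $ i\<bar>) powr (- (1 + e)))))"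
      using C0 by (intro mult_left_mono mult_mono Q_P Q_M Q_N mult_nonneg_nonneg prod_nonneg) auto
    also have "(\<Prod>i\<in>I. (1 + \<bar>z $ i\<bar>) powr (- (1 + e))) * ((1 + \<bar>z $ m\<bar>) powr (- (1 + e)) * (\<Prod>i\<in>J. (1 + \<bar>z $ i\<bar>) powr (- (1 + e))))
        = (\<Prod>i\<in>UNIV. (1 + \<bar>z $ i\<bar>) powr (- (1 + e)))"
    proof -
      have "(\<Prod>i\<in>UNIV. (1 + \<bar>z $ i\<bar>) powr (- (1 + e))) = (\<Prod>i\<in>J. (1 + \<bar>z $ i\<bar>) powr (- (1 + e))) * (\<Prod>i\<in>insert m I. (1 + \<bar>z $ i\<bar>) powr (- (1 + e)))"
        unfolding J_def Compl_eq_Diff_UNIV by (rule prod.subset_diff) auto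
      thus ?thesis using m by (simp add: mult_ac)
    qed
    finally show ?thesis by (simp add: N_def)
  qed
  have bound: "F z powr (2 / \<theta>) * norm z powr (- a) \<le> C * (\<Prod>i\<in>UNIV. g (z $ i))"
    if nz: "\<forall>i. z $ i \<noteq> 0" for z
  proof (cases "norm z \<ge> 1")
    case True
    have "(\<Prod>i\<in>UNIV. (1 + \<bar>z $ i\<bar>) powr (- (1 + e))) \<le> (\<Prod>i\<in>UNIV. g (z $ i))"
      by (intro prod_mono) (auto simp: g_def)
    thus ?thesis using far[OF True] C0 by (meson mult_left_mono order_trans zero_le_one)
  next
    case False
    have zi: "\<bar>z $ i\<bar> \<le> norm z" for i by (rule component_le_norm_cart)
    have norm_prod: "norm z powr (- a) = (\<Prod>i\<in>(UNIV::'n set). norm z powr (- (a / d)))"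
    proof -
      have "z \<noteq> 0" using nz by (auto simp: vec_eq_iff)
      hence "(norm z powr (- (a / d))) ^ CARD('n) = (norm z powr (- (a / d))) powr d"
        unfolding d_def by (intro powr_realpow[symmetric]) simp
      thus ?thesis using d0 by (simp add: powr_powr)
    qed
    have "F z powr (2 / \<theta>) \<le> 1 powr (2 / \<theta>)" using F \<theta>(1) by (intro powr_mono2) auto
    hence "F z powr (2 / \<theta>) * norm z powr (- a) \<le> 1 * norm z powr (- a)"
      by (intro mult_right_mono) auto
    also have "\<dots> \<le> (\<Prod>i\<in>UNIV. g (z $ i))"
      unfolding mult_1 norm_prod
    proof (intro prod_mono conjI)
      fix i
      have "\<bar>z $ i\<bar> \<le> 1" using zi[of i] False by linarith
      moreover have "norm z powr (- (a / d)) \<le> \<bar>z $ i\<bar> powr (- (a / d))"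
        using zi[of i] nz a0 d0 by (intro powr_mono2') auto
      ultimately show "norm z powr (- (a / d)) \<le> g (z $ i)"
        by (auto simp: g_def abs_le_iff intro: add_increasing2)
    qed auto
    also have "\<dots> \<le> C * (\<Prod>i\<in>UNIV. g (z $ i))"
      using C0 mult_right_mono[of 1 C "\<Prod>i\<in>UNIV. g (z $ i)"] g0 by (simp add: prod_nonneg)
    finally show ?thesis .
  qed
  have "AE z::real ^ 'n in lborel. z $ i \<noteq> 0" for i
    using AE_lborel_inner_neq[of "axis i (1::real)" "0::real"] by (simp add: inner_axis axis_in_Basis_iff)
  hence ae: "AE z::real ^ 'n in lborel. \<forall>i. z $ i \<noteq> 0" by (simp add: AE_all_countable)
  have "(\<integral>\<^sup>+z. ennreal (F z powr (2 / \<theta>) * norm z powr (s / \<theta> - real CARD('n))) \<partial>lborel)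
      \<le> (\<integral>\<^sup>+z. ennreal C * ennreal (\<Prod>i\<in>UNIV. g (z $ i)) \<partial>(lborel :: (real ^ 'n) measure))"
  proof (rule nn_integral_mono_AE)
    show "AE z in lborel. ennreal (F z powr (2 / \<theta>) * norm z powr (s / \<theta> - real CARD('n)))
        \<le> ennreal C * ennreal (\<Prod>i\<in>UNIV. g (z $ i))"
      using ae
    proof eventually_elim
      case (elim z)
      have "- a = s / \<theta> - real CARD('n)" by (simp add: a_def d_def)
      thus ?case using bound[OF elim] C0 g0 by (simp add: ennreal_mult[symmetric] prod_nonneg ennreal_leI)
    qed
  qed
  also have "\<dots> = ennreal C * (\<integral>\<^sup>+z. ennreal (\<Prod>i\<in>UNIV. g (z $ i)) \<partial>(lborel :: (real ^ 'n) measure))"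
  proof (rule nn_integral_cmult)
    have "(\<lambda>z::real ^ 'n. z $ i) \<in> borel_measurable borel" for i
      by (intro borel_measurable_continuous_onI continuous_intros)
    thus "(\<lambda>z::real ^ 'n. ennreal (\<Prod>i\<in>UNIV. g (z $ i))) \<in> borel_measurable lborel"
      using g_meas by measurable
  qed
  also have "\<dots> < \<infinity>"
    using nn_integral_prod_coords_finite[OF g_meas g0 g_fin, where ?'n = 'n] by (simp add: ennreal_mult_less_top)
  finally show ?thesis .
qed

section \<open>Cylinders over spheres\<close>

abbreviation sphere_ft :: "'n::finite set \<Rightarrow> real ^ 'n \<Rightarrow> complex" where
  "sphere_ft I z \<equiv> (\<integral>x. cis (- (2 * pi * (z \<bullet> x))) \<partial>sphere_measure I)"

lemma sphere_measure_ft_decay: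
  fixes I :: "'n::finite set"
  assumes card: "card I \<ge> 2"
  shows "\<exists>K>0. \<forall>z. cmod (sphere_ft I z)
     \<le> K * (1 + norm (coord_proj I z)) powr (- (real (card I) - 1) / 2)"
proof -
  have I: "I \<noteq> {}" using card by auto
  interpret prob_space "sphere_measure I" by (rule prob_space_sphere_measure[OF I])
  define \<kappa> where "\<kappa> = real (card I) - 1"
  have k: "\<kappa> \<ge> 1" using card by (simp add: \<kappa>_def)
  obtain C where C: "C > 0" and decay: "\<And>w c r. coord_proj I w = w \<Longrightarrow> norm w = 1 \<Longrightarrow> 0 \<le> r \<Longrightarrow>
    \<bar>\<integral>x. cos (r * (w \<bullet> x) + c) \<partial>sphere_measure I\<bar> \<le> C * (1 + r) powr (- \<kappa> / 2)"
    using sphere_cos_integral_decay[OF card] unfolding \<kappa>_def by blast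
  have int: "integrable (sphere_measure I) (\<lambda>x. cis (- (2 * pi * (z \<bullet> x))))" for z
  proof (rule integrable_const_bound[where B = 1])
    show "(\<lambda>x. cis (- (2 * pi * (z \<bullet> x)))) \<in> borel_measurable (sphere_measure I)"
      unfolding cis_conv_exp measurable_cong_sets[OF sets_sphere_measure refl]
      by (intro borel_measurable_continuous_onI continuous_intros)
  qed simp
  have "cmod (sphere_ft I z) \<le> (1 + 2 * C) * (1 + norm (coord_proj I z)) powr (- \<kappa> / 2)" for z
  proof (cases "coord_proj I z = 0")
    case True
    have "cmod (sphere_ft I z) \<le> (\<integral>x. cmod (cis (- (2 * pi * (z \<bullet> x)))) \<partial>sphere_measure I)"
      by (rule integral_norm_bound)
    also have "\<dots> = 1" by (simp add: prob_space)
    finally show ?thesis using True C by simp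
  next
    case False
    define R where "R = norm (coord_proj I z)"
    define w where "w = coord_proj I z /\<^sub>R R"
    have R0: "R > 0" using False by (simp add: R_def)
    have w: "coord_proj I w = w" "norm w = 1"
      using R0 by (auto simp: w_def linear_cmul[OF linear_coord_proj] R_def[symmetric])
    have zx: "z \<bullet> x = R * (w \<bullet> x)" if "coord_proj I x = x" for x
    proof -
      have "z \<bullet> x = coord_proj I z \<bullet> x" using inner_coord_proj[of I z x] that by simp
      also have "coord_proj I z = R *\<^sub>R w" using R0 by (simp add: w_def)
      finally show ?thesis by simp
    qed
    have ae: "AE x in sphere_measure I. z \<bullet> x = R * (w \<bullet> x)"
      using AE_sphere_measure[of I] by eventually_elim (use zx in blast)
    have meas: "(\<lambda>x. h (v \<bullet> x)) \<in> borel_measurable (sphere_measure I)" if "continuous_on UNIV h" for h :: "real \<Rightarrow> real" and v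
      unfolding measurable_cong_sets[OF sets_sphere_measure refl]
      by (intro borel_measurable_continuous_onI continuous_on_compose2[OF that] continuous_intros) auto
    have Re_eq: "Re (sphere_ft I z) = (\<integral>x. cos ((2 * pi * R) * (w \<bullet> x) + 0) \<partial>sphere_measure I)"
    proof -
      have "Re (sphere_ft I z) = (\<integral>x. cos (2 * pi * (z \<bullet> x)) \<partial>sphere_measure I)"
        using integral_Re[OF int[of z]] by simp
      also have "\<dots> = (\<integral>x. cos ((2 * pi * R) * (w \<bullet> x) + 0) \<partial>sphere_measure I)"
      proof (rule integral_cong_AE)
        show "AE x in sphere_measure I. cos (2 * pi * (z \<bullet> x)) = cos ((2 * pi * R) * (w \<bullet> x) + 0)"
          using ae by eventually_elim (simp add: mult.assoc)
      qed (intro meas continuous_intros)+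
      finally show ?thesis .
    qed
    have Im_eq: "Im (sphere_ft I z) = (\<integral>x. cos ((2 * pi * R) * (w \<bullet> x) + pi / 2) \<partial>sphere_measure I)"
    proof -
      have "Im (sphere_ft I z) = (\<integral>x. - sin (2 * pi * (z \<bullet> x)) \<partial>sphere_measure I)"
        using integral_Im[OF int[of z]] by simp
      also have "\<dots> = (\<integral>x. cos ((2 * pi * R) * (w \<bullet> x) + pi / 2) \<partial>sphere_measure I)"
      proof (rule integral_cong_AE)
        show "AE x in sphere_measure I. - sin (2 * pi * (z \<bullet> x)) = cos ((2 * pi * R) * (w \<bullet> x) + pi / 2)"
          using ae by eventually_elim (simp add: mult.assoc cos_add)
      qed (intro meas continuous_intros)+
      finally show ?thesis .
    qed
    have "cmod (sphere_ft I z)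
        \<le> \<bar>Re (sphere_ft I z)\<bar> + \<bar>Im (sphere_ft I z)\<bar>"
      by (rule cmod_le)
    also have "\<dots> \<le> C * (1 + 2 * pi * R) powr (- \<kappa> / 2) + C * (1 + 2 * pi * R) powr (- \<kappa> / 2)"
      unfolding Re_eq Im_eq using R0 by (intro add_mono decay w) auto
    also have "\<dots> = 2 * C * (1 + 2 * pi * R) powr (- \<kappa> / 2)" by simp
    also have "\<dots> \<le> (1 + 2 * C) * (1 + R) powr (- \<kappa> / 2)"
    proof (intro mult_mono powr_mono2')
      have "1 * R \<le> (2 * pi) * R" using R0 pi_ge_two by (intro mult_right_mono) auto
      thus "1 + R \<le> 1 + 2 * pi * R" by simp
    qed (use C R0 k in auto)
    finally show ?thesis by (simp add: R_def)
  qed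
  thus ?thesis using C unfolding \<kappa>_def by (intro exI[of _ "1 + 2 * C"]) auto
qed

definition cylinder :: "'n::finite set \<Rightarrow> 'n \<Rightarrow> real set \<Rightarrow> (real ^ 'n) set" where
  "cylinder I m C = (\<lambda>(u, t). u + t *\<^sub>R axis m 1) ` ({u. norm u = 1 \<and> coord_proj I u = u} \<times> C)"

definition cylinder_measure :: "'n::finite set \<Rightarrow> 'n \<Rightarrow> real measure \<Rightarrow> (real ^ 'n) measure" where
  "cylinder_measure I m \<nu> = distr (sphere_measure I \<Otimes>\<^sub>M \<nu>) borel (\<lambda>(u, t). u + t *\<^sub>R axis m 1)"

lemma compact_cylinder:
  assumes "compact C" shows "compact (cylinder I m C)"
  unfolding cylinder_def
proof (rule compact_continuous_image)
  have "closed {u :: real ^ 'a. norm u = 1}"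
    by (rule closed_Collect_eq) (intro continuous_intros)+
  moreover have "closed {u :: real ^ 'a. coord_proj I u = u}"
    by (rule closed_Collect_eq[OF continuous_coord_proj continuous_on_id])
  ultimately have "closed ({u :: real ^ 'a. norm u = 1} \<inter> {u. coord_proj I u = u})" by (rule closed_Int)
  moreover have "bounded {u :: real ^ 'a. norm u = 1 \<and> coord_proj I u = u}"
    by (rule boundedI[where B = 1]) auto
  ultimately have "compact {u :: real ^ 'a. norm u = 1 \<and> coord_proj I u = u}"
    by (simp add: compact_eq_bounded_closed Collect_conj_eq)
  thus "compact ({u :: real ^ 'a. norm u = 1 \<and> coord_proj I u = u} \<times> C)" using assms by (rule compact_Times)
qed (auto simp: split_beta intro!: continuous_intros)

lemma cylinder_map_measurable:
  assumes "real_distribution \<nu>"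
  shows "(\<lambda>(u, t). u + t *\<^sub>R axis m 1) \<in> borel_measurable (sphere_measure I \<Otimes>\<^sub>M \<nu>)"
proof -
  have "sets \<nu> = sets borel" using real_distribution.events_eq_borel[OF assms] .
  hence eq: "borel_measurable (sphere_measure I \<Otimes>\<^sub>M \<nu>) = borel_measurable (borel \<Otimes>\<^sub>M borel)"
    by (intro measurable_cong_sets sets_pair_measure_cong) auto
  show ?thesis unfolding eq borel_prod
    by (rule borel_measurable_continuous_onI) (auto simp: split_beta intro!: continuous_intros)
qed

lemma cylinder_measure_in_measures_on:
  assumes I: "I \<noteq> {}" and \<nu>: "real_distribution \<nu>" and C: "compact C" and ae: "AE t in \<nu>. t \<in> C"
  shows "prob_space (cylinder_measure I m \<nu>)" "cylinder_measure I m \<nu> \<in> measures_on (cylinder I m C)"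
proof -
  interpret S: prob_space "sphere_measure I" by (rule prob_space_sphere_measure[OF I])
  interpret N: real_distribution \<nu> by (rule \<nu>)
  interpret P: pair_prob_space "sphere_measure I" \<nu> ..
  note meas = cylinder_map_measurable[OF \<nu>, of m I]
  show prob: "prob_space (cylinder_measure I m \<nu>)"
    unfolding cylinder_measure_def by (rule P.prob_space_distr[OF meas])
  interpret C: prob_space "cylinder_measure I m \<nu>" by (rule prob)
  have closed: "closed (cylinder I m C)" using compact_cylinder[OF C] by (rule compact_imp_closed)
  have "AE p in sphere_measure I \<Otimes>\<^sub>M \<nu>. (\<lambda>(u, t). u + t *\<^sub>R axis m 1) p \<in> cylinder I m C"
  proof (rule P.AE_pair_measure)
    show "{p \<in> space (sphere_measure I \<Otimes>\<^sub>M \<nu>). (\<lambda>(u, t). u + t *\<^sub>R axis m 1) p \<in> cylinder I m C} \<in> sets (sphere_measure I \<Otimes>\<^sub>M \<nu>)"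
      using measurable_sets[OF meas borel_closed[OF closed]] by (simp add: vimage_def Int_def conj_commute)
    show "AE u in sphere_measure I. AE t in \<nu>. (\<lambda>(u, t). u + t *\<^sub>R axis m 1) (u, t) \<in> cylinder I m C"
      using AE_sphere_measure[of I]
    proof eventually_elim
      case (elim u)
      show ?case using ae
      proof eventually_elim
        case (elim t)
        thus ?case using \<open>norm u = 1 \<and> coord_proj I u = u\<close> unfolding cylinder_def by blast
      qed
    qed
  qed
  hence "AE x in cylinder_measure I m \<nu>. x \<in> cylinder I m C"
    unfolding cylinder_measure_def using meas borel_closed[OF closed] by (subst AE_distr_iff) auto
  hence null: "emeasure (cylinder_measure I m \<nu>) (- cylinder I m C) = 0"
    using borel_closed[OF closed] by (subst (asm) AE_iff_measurable[OF _ refl]) (auto simp: cylinder_measure_def Compl_eq)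
  have "measure_support (cylinder_measure I m \<nu>) \<subseteq> cylinder I m C"
  proof
    fix x assume x: "x \<in> measure_support (cylinder_measure I m \<nu>)"
    show "x \<in> cylinder I m C"
    proof (rule ccontr)
      assume "x \<notin> cylinder I m C"
      hence "emeasure (cylinder_measure I m \<nu>) (- cylinder I m C) > 0"
        using x closed unfolding measure_support_def by (auto simp: open_Compl)
      with null show False by simp
    qed
  qed
  moreover have "emeasure (cylinder_measure I m \<nu>) UNIV \<noteq> 0"
    using C.emeasure_space_1 by (simp add: cylinder_measure_def)
  moreover have "sets (cylinder_measure I m \<nu>) = sets borel" by (simp add: cylinder_measure_def)
  ultimately show "cylinder_measure I m \<nu> \<in> measures_on (cylinder I m C)"
    using C.finite_measure_axioms by (simp add: measures_on_def)
qed

lemma exp_two_pi_cis: "exp (- 2 * of_real pi * \<i> * of_real r) = cis (- (2 * pi * r))"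
  unfolding cis_conv_exp by (rule arg_cong[where f = exp]) simp

text \<open>
The cylinder lies in the block \<open>I\<close> plus the \<open>m\<close>-axis, so its Fourier transform is a product.
\<close>

lemma fourier_transform_cylinder_measure:
  assumes I: "I \<noteq> {}" and \<nu>: "real_distribution \<nu>"
  shows "fourier_transform (cylinder_measure I m \<nu>) z
    = sphere_ft I z * char \<nu> (- (2 * pi * z $ m))"
proof -
  interpret S: prob_space "sphere_measure I" by (rule prob_space_sphere_measure[OF I])
  interpret N: real_distribution \<nu> by (rule \<nu>)
  interpret P: pair_prob_space "sphere_measure I" \<nu> ..
  define f where "f u t = cis (- (2 * pi * (z \<bullet> u))) * cis (- (2 * pi * (z $ m)) * t)" for u :: "real ^ 'a" and t
  have cis_meas: "(\<lambda>x. cis (- (2 * pi * (z \<bullet> x)))) \<in> borel_measurable borel"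
    unfolding cis_conv_exp by (intro borel_measurable_continuous_onI continuous_intros)
  have eq: "cis (- (2 * pi * (z \<bullet> (u + t *\<^sub>R axis m 1)))) = f u t" for u t
    by (simp add: f_def inner_add_right inner_axis cis_mult algebra_simps)
  have "(\<lambda>p. cis (- (2 * pi * (z \<bullet> (\<lambda>(u, t). u + t *\<^sub>R axis m 1) p)))) \<in> borel_measurable (sphere_measure I \<Otimes>\<^sub>M \<nu>)"
    by (rule measurable_compose[OF cylinder_map_measurable[OF \<nu>] cis_meas])
  hence f_meas: "case_prod f \<in> borel_measurable (sphere_measure I \<Otimes>\<^sub>M \<nu>)"
    by (simp add: split_beta eq)
  have f_int: "integrable (sphere_measure I \<Otimes>\<^sub>M \<nu>) (case_prod f)"
    by (rule P.integrable_const_bound[where B = 1, OF _ f_meas]) (simp add: f_def split_beta norm_mult)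
  have "fourier_transform (cylinder_measure I m \<nu>) z = (\<integral>x. cis (- (2 * pi * (z \<bullet> x))) \<partial>cylinder_measure I m \<nu>)"
    by (simp only: fourier_transform_def exp_two_pi_cis)
  also have "\<dots> = (\<integral>p. cis (- (2 * pi * (z \<bullet> (\<lambda>(u, t). u + t *\<^sub>R axis m 1) p))) \<partial>(sphere_measure I \<Otimes>\<^sub>M \<nu>))"
    unfolding cylinder_measure_def by (rule integral_distr[OF cylinder_map_measurable[OF \<nu>] cis_meas])
  also have "\<dots> = (\<integral>p. case_prod f p \<partial>(sphere_measure I \<Otimes>\<^sub>M \<nu>))" by (simp add: split_beta eq)
  also have "\<dots> = (\<integral>u. (\<integral>t. f u t \<partial>\<nu>) \<partial>sphere_measure I)"
    using P.integral_fst'[OF f_int] by simp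
  also have "\<dots> = (\<integral>u. cis (- (2 * pi * (z \<bullet> u))) * char \<nu> (- (2 * pi * z $ m)) \<partial>sphere_measure I)"
    by (simp add: f_def char_def cis_conv_exp)
  also have "\<dots> = sphere_ft I z * char \<nu> (- (2 * pi * z $ m))"
    by (rule integral_mult_left_zero)
  finally show ?thesis .
qed

lemma fourier_spectrum_geI:
  fixes \<mu> :: "'a::euclidean_space measure"
  assumes \<mu>: "\<mu> \<in> measures_on E" and b: "b \<le> real DIM('a)"
    and fin: "\<And>s. 0 < s \<Longrightarrow> s < b \<Longrightarrow> fourier_energy s \<theta> \<mu> < \<infinity>"
  shows "ennreal b \<le> fourier_spectrum \<theta> E"
proof -
  have "ennreal b \<le> fourier_spectrum_measure \<theta> \<mu>"
  proof (rule dense_le)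
    fix y assume y: "y < ennreal b"
    then obtain r where r: "y = ennreal r" "0 \<le> r" by (cases y) auto
    have rb: "r < b" using y r by (simp add: ennreal_less_iff)
    define s where "s = (r + b) / 2"
    have s: "0 < s" "s < b" "r \<le> s" using r(2) rb by (auto simp: s_def)
    have "ennreal s \<le> fourier_spectrum_measure \<theta> \<mu>"
      unfolding fourier_spectrum_measure_def using s fin by (intro SUP_upper) auto
    thus "y \<le> fourier_spectrum_measure \<theta> \<mu>" using r s by (auto intro: order_trans ennreal_leI)
  qed
  moreover have "ennreal b \<le> of_nat DIM('a)" using ennreal_leI[OF b] by simp
  ultimately have "ennreal b \<le> min (fourier_spectrum_measure \<theta> \<mu>) (of_nat DIM('a))" by simp
  also have "\<dots> \<le> fourier_spectrum \<theta> E"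
    unfolding fourier_spectrum_def using \<mu> by (rule SUP_upper)
  finally show ?thesis .
qed

text \<open>
For \<open>\<theta> = 0\<close> the first of the three terms vanishes. Otherwise the decay of the two factors is exactly what
\<open>energy_integral_finite\<close> asks for.
\<close>

lemma fourier_spectrum_cylinder:
  fixes I :: "'n::finite set"
  assumes I: "card I = k" "k \<ge> 2" and m: "m \<notin> I" and k2: "CARD('n) = k + k2 + 1" "k2 \<ge> 1"
    and \<alpha>: "0 < \<alpha>" "\<alpha> < 1 / 2" and \<theta>: "0 \<le> \<theta>" "\<theta> \<le> 1"
    and \<nu>: "real_distribution \<nu>" and C: "compact C" "AE t in \<nu>. t \<in> C"
    and decay: "\<And>\<epsilon>. \<epsilon> > 0 \<Longrightarrow> \<exists>K. \<forall>t. cmod (char \<nu> (- (2 * pi * t))) \<le> K * (1 + \<bar>t\<bar>) powr (- \<alpha> / 2 + \<epsilon>)"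
  shows "fourier_spectrum \<theta> (cylinder I m C) \<ge> ennreal (Min {(real k + 1) * \<theta>, real k * \<theta> + \<alpha>, real k - 1 + \<alpha>})"
proof (cases "\<theta> = 0")
  case True
  hence "Min {(real k + 1) * \<theta>, real k * \<theta> + \<alpha>, real k - 1 + \<alpha>} \<le> 0" by (simp add: min_le_iff_disj)
  thus ?thesis by (simp add: ennreal_neg)
next
  case False
  hence \<theta>0: "0 < \<theta>" using \<theta> by simp
  have ne: "I \<noteq> {}" using I by auto
  define \<mu> where "\<mu> = cylinder_measure I m \<nu>"
  interpret \<mu>: prob_space \<mu> unfolding \<mu>_def by (rule cylinder_measure_in_measures_on(1)[OF ne \<nu> C])
  obtain K1 where K1: "K1 > 0" "\<And>z. cmod (sphere_ft I z)
     \<le> K1 * (1 + norm (coord_proj I z)) powr (- (real k - 1) / 2)"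
    using sphere_measure_ft_decay[of I] I by auto
  show ?thesis
  proof (rule fourier_spectrum_geI[where \<mu> = \<mu>])
    show "\<mu> \<in> measures_on (cylinder I m C)"
      unfolding \<mu>_def by (rule cylinder_measure_in_measures_on(2)[OF ne \<nu> C])
    have "(real k + 1) * \<theta> \<le> (real k + 1) * 1" using \<theta> by (intro mult_left_mono) auto
    also have "\<dots> \<le> real DIM(real ^ 'n)" using k2 by simp
    finally show "Min {(real k + 1) * \<theta>, real k * \<theta> + \<alpha>, real k - 1 + \<alpha>} \<le> real DIM(real ^ 'n)"
      by (rule order_trans[OF Min_le, rotated 2]) auto
    fix s assume s: "0 < s" "s < Min {(real k + 1) * \<theta>, real k * \<theta> + \<alpha>, real k - 1 + \<alpha>}"
    have "(\<integral>\<^sup>+z. ennreal (cmod (fourier_transform \<mu> z) powr (2 / \<theta>) * norm z powr (s / \<theta> - real CARD('n))) \<partial>lborel) < \<infinity>"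
    proof (rule energy_integral_finite[OF I m k2 \<alpha> \<theta>0 \<theta>(2)])
      show "cmod (fourier_transform \<mu> z) \<le> 1" for z
      proof -
        have "cmod (fourier_transform \<mu> z) \<le> (\<integral>x. cmod (cis (- (2 * pi * (z \<bullet> x)))) \<partial>\<mu>)"
          unfolding fourier_transform_def exp_two_pi_cis by (rule integral_norm_bound)
        thus ?thesis by (simp add: \<mu>.prob_space)
      qed
      show "\<exists>K. \<forall>z. cmod (fourier_transform \<mu> z) \<le> K * (1 + norm (coord_proj I z)) powr (- (real k - 1) / 2) * (1 + \<bar>z $ m\<bar>) powr (- \<alpha> / 2 + \<epsilon>)"
        if e: "\<epsilon> > 0" for \<epsilon>
      proof -
        obtain K2 where K2: "\<And>t. cmod (char \<nu> (- (2 * pi * t))) \<le> K2 * (1 + \<bar>t\<bar>) powr (- \<alpha> / 2 + \<epsilon>)"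
          using decay[OF e] by blast
        have "cmod (fourier_transform \<mu> z) \<le> (K1 * K2) * (1 + norm (coord_proj I z)) powr (- (real k - 1) / 2) * (1 + \<bar>z $ m\<bar>) powr (- \<alpha> / 2 + \<epsilon>)" for z
        proof -
          have "cmod (fourier_transform \<mu> z) \<le> (K1 * (1 + norm (coord_proj I z)) powr (- (real k - 1) / 2)) * (K2 * (1 + \<bar>z $ m\<bar>) powr (- \<alpha> / 2 + \<epsilon>))"
            unfolding \<mu>_def fourier_transform_cylinder_measure[OF ne \<nu>] norm_mult
            using K1 by (intro mult_mono K1(2) K2) auto
          thus ?thesis by (simp only: mult_ac)
        qed
        thus ?thesis by blast
      qed
    qed (use s in auto)
    thus "fourier_energy s \<theta> \<mu> < \<infinity>"
      using False by (simp add: fourier_energy_def ennreal_power_def)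
  qed
qed

section \<open>Dimension of the distance set\<close>

lemma hausdorff_premeasure_le_finite_cover:
  assumes T: "finite T" and D: "D \<subseteq> (\<Union>p\<in>T. U p)" and U: "\<And>p. p \<in> T \<Longrightarrow> bounded (U p)" "\<And>p. p \<in> T \<Longrightarrow> diameter (U p) \<le> r"
    and r: "0 \<le> r" "r \<le> \<delta>" and s: "s > 0"
  shows "hausdorff_premeasure s \<delta> D \<le> ennreal (real (card T) * r powr s)"
proof -
  obtain f where f: "bij_betw f {..<card T} T" using ex_bij_betw_nat_finite[OF T] atLeast0LessThan by metis
  define V where "V i = (if i < card T then U (f i) else {})" for i
  have fT: "f i \<in> T" if "i < card T" for i using f that by (auto simp: bij_betw_def)
  have D': "D \<subseteq> (\<Union>i. V i)"
  proof
    fix x assume "x \<in> D"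
    then obtain p where p: "p \<in> T" "x \<in> U p" using D by blast
    then obtain i where "i < card T" "p = f i" using f by (auto simp: bij_betw_def)
    thus "x \<in> (\<Union>i. V i)" using p by (auto simp: V_def)
  qed
  have V: "bounded (V i) \<and> diameter (V i) \<le> \<delta>" for i
    using U fT r by (auto simp: V_def diameter_empty intro: order_trans)
  have "hausdorff_premeasure s \<delta> D \<le> (\<Sum>i. diam_power s (V i))"
    unfolding hausdorff_premeasure_def by (rule INF_lower) (use D' V in auto)
  also have "\<dots> = (\<Sum>i<card T. diam_power s (V i))"
    by (rule suminf_finite) (auto simp: V_def diam_power_def)
  also have "\<dots> \<le> (\<Sum>i<card T. ennreal (r powr s))"
  proof (rule sum_mono)
    fix i assume "i \<in> {..<card T}"
    hence "bounded (V i)" "diameter (V i) \<le> r" using U fT by (auto simp: V_def)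
    thus "diam_power s (V i) \<le> ennreal (r powr s)"
      using s by (auto simp: diam_power_def intro!: ennreal_leI powr_mono2 diameter_ge_0)
  qed
  also have "\<dots> = ennreal (real (card T) * r powr s)"
    by (simp add: ennreal_of_nat_eq_real_of_nat ennreal_mult[symmetric])
  finally show ?thesis .
qed



lemma hausdorff_dim_leI:
  assumes "0 \<le> a" and null: "\<And>s. a < s \<Longrightarrow> hausdorff_measure s D = 0"
  shows "hausdorff_dim D \<le> ennreal a"
proof (rule ennreal_le_epsilon)
  fix e :: real assume e: "e > 0"
  have "hausdorff_dim D \<le> ennreal (a + e)"
    unfolding hausdorff_dim_def by (rule INF_lower) (use null[of "a + e"] e assms(1) in auto)
  thus "hausdorff_dim D \<le> ennreal a + ennreal e" using e assms(1) by simp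
qed

lemma kaufman_level_near_rational:
  assumes \<alpha>: "0 < \<alpha>" "\<alpha> < 1 / 2" and Q: "Q \<ge> 2" and x: "x \<in> kaufman_level \<alpha> Q"
  shows "\<exists>q\<in>{Q..<2*Q}. \<exists>a\<in>{- 2 * int Q..2 * int Q}. \<bar>x - real_of_int a / real q\<bar> \<le> real Q powr (- 2 / \<alpha>)"
proof -
  obtain q where q: "q \<in> {Q..<2*Q}" "int_dist (real q * x) \<le> comb_width \<alpha> Q" and x1: "\<bar>x\<bar> \<le> 1"
    using x by (auto simp: kaufman_level_def abs_le_iff)
  define a where "a = round (real q * x)"
  have q0: "q > 0" "real Q \<le> real q" using q Q by auto
  have "\<bar>real q * x\<bar> \<le> real q" using x1 mult_left_mono[of "\<bar>x\<bar>" 1 "real q"] by (simp add: abs_mult)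
  moreover have "\<bar>real q * x - of_int a\<bar> \<le> 1 / 2" using int_dist_le_half[of "real q * x"] by (simp add: int_dist_def a_def)
  moreover have "real q \<le> 2 * real Q - 1" using q(1) by (simp add: of_nat_diff)
  ultimately have "\<bar>real_of_int a\<bar> \<le> 2 * real Q" by linarith
  hence a: "a \<in> {- 2 * int Q..2 * int Q}" by auto
  have "\<bar>x - real_of_int a / real q\<bar> = \<bar>real q * x - of_int a\<bar> / real q"
    using q0 by (simp add: abs_divide[symmetric] field_simps)
  also have "\<dots> \<le> comb_width \<alpha> Q / real q"
    using q(2) q0 by (intro divide_right_mono) (auto simp: int_dist_def a_def)
  also have "\<dots> \<le> comb_width \<alpha> Q / real Q"
    using q0 Q by (intro divide_left_mono) (auto simp: comb_width_def)
  also have "\<dots> = real Q powr (- 2 / \<alpha>)"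
    using Q by (simp add: comb_width_def powr_diff powr_minus field_simps)
  finally show ?thesis using q(1) a by blast
qed

text \<open>
\<open>sqrt (2 + w\<^sup>2)\<close> is the modulus of the complex number with real part \<open>sqrt 2\<close> and imaginary part \<open>w\<close>.
\<close>

lemma sqrt_two_plus_square_lipschitz: "\<bar>sqrt (2 + w\<^sup>2) - sqrt (2 + c\<^sup>2)\<bar> \<le> \<bar>w - c\<bar>"
proof -
  have "\<bar>cmod (Complex (sqrt 2) w) - cmod (Complex (sqrt 2) c)\<bar> \<le> cmod (Complex (sqrt 2) w - Complex (sqrt 2) c)"
    by (rule norm_triangle_ineq3)
  thus ?thesis by (simp add: cmod_def)
qed

text \<open>
At each scale, replacing \<open>s\<close> and \<open>t\<close> by nearby fractions covers the set by at most \<open>25 * Q ^ 4\<close>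
intervals of length \<open>4 * Q powr (- 2 / \<alpha>)\<close>, and \<open>4 - 2 * s / \<alpha> < 0\<close> for an exponent \<open>s > 2 * \<alpha>\<close>.
\<close>

lemma hausdorff_dim_kaufman_distances:
  assumes \<alpha>: "0 < \<alpha>" "\<alpha> < 1 / 2" and Q: "\<And>n. n \<le> Q n" "\<And>n. 2 \<le> Q n"
    and D: "D \<subseteq> {sqrt (2 + (s - t)\<^sup>2) | s t. (\<forall>n. s \<in> kaufman_level \<alpha> (Q n)) \<and> (\<forall>n. t \<in> kaufman_level \<alpha> (Q n))}"
  shows "hausdorff_dim D \<le> ennreal (2 * \<alpha>)"
proof (rule hausdorff_dim_leI)
  fix s assume s: "2 * \<alpha> < s"
  have s0: "s > 0" using s \<alpha> by simp
  define \<rho> where "\<rho> n = real (Q n) powr (- 2 / \<alpha>)" for n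
  have cover: "hausdorff_premeasure s \<delta> D \<le> ennreal (25 * 4 powr s * real (Q n) powr (4 - 2 * s / \<alpha>))" if \<delta>: "4 * \<rho> n \<le> \<delta>" for n \<delta>
  proof -
    define T where "T = {Q n..<2 * Q n} \<times> {- 2 * int (Q n)..2 * int (Q n)}"
    define y where "y p = real_of_int (snd p) / real (fst p)" for p :: "nat \<times> int"
    define U where "U pp = cball (sqrt (2 + (y (fst pp) - y (snd pp))\<^sup>2)) (2 * \<rho> n)" for pp
    have \<rho>0: "\<rho> n \<ge> 0" by (simp add: \<rho>_def)
    have near: "\<exists>p\<in>T. \<bar>u - y p\<bar> \<le> \<rho> n" if u: "u \<in> kaufman_level \<alpha> (Q n)" for u
    proof -
      obtain q a where "q \<in> {Q n..<2 * Q n}" "a \<in> {- 2 * int (Q n)..2 * int (Q n)}"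
        "\<bar>u - real_of_int a / real q\<bar> \<le> real (Q n) powr (- 2 / \<alpha>)"
        using kaufman_level_near_rational[OF \<alpha> Q(2) u] by blast
      thus ?thesis by (intro bexI[of _ "(q, a)"]) (simp_all add: T_def y_def \<rho>_def)
    qed
    have "D \<subseteq> (\<Union>pp\<in>T \<times> T. U pp)"
    proof
      fix d assume "d \<in> D"
      then obtain u v where d: "d = sqrt (2 + (u - v)\<^sup>2)" and uv: "u \<in> kaufman_level \<alpha> (Q n)" "v \<in> kaufman_level \<alpha> (Q n)"
        using D by blast
      obtain p where p: "p \<in> T" "\<bar>u - y p\<bar> \<le> \<rho> n"
        using near[OF uv(1)] by blast
      obtain p' where p': "p' \<in> T" "\<bar>v - y p'\<bar> \<le> \<rho> n"
        using near[OF uv(2)] by blast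
      have "\<bar>d - sqrt (2 + (y p - y p')\<^sup>2)\<bar> \<le> \<bar>(u - v) - (y p - y p')\<bar>"
        unfolding d by (rule sqrt_two_plus_square_lipschitz)
      also have "\<dots> \<le> 2 * \<rho> n" using p p' by linarith
      finally have "d \<in> U (p, p')" by (simp add: U_def dist_real_def abs_minus_commute)
      thus "d \<in> (\<Union>pp\<in>T \<times> T. U pp)" using p p' by blast
    qed
    moreover have "finite (T \<times> T)" by (simp add: T_def)
    moreover have "bounded (U pp)" "diameter (U pp) \<le> 4 * \<rho> n" for pp
      using \<rho>0 by (simp_all add: U_def diameter_cball)
    ultimately have "hausdorff_premeasure s \<delta> D \<le> ennreal (real (card (T \<times> T)) * (4 * \<rho> n) powr s)"
      using \<rho>0 \<delta> s0 by (intro hausdorff_premeasure_le_finite_cover) auto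
    also have "\<dots> \<le> ennreal (25 * 4 powr s * real (Q n) powr (4 - 2 * s / \<alpha>))"
    proof (rule ennreal_leI)
      define x where "x = real (Q n)"
      have x2: "x \<ge> 2" using Q(2)[of n] by (simp add: x_def)
      have "real (card T) = x * (4 * x + 1)" by (simp add: T_def card_cartesian_product x_def)
      also have "\<dots> \<le> x * (5 * x)" using x2 by (intro mult_left_mono) auto
      finally have T: "real (card T) \<le> 5 * x\<^sup>2" by (simp add: power2_eq_square)
      have "real (card (T \<times> T)) \<le> (5 * x\<^sup>2) * (5 * x\<^sup>2)"
        unfolding card_cartesian_product of_nat_mult by (intro mult_mono T) auto
      also have "\<dots> = 25 * x powr 4" using x2 by (simp add: power2_eq_square power4_eq_xxxx)
      finally have "real (card (T \<times> T)) * (4 * \<rho> n) powr s \<le> (25 * x powr 4) * (4 * \<rho> n) powr s"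
        by (intro mult_right_mono) auto
      moreover have "(25 * x powr 4) * (4 * \<rho> n) powr s = 25 * 4 powr s * real (Q n) powr (4 - 2 * s / \<alpha>)"
      proof -
        have "(4 * \<rho> n) powr s = 4 powr s * x powr (- (2 * s / \<alpha>))"
          by (simp add: \<rho>_def x_def powr_mult powr_powr)
        moreover have "x powr 4 * x powr (- (2 * s / \<alpha>)) = x powr (4 - 2 * s / \<alpha>)"
          unfolding powr_add[symmetric] by simp
        ultimately show ?thesis by (simp add: x_def)
      qed
      ultimately show "real (card (T \<times> T)) * (4 * \<rho> n) powr s \<le> 25 * 4 powr s * real (Q n) powr (4 - 2 * s / \<alpha>)"
        by simp
    qed
    finally show ?thesis .
  qed
  have Q_lim: "filterlim (\<lambda>n. real (Q n)) at_top sequentially"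
    by (rule filterlim_at_top_mono[OF filterlim_real_sequentially]) (use Q(1) in auto)
  have exponent: "2 * s / \<alpha> > 4" using s \<alpha> by (simp add: field_simps)
  have "hausdorff_premeasure s \<delta> D = 0" if \<delta>: "\<delta> > 0" for \<delta>
  proof -
    have le: "hausdorff_premeasure s \<delta> D \<le> 0 + ennreal e" if e: "e > 0" for e
    proof -
      have "((\<lambda>n. 25 * 4 powr s * real (Q n) powr (4 - 2 * s / \<alpha>)) \<longlongrightarrow> 25 * 4 powr s * 0) sequentially"
        by (intro tendsto_mult tendsto_const tendsto_neg_powr Q_lim) (use exponent in auto)
      hence "\<forall>\<^sub>F n in sequentially. 25 * 4 powr s * real (Q n) powr (4 - 2 * s / \<alpha>) < e"
        using e by (intro order_tendstoD(2)[where y = "25 * 4 powr s * 0"]) auto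
      moreover have "((\<lambda>n. 4 * \<rho> n) \<longlongrightarrow> 4 * 0) sequentially"
        unfolding \<rho>_def by (intro tendsto_mult tendsto_const tendsto_neg_powr Q_lim) (use \<alpha> in auto)
      hence "\<forall>\<^sub>F n in sequentially. 4 * \<rho> n < \<delta>"
        using \<delta> by (intro order_tendstoD(2)[where y = "4 * 0"]) auto
      ultimately have "\<forall>\<^sub>F n in sequentially. 25 * 4 powr s * real (Q n) powr (4 - 2 * s / \<alpha>) < e \<and> 4 * \<rho> n < \<delta>"
        by (rule eventually_conj)
      then obtain n where n: "25 * 4 powr s * real (Q n) powr (4 - 2 * s / \<alpha>) < e" "4 * \<rho> n < \<delta>"
        using eventually_happens'[OF sequentially_bot] by blast
      have "hausdorff_premeasure s \<delta> D \<le> ennreal (25 * 4 powr s * real (Q n) powr (4 - 2 * s / \<alpha>))"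
        by (rule cover) (use n in simp)
      also have "\<dots> \<le> ennreal e" using n by (intro ennreal_leI) simp
      finally show ?thesis by simp
    qed
    have "hausdorff_premeasure s \<delta> D \<le> 0" by (rule ennreal_le_epsilon) (rule le)
    thus ?thesis by simp
  qed
  hence "hausdorff_measure s D \<le> 0" unfolding hausdorff_measure_def by (intro SUP_least) simp
  thus "hausdorff_measure s D = 0" by simp
qed (use \<alpha> in simp)

text \<open>
The three parts \<open>u\<close>, \<open>v\<close> and \<open>(s - t) *\<^sub>R axis m 1\<close> of the difference are pairwise orthogonal, and the
first two have norm 1.
\<close>

lemma distance_set_cylinders:
  fixes I1 I2 :: "'n::finite set"
  assumes I: "I1 \<inter> I2 = {}" "m \<notin> I1" "m \<notin> I2"
  shows "distance_set (cylinder I1 m C) (cylinder I2 m C) \<subseteq> {sqrt (2 + (s - t)\<^sup>2) | s t. s \<in> C \<and> t \<in> C}"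
proof
  fix d assume "d \<in> distance_set (cylinder I1 m C) (cylinder I2 m C)"
  then obtain u v s t where d: "d = norm ((u + s *\<^sub>R axis m 1) - (v + t *\<^sub>R axis m 1))"
    and u: "norm u = 1" "coord_proj I1 u = u" and v: "norm v = 1" "coord_proj I2 v = v" and st: "s \<in> C" "t \<in> C"
    by (auto simp: distance_set_def cylinder_def)
  have uv: "u \<bullet> v = 0"
  proof -
    have "u \<bullet> v = u \<bullet> coord_proj I1 (coord_proj I2 v)" using inner_coord_proj[of I1 u v] u v by simp
    also have "coord_proj I1 (coord_proj I2 v) = 0" using I by (auto simp: vec_eq_iff)
    finally show ?thesis by simp
  qed
  have "u $ m = coord_proj I1 u $ m" "v $ m = coord_proj I2 v $ m" using u v by simp_all
  hence um: "u $ m = 0" "v $ m = 0" using I by simp_all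
  have "u \<bullet> u = 1" "v \<bullet> v = 1" using u v by (simp_all add: power2_norm_eq_inner[symmetric])
  hence "((u - v) + (s - t) *\<^sub>R axis m 1) \<bullet> ((u - v) + (s - t) *\<^sub>R axis m 1) = 2 + (s - t)\<^sup>2"
    using uv um inner_commute[of v u]
    by (simp add: inner_add_left inner_add_right inner_diff_left inner_diff_right inner_axis inner_axis' power2_eq_square)
  moreover have "(u + s *\<^sub>R axis m 1) - (v + t *\<^sub>R axis m 1) = (u - v) + (s - t) *\<^sub>R axis m (1::real)"
    by (simp add: scaleR_diff_left)
  ultimately have "d = sqrt (2 + (s - t)\<^sup>2)" by (simp only: d norm_eq_sqrt_inner)
  thus "d \<in> {sqrt (2 + (s - t)\<^sup>2) | s t. s \<in> C \<and> t \<in> C}" using st by blast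
qed

theorem proposition3p2:
  fixes k1 k2 :: nat and \<alpha> :: real
  assumes "k1 \<ge> 2" and "k2 \<ge> 2"
    and "CARD('n::finite) = k1 + k2 + 1"
    and "0 < \<alpha>" and "\<alpha> < 1 / 2"
  shows "\<exists>E F :: (real ^ 'n) set. compact E \<and> compact F \<and>
    (hausdorff_dim (distance_set E F) \<le> ennreal (2 * \<alpha>) \<and> 2 * \<alpha> < 1) \<and>
    (\<forall>\<theta>\<in>{0..1}.
       fourier_spectrum \<theta> E \<ge>
         ennreal (Min {(real k1 + 1) * \<theta>, real k1 * \<theta> + \<alpha>, real k1 - 1 + \<alpha>}) \<and>
       fourier_spectrum \<theta> F \<ge>
         ennreal (Min {(real k2 + 1) * \<theta>, real k2 * \<theta> + \<alpha>, real k2 - 1 + \<alpha>}))"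
proof -
  obtain I1 :: "'n set" where I1: "card I1 = k1"
    using obtain_subset_with_card_n[of k1 "UNIV :: 'n set"] assms(3) by auto
  have "card (- I1) = k2 + 1" using I1 assms(3) by (simp add: Compl_eq_Diff_UNIV card_Diff_subset)
  then obtain I2 where I2: "I2 \<subseteq> - I1" "card I2 = k2"
    using obtain_subset_with_card_n[of k2 "- I1"] by auto
  have "card (- I1 - I2) = 1" using I2 \<open>card (- I1) = k2 + 1\<close> by (simp add: card_Diff_subset)
  then obtain m where "m \<in> - I1 - I2" by (metis card.empty equals0I zero_neq_one)
  hence m: "m \<notin> I1" "m \<notin> I2" by auto
  from salem_measure[OF assms(4,5)] obtain Q \<nu> where Q: "\<forall>n. n \<le> Q n \<and> 2 \<le> Q n" and \<nu>: "real_distribution \<nu>"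
    and ae: "AE x in \<nu>. \<forall>n. x \<in> kaufman_level \<alpha> (Q n)"
    and decay: "\<forall>\<epsilon>>0. \<exists>K. \<forall>t. cmod (char \<nu> (- (2 * pi * t))) \<le> K * (1 + \<bar>t\<bar>) powr (- \<alpha> / 2 + \<epsilon>)"
    by (elim exE conjE)
  define C where "C = (\<Inter>n. kaufman_level \<alpha> (Q n))"
  have "closed C" unfolding C_def by (intro closed_INT ballI closed_kaufman_level)
  hence "compact ({-1..1} \<inter> C)" by (rule compact_Int_closed[OF compact_Icc])
  moreover have "{-1..1} \<inter> C = C" by (auto simp: C_def kaufman_level_def)
  ultimately have C: "compact C" by (simp only:)
  have aeC: "AE x in \<nu>. x \<in> C" using ae by (simp add: C_def)
  show ?thesis
  proof (intro exI conjI ballI)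
    show "compact (cylinder I1 m C)" "compact (cylinder I2 m C)" by (rule compact_cylinder[OF C])+
    show "2 * \<alpha> < 1" using assms(5) by simp
    have "distance_set (cylinder I1 m C) (cylinder I2 m C) \<subseteq> {sqrt (2 + (s - t)\<^sup>2) | s t. s \<in> C \<and> t \<in> C}"
      by (rule distance_set_cylinders) (use I2(1) m in auto)
    thus "hausdorff_dim (distance_set (cylinder I1 m C) (cylinder I2 m C)) \<le> ennreal (2 * \<alpha>)"
      by (intro hausdorff_dim_kaufman_distances[OF assms(4,5), of Q]) (use Q in \<open>auto simp: C_def\<close>)
    fix \<theta> :: real assume "\<theta> \<in> {0..1}"
    hence \<theta>: "0 \<le> \<theta>" "\<theta> \<le> 1" by auto
    show "fourier_spectrum \<theta> (cylinder I1 m C) \<ge> ennreal (Min {(real k1 + 1) * \<theta>, real k1 * \<theta> + \<alpha>, real k1 - 1 + \<alpha>})"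
      by (rule fourier_spectrum_cylinder[OF I1 assms(1) m(1) assms(3) _ assms(4,5) \<theta> \<nu> C aeC decay[rule_format]]) (use assms(2) in auto)
    show "fourier_spectrum \<theta> (cylinder I2 m C) \<ge> ennreal (Min {(real k2 + 1) * \<theta>, real k2 * \<theta> + \<alpha>, real k2 - 1 + \<alpha>})"
      by (rule fourier_spectrum_cylinder[OF I2(2) assms(2) m(2) _ _ assms(4,5) \<theta> \<nu> C aeC decay[rule_format], where ?k2.0 = k1]) (use assms in auto)
  qed
qed

end
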